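(* Fix $\gamma\in[0,1/2)$ and let $\beta_c=\frac14-\frac\gamma2$. There exist constants $c,C>0$ such that for all integers $k\ge2$ and any sequence $(\beta_n)_{n\ge1}$ of positive reals tending to $\beta_c$, the limit below exists and $$\frac{c}{k(\log k)^2}\le\lim_{n\to\infty}\mathbb P^{\beta_n}\big(|\mathscr C_n(O_n)|\ge k\big)\le\frac{C}{k(\log k)^2}.$$
   Context: $\gamma$-growing random graph with parameter $\beta>0$: the random graph $\mathscr G_n$ on vertex set $[n]=\{1,\dots,n\}$ in which, independently over pairs $i<j$, the edge $\{i,j\}$ is present with probability $p_{ij}=\min(\beta\, i^{-\gamma}j^{\gamma-1},1)$; $\mathbb P^\beta$ denotes its law. Under $\mathbb P^{\beta_n}$ all edges of $\mathscr G_n$ are generated with $\beta=\beta_n$. $\mathscr C_n(v)$ is the connected component of $v$ in $\mathscr G_n$, $|\mathscr C_n(v)|$ its number of vertices, and $O_n$ is a vertex chosen uniformly at random from $[n]$, independently of the graph. *)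

theory Defs
  imports "HOL-Probability.Probability"
begin

definition edge_prob :: "real \<Rightarrow> real \<Rightarrow> nat \<Rightarrow> nat \<Rightarrow> real" where
  "edge_prob \<gamma> \<beta> i j = min (\<beta> * real i powr (- \<gamma>) * real j powr (\<gamma> - 1)) 1"

definition vertex_pairs :: "nat \<Rightarrow> (nat \<times> nat) set" where
  "vertex_pairs n = {(i, j). 1 \<le> i \<and> i < j \<and> j \<le> n}"

text \<open>A graph on the vertex set \<open>{1..n}\<close> is represented by its set of edges, each edge being a
  two-element set of vertices. The product distribution makes the edge indicators independent over
  the pairs \<open>i < j\<close>; outside \<open>vertex_pairs n\<close> they take the default value \<open>False\<close>.\<close>

definition growing_graph :: "real \<Rightarrow> real \<Rightarrow> nat \<Rightarrow> nat set set pmf" where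
  "growing_graph \<gamma> \<beta> n =
     map_pmf (\<lambda>X. {{i, j} | i j. (i, j) \<in> vertex_pairs n \<and> X (i, j)})
       (Pi_pmf (vertex_pairs n) False (\<lambda>(i, j). bernoulli_pmf (edge_prob \<gamma> \<beta> i j)))"

definition component :: "nat \<Rightarrow> nat set set \<Rightarrow> nat \<Rightarrow> nat set" where
  "component n E v = {w \<in> {1..n}. (v, w) \<in> {(x, y). {x, y} \<in> E}\<^sup>*}"

text \<open>The joint law of the random graph and the independent uniform vertex is a product. It is
  meaningful only for \<open>n \<ge> 1\<close>, since \<open>pmf_of_set {}\<close> is unspecified.\<close>

definition cluster_tail :: "real \<Rightarrow> real \<Rightarrow> nat \<Rightarrow> nat \<Rightarrow> real" where
  "cluster_tail \<gamma> \<beta> n k =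
     measure_pmf.prob (pair_pmf (growing_graph \<gamma> \<beta> n) (pmf_of_set {1..n}))
       {(E, v). k \<le> card (component n E v)}"

end

theory Submission
  imports Defs
begin

text \<open>
  In logarithmic coordinates \<open>x = ln (n / v)\<close> the local limit of the graph at \<open>\<beta>\<^sub>c\<close> is a critical branching
  random walk killed on the negative axis, whose displacement kernel is, after an exponential tilt, the
  two-sided exponential kernel \<open>(a / 2) exp (- a \<bar>x - y\<bar>)\<close> with \<open>a = 1 / 2 - \<gamma>\<close>. This kernel is a Green's function,
  so the generating function of the total progeny \<open>T\<close> solves a second order differential equation. A comparison
  analysis of that equation as \<open>s\<close> tends to \<open>1\<close> yields \<open>E (1 - s\<^sup>T)\<^sup>2\<close> of order \<open>(1 - s) / (ln (1 / (1 - s)))\<^sup>2\<close>, and the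
  tail bounds follow by an elementary Tauberian argument.

  For the finite graphs, exploring one vertex at a time gives an exact recursion for \<open>E s\<^sup>|\<^sup>C\<^sup>|\<close>. It dominates
  every product of a supersolution of the branching fixed point equation, and after the removal of the oldest vertices
  it is at most a product of a subsolution up to an error \<open>O (1 / n)\<close>. By concavity of the fixed point
  equation, multiples of the solution \<open>prof s\<close> are strict sub- and supersolutions.
\<close>

section \<open>Exploration of a random graph\<close>

text \<open>The claimed tails are summable, so \<open>T\<close> has finite mean and
  \<open>1 - E s^T\<close> is to leading order linear in \<open>1 - s\<close>; the tail is invisible
  there. The second difference \<open>2 (1 - E s^T) - (1 - E s^(2T)) = E (1 - s^T)^2\<close> cancels
  the linear term and at \<open>s = exp (-1/k)\<close> is comparable to \<open>P (T >= k)\<close>.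
  This is why solutions at \<open>s\<close> and \<open>s^2\<close> are treated as a pair. The
  logarithm is the width \<open>X\<close> of the region where the solution is small. There
  \<open>V = exp (-x/2) g'\<close> falls almost linearly, from order \<open>1 - s\<close> at
  \<open>0\<close> to order \<open>exp (-X/2)\<close> at \<open>X\<close>, where it must join an
  exponential decay. This forces \<open>exp (-X/2)\<close> to be of order
  \<open>(1 - s) / X\<close>, and a Wronskian gives the second difference the order
  \<open>(1 - s) / X^2\<close>. On finite graphs \<open>s < 1\<close> stays fixed while
  \<open>n\<close> grows: the strictness gained from concavity is then a fixed amount, whereas all
  errors, including the distance of \<open>\<beta> n\<close> from the critical value, vanish. The
  limiting tail is recovered from these fixed \<open>s\<close>, and its bounds involve only
  quantities independent of the sequence.\<close>

definition reach :: "'a set set \<Rightarrow> 'a set \<Rightarrow> 'a set \<Rightarrow> 'a set" where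
  "reach E W S = {(x, y). x \<in> W \<and> y \<in> W \<and> {x, y} \<in> E}\<^sup>* `` S"

lemma reach_superset: "S \<subseteq> reach E W S"
  by (auto simp: reach_def)

lemma reach_step: "\<lbrakk>x \<in> reach E W S; x \<in> W; y \<in> W; {x, y} \<in> E\<rbrakk> \<Longrightarrow> y \<in> reach E W S"
  unfolding reach_def by (blast intro: rtrancl_into_rtrancl)

lemma reach_least:
  assumes "S \<subseteq> T" and "\<And>x y. \<lbrakk>x \<in> T; x \<in> W; y \<in> W; {x, y} \<in> E\<rbrakk> \<Longrightarrow> y \<in> T"
  shows "reach E W S \<subseteq> T"
proof -
  have "w \<in> T" if "(v, w) \<in> {(x, y). x \<in> W \<and> y \<in> W \<and> {x, y} \<in> E}\<^sup>*" "v \<in> S" for v w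
    using that by (induction rule: rtrancl_induct) (use assms in auto)
  then show ?thesis by (auto simp: reach_def)
qed

lemma reach_subset: "S \<subseteq> W \<Longrightarrow> reach E W S \<subseteq> W"
  by (rule reach_least) auto

lemma reach_mono: "W \<subseteq> W' \<Longrightarrow> reach E W S \<subseteq> reach E W' S"
  by (intro reach_least) (auto intro: reach_step reach_superset[THEN subsetD])

lemma reach_empty [simp]: "reach E W {} = {}"
  by (simp add: reach_def)

text \<open>A path through \<open>v\<close> can be cut at its last visit to \<open>v\<close>, so
  \<open>v\<close> may be deleted once its neighbours are active. Later steps then never look at an
  edge of \<open>v\<close> again, which is the source of independence in
  \<open>pgf_explore\<close>.\<close>

lemma reach_explore:
  assumes "v \<in> S" "S \<subseteq> W"
  shows "reach E W S = insert v (reach E (W - {v}) (S - {v} \<union> {w \<in> W - {v}. {v, w} \<in> E}))"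
    (is "_ = insert v ?R")
proof (intro equalityI)
  have sub: "?R \<subseteq> W - {v}" using assms by (intro reach_subset) auto
  show "reach E W S \<subseteq> insert v ?R"
  proof (rule reach_least)
    show "S \<subseteq> insert v ?R"
      using reach_superset[of "S - {v} \<union> {w \<in> W - {v}. {v, w} \<in> E}" E "W - {v}"] by auto
  next
    fix x y assume *: "x \<in> insert v ?R" "x \<in> W" "y \<in> W" "{x, y} \<in> E"
    show "y \<in> insert v ?R"
    proof (cases "x = v \<or> y = v")
      case True
      then show ?thesis
        using * reach_superset[of "S - {v} \<union> {w \<in> W - {v}. {v, w} \<in> E}" E "W - {v}"] by auto
    next
      case False
      then show ?thesis using * by (auto intro: reach_step)
    qed
  qed
  have "v \<in> reach E W S" using assms(1) reach_superset[of S E W] by blast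
  moreover have "?R \<subseteq> reach E W S"
  proof (rule reach_least)
    show "S - {v} \<union> {w \<in> W - {v}. {v, w} \<in> E} \<subseteq> reach E W S"
      using assms reach_superset[of S E W] \<open>v \<in> reach E W S\<close>
      by (auto intro: reach_step)
  qed (auto intro: reach_step)
  ultimately show "insert v ?R \<subseteq> reach E W S" by simp
qed

lemma component_eq_reach:
  assumes "\<And>x y. {x, y} \<in> E \<Longrightarrow> x \<in> {1..n} \<and> y \<in> {1..n}" and "v \<in> {1..n}"
  shows "component n E v = reach E {1..n} {v}"
proof -
  have "{(x, y). x \<in> {1..n} \<and> y \<in> {1..n} \<and> {x, y} \<in> E} = {(x, y). {x, y} \<in> E}"
    using assms(1) by blast
  then show ?thesis
    using reach_subset[of "{v}" "{1..n}" E] assms(2) by (auto simp: component_def reach_def)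
qed

section \<open>Expectations under finitely supported product laws\<close>

lemma expectation_mono_finite:
  fixes u v :: "'a \<Rightarrow> real"
  assumes "finite (set_pmf P)" "\<And>x. x \<in> set_pmf P \<Longrightarrow> u x \<le> v x"
  shows "measure_pmf.expectation P u \<le> measure_pmf.expectation P v"
  using assms by (subst (1 2) integral_measure_pmf[OF assms(1)])
    (auto intro!: sum_mono mult_left_mono)

lemma expectation_pair_pmf_finite:
  fixes h :: "'a \<times> 'b \<Rightarrow> real"
  assumes "finite (set_pmf P)" "finite (set_pmf Q)"
  shows "measure_pmf.expectation (pair_pmf P Q) h
    = measure_pmf.expectation P (\<lambda>x. measure_pmf.expectation Q (\<lambda>y. h (x, y)))"
proof -
  have "measure_pmf.expectation (pair_pmf P Q) h
      = (\<Sum>z\<in>set_pmf P \<times> set_pmf Q. pmf (pair_pmf P Q) z * h z)"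
    using assms by (subst integral_measure_pmf[of "set_pmf P \<times> set_pmf Q"]) auto
  also have "\<dots> = (\<Sum>x\<in>set_pmf P. pmf P x * (\<Sum>y\<in>set_pmf Q. pmf Q y * h (x, y)))"
    by (simp add: sum.cartesian_product' pmf_pair sum_distrib_left mult.assoc)
  also have "\<dots> = measure_pmf.expectation P (\<lambda>x. measure_pmf.expectation Q (\<lambda>y. h (x, y)))"
    using assms by (simp add: integral_measure_pmf[of "set_pmf P"] integral_measure_pmf[of "set_pmf Q"])
  finally show ?thesis .
qed

text \<open>The coordinates in \<open>B\<close> and in \<open>A - B\<close> are independent, so the
  second argument may be resampled. Both copies carry the full product law, so the index set stays
  fixed while the exploration shrinks the vertex set.\<close>

lemma expectation_Pi_pmf_indep:
  fixes u :: "('a \<Rightarrow> 'b) \<Rightarrow> ('a \<Rightarrow> 'b) \<Rightarrow> real" and d :: 'b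
  assumes A: "finite A" "B \<subseteq> A" and fin: "\<And>x. x \<in> A \<Longrightarrow> finite (set_pmf (p x))"
    and u1: "\<And>X X' Y. (\<And>x. x \<in> B \<Longrightarrow> X x = X' x) \<Longrightarrow> u X Y = u X' Y"
    and u2: "\<And>X Y Y'. (\<And>x. x \<in> A - B \<Longrightarrow> Y x = Y' x) \<Longrightarrow> u X Y = u X Y'"
  defines "P \<equiv> Pi_pmf A d p"
  shows "measure_pmf.expectation P (\<lambda>X. u X X)
    = measure_pmf.expectation P (\<lambda>X. measure_pmf.expectation P (\<lambda>Y. u X Y))"
proof -
  have finP: "finite (set_pmf P)"
    unfolding P_def using A fin by (subst set_Pi_pmf) (auto intro!: finite_PiE_dflt)
  have "P = Pi_pmf (B \<union> (A - B)) d p" using A by (auto simp: P_def Un_absorb1)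
  also have "\<dots> = map_pmf (\<lambda>(f, g) x. if x \<in> B then f x else g x)
       (pair_pmf (Pi_pmf B d p) (Pi_pmf (A - B) d p))"
    using A by (intro Pi_pmf_union) (auto intro: finite_subset)
  also have "\<dots> = map_pmf (\<lambda>(X, Y) x. if x \<in> B then X x else if x \<in> A - B then Y x else d)
       (pair_pmf P P)"
    unfolding P_def using A
    by (subst Pi_pmf_subset[of A B], simp, simp, subst Pi_pmf_subset[of A "A - B"], simp, simp)
      (auto simp: map_pair[symmetric] pmf.map_comp intro!: map_pmf_cong)
  finally have "P = map_pmf (\<lambda>(X, Y) x. if x \<in> B then X x else if x \<in> A - B then Y x else d)
       (pair_pmf P P)" (is "_ = map_pmf ?m _") .
  then have "measure_pmf.expectation P (\<lambda>X. u X X)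
      = measure_pmf.expectation (map_pmf ?m (pair_pmf P P)) (\<lambda>X. u X X)" by simp
  also have "\<dots> = measure_pmf.expectation (pair_pmf P P) (\<lambda>z. u (?m z) (?m z))" by simp
  also have "(\<lambda>z. u (?m z) (?m z)) = (\<lambda>(X, Y). u X Y)"
  proof (intro ext)
    fix z :: "('a \<Rightarrow> 'b) \<times> ('a \<Rightarrow> 'b)"
    obtain X Y where z: "z = (X, Y)" by fastforce
    have "u (?m z) (?m z) = u X (?m z)" by (rule u1) (simp add: z)
    also have "\<dots> = u X Y" by (rule u2) (simp add: z)
    finally show "u (?m z) (?m z) = (case z of (X, Y) \<Rightarrow> u X Y)" by (simp add: z)
  qed
  also have "measure_pmf.expectation (pair_pmf P P) (\<lambda>(X, Y). u X Y)
      = measure_pmf.expectation P (\<lambda>X. measure_pmf.expectation P (\<lambda>Y. u X Y))"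
    by (subst expectation_pair_pmf_finite[OF finP finP]) simp
  finally show ?thesis .
qed

text \<open>Weierstrass' product inequality applied to \<open>B - A\<close>. In the exploration
  these are the factors of vertices that are already explored or active.\<close>

lemma prod_subset_bounds:
  fixes h :: "'a \<Rightarrow> real"
  assumes "finite B" "A \<subseteq> B" "\<And>x. x \<in> B \<Longrightarrow> 0 \<le> h x \<and> h x \<le> 1"
  shows "prod h B \<le> prod h A" "prod h A \<le> prod h B + (\<Sum>x\<in>B - A. 1 - h x)"
proof -
  have weierstrass: "1 - (\<Sum>x\<in>T. 1 - h x) \<le> prod h T" if "T \<subseteq> B" for T
    using finite_subset[OF that assms(1)] that
  proof (induction T rule: finite_induct)
    case (insert x T)
    have "prod h T \<le> 1" using insert assms(3) by (intro prod_le_1) auto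
    then have "0 \<le> (1 - h x) * (1 - prod h T)"
      using insert assms(3) by (intro mult_nonneg_nonneg) auto
    then show ?case using insert by (simp add: algebra_simps)
  qed simp
  have A: "0 \<le> prod h A" "prod h A \<le> 1" "prod h (B - A) \<le> 1"
    using assms by (auto intro!: prod_nonneg prod_le_1)
  have split: "prod h B = prod h (B - A) * prod h A"
    using assms by (intro prod.subset_diff) auto
  show "prod h B \<le> prod h A"
    unfolding split using A mult_right_mono[of "prod h (B - A)" 1 "prod h A"] by simp
  have "(1 - prod h (B - A)) * prod h A \<le> (1 - prod h (B - A)) * 1"
    using A by (intro mult_left_mono) auto
  then show "prod h A \<le> prod h B + (\<Sum>x\<in>B - A. 1 - h x)"
    unfolding split using weierstrass[of "B - A"] by (simp add: algebra_simps)
qed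

section \<open>Independent edges and the exact exploration recursion\<close>

locale edge_model =
  fixes n :: nat and p :: "nat \<times> nat \<Rightarrow> real"
  assumes p01: "0 \<le> p e" "p e \<le> 1"
begin

definition pr :: "nat \<Rightarrow> nat \<Rightarrow> real" where
  "pr v w = p (min v w, max v w)"

definition edge_pmf :: "(nat \<times> nat \<Rightarrow> bool) pmf" where
  "edge_pmf = Pi_pmf (vertex_pairs n) False (\<lambda>e. bernoulli_pmf (p e))"

definition edges :: "(nat \<times> nat \<Rightarrow> bool) \<Rightarrow> nat set set" where
  "edges X = {{i, j} | i j. (i, j) \<in> vertex_pairs n \<and> X (i, j)}"

definition pgf :: "real \<Rightarrow> nat set \<Rightarrow> nat set \<Rightarrow> real" where
  "pgf s W S = measure_pmf.expectation edge_pmf (\<lambda>X. s ^ card (reach (edges X) W S))"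

lemma pr_bounds [simp]: "0 \<le> pr v w" "pr v w \<le> 1"
  using p01 by (auto simp: pr_def)

lemma finite_vertex_pairs [simp]: "finite (vertex_pairs n)"
  by (rule finite_subset[of _ "{1..n} \<times> {1..n}"]) (auto simp: vertex_pairs_def)

lemma finite_edge_pmf [simp]: "finite (set_pmf edge_pmf)"
  unfolding edge_pmf_def by (subst set_Pi_pmf) (auto intro!: finite_PiE_dflt)

lemma edges_iff:
  "{v, w} \<in> edges X \<longleftrightarrow> (min v w, max v w) \<in> vertex_pairs n \<and> X (min v w, max v w)"
proof
  assume "{v, w} \<in> edges X"
  then obtain i j where ij: "{v, w} = {i, j}" "(i, j) \<in> vertex_pairs n" "X (i, j)"
    by (auto simp: edges_def)
  then have "min v w = i" "max v w = j"
    by (auto simp: doubleton_eq_iff vertex_pairs_def)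
  with ij show "(min v w, max v w) \<in> vertex_pairs n \<and> X (min v w, max v w)" by simp
next
  assume "(min v w, max v w) \<in> vertex_pairs n \<and> X (min v w, max v w)"
  moreover have "{v, w} = {min v w, max v w}" by (auto simp: min_def max_def)
  ultimately show "{v, w} \<in> edges X" unfolding edges_def by blast
qed

lemma pgf_empty [simp]: "pgf s W {} = 1"
  by (simp add: pgf_def)

lemma pgf_bounds: "0 \<le> s \<Longrightarrow> s \<le> 1 \<Longrightarrow> 0 \<le> pgf s W S" "0 \<le> s \<Longrightarrow> s \<le> 1 \<Longrightarrow> pgf s W S \<le> 1"
proof -
  assume s: "0 \<le> s" "s \<le> 1"
  have "measure_pmf.expectation edge_pmf (\<lambda>X. s ^ card (reach (edges X) W S))
      \<le> measure_pmf.expectation edge_pmf (\<lambda>X. 1)"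
    using s by (intro expectation_mono_finite) (auto intro: power_le_one)
  then show "pgf s W S \<le> 1" by (simp add: pgf_def)
  show "0 \<le> pgf s W S" using s by (simp add: pgf_def)
qed

lemma pgf_antimono:
  assumes "0 \<le> s" "s \<le> 1" "W \<subseteq> W'" "S \<subseteq> W'" "finite W'"
  shows "pgf s W' S \<le> pgf s W S"
  unfolding pgf_def
proof (intro expectation_mono_finite finite_edge_pmf power_decreasing assms(1,2) card_mono reach_mono)
  show "finite (reach (edges X) W' S)" for X
    using assms reach_subset finite_subset by metis
qed (use assms in auto)

text \<open>Edges at \<open>v\<close> and edges inside \<open>W - {v}\<close> are disjoint sets of
  independent coordinates; once the neighbours of \<open>v\<close> are revealed, what remains is a
  fresh instance of the same problem. The factor \<open>s\<close> counts \<open>v\<close>.\<close>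

lemma pgf_explore:
  assumes "v \<in> S" "S \<subseteq> W" "finite W"
  shows "pgf s W S = s * measure_pmf.expectation edge_pmf
    (\<lambda>X. pgf s (W - {v}) (S - {v} \<union> {w \<in> W - {v}. {v, w} \<in> edges X}))"
proof -
  define N where "N X = {w \<in> W - {v}. {v, w} \<in> edges X}" for X
  define u where "u X Y = s * s ^ card (reach (edges Y) (W - {v}) (S - {v} \<union> N X))" for X Y
  have u: "s ^ card (reach (edges X) W S) = u X X" for X
  proof -
    have sub: "reach (edges X) (W - {v}) (S - {v} \<union> N X) \<subseteq> W - {v}"
      using assms by (intro reach_subset) (auto simp: N_def)
    then have "finite (reach (edges X) (W - {v}) (S - {v} \<union> N X))"
      using assms finite_subset by blast
    then show ?thesis
      unfolding u_def using sub
      by (subst reach_explore[OF assms(1,2)], fold N_def, subst card_insert_disjoint) auto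
  qed
  let ?B = "{e \<in> vertex_pairs n. fst e = v \<or> snd e = v}"
  have "pgf s W S = measure_pmf.expectation edge_pmf (\<lambda>X. u X X)"
    by (simp add: pgf_def u)
  also have "\<dots> = measure_pmf.expectation edge_pmf (\<lambda>X. measure_pmf.expectation edge_pmf (u X))"
    unfolding edge_pmf_def
  proof (rule expectation_Pi_pmf_indep[where B = ?B])
    fix X X' Y :: "nat \<times> nat \<Rightarrow> bool"
    assume eq: "\<And>x. x \<in> ?B \<Longrightarrow> X x = X' x"
    have "{v, w} \<in> edges X \<longleftrightarrow> {v, w} \<in> edges X'" for w
      unfolding edges_iff using eq[of "(min v w, max v w)"] by (auto simp: min_def max_def)
    then have "N X = N X'" by (simp add: N_def)
    then show "u X Y = u X' Y" by (simp add: u_def)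
  next
    fix X Y Y' :: "nat \<times> nat \<Rightarrow> bool"
    assume eq: "\<And>x. x \<in> vertex_pairs n - ?B \<Longrightarrow> Y x = Y' x"
    have "{x, y} \<in> edges Y \<longleftrightarrow> {x, y} \<in> edges Y'" if "x \<noteq> v" "y \<noteq> v" for x y
      unfolding edges_iff using eq[of "(min x y, max x y)"] that by (auto simp: min_def max_def)
    then have "{(x, y). x \<in> W - {v} \<and> y \<in> W - {v} \<and> {x, y} \<in> edges Y}
        = {(x, y). x \<in> W - {v} \<and> y \<in> W - {v} \<and> {x, y} \<in> edges Y'}" by auto
    then show "u X Y = u X Y'" unfolding u_def reach_def by simp
  qed auto
  finally show ?thesis
    by (simp add: u_def[abs_def] pgf_def N_def)
qed

lemma expectation_prod_nbrs:
  fixes \<psi> :: "nat \<Rightarrow> real"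
  assumes "finite T" "v \<notin> T" "T \<subseteq> {1..n}" "v \<in> {1..n}" "\<And>w. w \<in> T \<Longrightarrow> 0 \<le> \<psi> w"
  shows "measure_pmf.expectation edge_pmf (\<lambda>X. \<Prod>w\<in>T. if {v, w} \<in> edges X then \<psi> w else 1)
    = (\<Prod>w\<in>T. 1 - pr v w * (1 - \<psi> w))"
proof -
  define e where "e w = (min v w, max v w)" for w
  define other where "other z = (if fst z = v then snd z else fst z)" for z
  have e: "e w \<in> vertex_pairs n" if "w \<in> T" for w
  proof -
    have "w \<noteq> v" using assms that by auto
    then show ?thesis using assms that by (auto simp: e_def vertex_pairs_def min_def max_def)
  qed
  have oe: "other (e w) = w" if "w \<in> T" for w
    using assms that by (auto simp: e_def other_def min_def max_def)
  have inj: "inj_on e T" by (rule inj_on_inverseI[where g = other]) (rule oe)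
  \<comment> \<open>The factor of a single pair, extended by 1 to pairs that do not join
    \<open>v\<close> to \<open>T\<close>: the product then runs over the whole index set of
    \<open>edge_pmf\<close>, where independence applies.\<close>
  define F where "F z b = (if z \<in> e ` T \<and> b then \<psi> (other z) else 1)" for z b
  have split: "(\<Prod>z\<in>vertex_pairs n. k z) = (\<Prod>w\<in>T. k (e w))"
    if "\<And>z. z \<in> vertex_pairs n - e ` T \<Longrightarrow> k z = 1" for k :: "_ \<Rightarrow> real"
  proof -
    have "(\<Prod>z\<in>vertex_pairs n. k z) = prod k (e ` T)"
      using e that by (intro prod.mono_neutral_right) auto
    then show ?thesis using inj by (simp add: prod.reindex)
  qed
  have "(\<Prod>w\<in>T. if {v, w} \<in> edges X then \<psi> w else 1) = (\<Prod>z\<in>vertex_pairs n. F z (X z))" for X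
    using e oe by (subst split) (auto simp: F_def edges_iff e_def[symmetric] intro!: prod.cong)
  then have "measure_pmf.expectation edge_pmf (\<lambda>X. \<Prod>w\<in>T. if {v, w} \<in> edges X then \<psi> w else 1)
     = measure_pmf.expectation edge_pmf (\<lambda>X. \<Prod>z\<in>vertex_pairs n. F z (X z))" by simp
  also have "\<dots> = (\<Prod>z\<in>vertex_pairs n. measure_pmf.expectation (bernoulli_pmf (p z)) (F z))"
    unfolding edge_pmf_def
    using assms(5) oe by (intro expectation_prod_Pi_pmf) (auto intro!: integrable_measure_pmf_finite simp: F_def)
  also have "\<dots> = (\<Prod>z\<in>vertex_pairs n. 1 - p z * (1 - F z True))"
    using p01 by (intro prod.cong refl) (auto simp: F_def algebra_simps)
  also have "\<dots> = (\<Prod>w\<in>T. 1 - pr v w * (1 - \<psi> w))"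
    using oe by (subst split) (auto simp: F_def pr_def e_def[symmetric] intro!: prod.cong)
  finally show ?thesis .
qed

lemma expectation_card_nbrs:
  assumes "finite T" "T \<subseteq> {1..n}" "v \<notin> T" "v \<in> {1..n}"
  shows "measure_pmf.expectation edge_pmf (\<lambda>X. real (card {w \<in> T. {v, w} \<in> edges X}))
    = (\<Sum>w\<in>T. pr v w)"
proof -
  \<comment> \<open>An edge indicator is 1 minus a one-factor product with
    \<open>\<psi> = 0\<close>, so its mean comes from \<open>expectation_prod_nbrs\<close>.\<close>
  have "real (card {w \<in> T. {v, w} \<in> edges X})
      = (\<Sum>w\<in>T. 1 - (\<Prod>w\<in>{w}. if {v, w} \<in> edges X then 0 else 1 :: real))" for X
  proof -
    have "(\<Sum>w\<in>T. 1 - (\<Prod>w\<in>{w}. if {v, w} \<in> edges X then 0 else 1 :: real))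
        = (\<Sum>w\<in>T. if {v, w} \<in> edges X then 1 else 0)"
      by (intro sum.cong) auto
    also have "\<dots> = real (card {w \<in> T. {v, w} \<in> edges X})"
      using assms(1) by (simp add: sum.inter_filter[symmetric])
    finally show ?thesis by simp
  qed
  then have "measure_pmf.expectation edge_pmf (\<lambda>X. real (card {w \<in> T. {v, w} \<in> edges X}))
      = (\<Sum>w\<in>T. 1 - measure_pmf.expectation edge_pmf
             (\<lambda>X. \<Prod>w\<in>{w}. if {v, w} \<in> edges X then 0 else 1))"
    by (simp only:) (subst Bochner_Integration.integral_sum,
        auto intro!: integrable_measure_pmf_finite sum.cong
          simp del: prod.insert simp: Bochner_Integration.integral_diff[OF _ integrable_measure_pmf_finite])
  also have "\<dots> = (\<Sum>w\<in>T. pr v w)"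
  proof (intro sum.cong refl)
    fix w assume "w \<in> T"
    show "1 - measure_pmf.expectation edge_pmf (\<lambda>X. \<Prod>w\<in>{w}. if {v, w} \<in> edges X then 0 else 1) = pr v w"
      using assms \<open>w \<in> T\<close> by (subst expectation_prod_nbrs) auto
  qed
  finally show ?thesis .
qed

lemma expectation_prod_explore:
  assumes "v \<in> S" "S \<subseteq> W" "W \<subseteq> {1..n}" "\<And>w. w \<in> W \<Longrightarrow> 0 \<le> \<psi> w"
  shows "measure_pmf.expectation edge_pmf (\<lambda>X. prod \<psi> (S - {v} \<union> {w \<in> W - {v}. {v, w} \<in> edges X}))
    = prod \<psi> (S - {v}) * (\<Prod>w\<in>W - S. 1 - pr v w * (1 - \<psi> w))"
proof -
  have fin: "finite S" "finite (W - S)" using assms finite_subset by (metis finite_atLeastAtMost finite_Diff)+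
  have "prod \<psi> (S - {v} \<union> {w \<in> W - {v}. {v, w} \<in> edges X})
      = prod \<psi> (S - {v}) * (\<Prod>w\<in>W - S. if {v, w} \<in> edges X then \<psi> w else 1)" for X
  proof -
    have "S - {v} \<union> {w \<in> W - {v}. {v, w} \<in> edges X} = (S - {v}) \<union> {w \<in> W - S. {v, w} \<in> edges X}"
      using assms(1) by auto
    moreover have "prod \<psi> {w \<in> W - S. {v, w} \<in> edges X}
        = (\<Prod>w\<in>W - S. if {v, w} \<in> edges X then \<psi> w else 1)"
      using fin by (intro prod.inter_filter)
    moreover have "prod \<psi> ((S - {v}) \<union> {w \<in> W - S. {v, w} \<in> edges X})
        = prod \<psi> (S - {v}) * prod \<psi> {w \<in> W - S. {v, w} \<in> edges X}"
      using fin by (intro prod.union_disjoint) auto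
    ultimately show ?thesis by (simp only:)
  qed
  moreover have "v \<in> {1..n}" using assms by blast
  ultimately show ?thesis
    using expectation_prod_nbrs[of "W - S" v \<psi>] fin assms by auto
qed

section \<open>Comparison with products of sub- and supersolutions\<close>

lemma factor_bounds:
  assumes "0 \<le> x" "x \<le> 1" shows "0 \<le> 1 - pr v w * (1 - x)" "1 - pr v w * (1 - x) \<le> 1"
  using mult_mono[of "pr v w" 1 "1 - x" 1] assms by auto

text \<open>Exploring \<open>v\<close> produces only the factors of \<open>W - S\<close>; extending
  the product to \<open>W0 - {v}\<close> lowers it. Cycles and the shrinking vertex set thus work in
  favour of this direction, and no error term arises. \<open>\<psi>\<close> is 1 minus a
  supersolution.\<close>

lemma pgf_ge_supersolution:
  assumes W0: "W0 \<subseteq> {1..n}" and s: "0 \<le> s"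
    and \<psi>: "\<And>v. v \<in> W0 \<Longrightarrow> 0 \<le> \<psi> v \<and> \<psi> v \<le> 1"
    and sup: "\<And>v. v \<in> W0 \<Longrightarrow> \<psi> v \<le> s * (\<Prod>w\<in>W0 - {v}. 1 - pr v w * (1 - \<psi> w))"
    and "S \<subseteq> W" "W \<subseteq> W0"
  shows "prod \<psi> S \<le> pgf s W S"
proof -
  have "finite W0" using W0 finite_subset by blast
  then have "finite W" using \<open>W \<subseteq> W0\<close> finite_subset by blast
  then show ?thesis using \<open>S \<subseteq> W\<close> \<open>W \<subseteq> W0\<close>
  proof (induction "card W" arbitrary: W S)
    case 0
    then show ?case by auto
  next
    case (Suc k)
    show ?case
    proof (cases "S = {}")
      case False
      then obtain v where v: "v \<in> S" by auto
      let ?N = "\<lambda>X. {w \<in> W - {v}. {v, w} \<in> edges X}" and ?h = "\<lambda>w. 1 - pr v w * (1 - \<psi> w)"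
      have fin: "finite S" using Suc.prems finite_subset by auto
      have "prod ?h (W0 - {v}) \<le> prod ?h (W - S)"
        using v Suc.prems \<open>finite W0\<close> \<psi> by (intro prod_subset_bounds conjI factor_bounds) auto
      from mult_left_mono[OF this s] have key: "\<psi> v \<le> s * prod ?h (W - S)"
        using sup[of v] v Suc.prems by auto
      have "prod \<psi> S = prod \<psi> (S - {v}) * \<psi> v"
        using prod.remove[OF fin v, of \<psi>] by (simp add: mult.commute)
      also have "\<dots> \<le> prod \<psi> (S - {v}) * (s * prod ?h (W - S))"
        using key \<psi> Suc.prems by (intro mult_left_mono prod_nonneg) auto
      also have "\<dots> = s * measure_pmf.expectation edge_pmf (\<lambda>X. prod \<psi> (S - {v} \<union> ?N X))"
        using v Suc.prems W0 \<psi> by (subst expectation_prod_explore) auto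
      also have "\<dots> \<le> s * measure_pmf.expectation edge_pmf (\<lambda>X. pgf s (W - {v}) (S - {v} \<union> ?N X))"
        using s v Suc.prems Suc.hyps(2)
        by (intro mult_left_mono expectation_mono_finite Suc.hyps(1)) auto
      also have "\<dots> = pgf s W S"
        using pgf_explore[OF v] Suc.prems by simp
      finally show ?thesis .
    qed simp
  qed
qed

text \<open>Cycles closing inside the explored part cost at most \<open>q\<close> per explored or active vertex; the
  affine error term is the invariant that survives one exploration step.\<close>

lemma pgf_le_subsolution:
  assumes W0: "W0 \<subseteq> {1..n}" and s: "0 \<le> s" "s < 1"
    and \<psi>: "\<And>v. v \<in> W0 \<Longrightarrow> 0 \<le> \<psi> v \<and> \<psi> v \<le> 1"
    and sub: "\<And>v. v \<in> W0 \<Longrightarrow> s * (\<Prod>w\<in>W0 - {v}. 1 - pr v w * (1 - \<psi> w)) \<le> \<psi> v"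
    and q: "\<And>v w. \<lbrakk>v \<in> W0; w \<in> W0\<rbrakk> \<Longrightarrow> pr v w \<le> q" and C: "real (card W0) * q \<le> C" "0 \<le> q"
    and "S \<subseteq> W" "W \<subseteq> W0"
  shows "pgf s W S \<le> prod \<psi> S + q * (1 / (1 - s) * (card (W0 - W) + card S) + C / (1 - s)\<^sup>2)"
proof -
  define c1 where "c1 = 1 / (1 - s)"
  define c2 where "c2 = C / (1 - s)\<^sup>2"
  have C0: "0 \<le> C" using C by (meson mult_nonneg_nonneg of_nat_0_le_iff order_trans)
  have c0: "0 \<le> c1" "0 \<le> c2" using s C0 by (auto simp: c1_def c2_def)
  have "c1 * (1 - s) = 1" "c2 * (1 - s) = C * c1"
    using s by (simp_all add: c1_def c2_def power2_eq_square)
  \<comment> \<open>One exploration step turns an error \<open>c1 * r + c2\<close> into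
    \<open>(s + s * c1) * r + s * (c2 + C * c1)\<close>, with \<open>r\<close> the number of
    explored or active vertices; these inequalities close the induction.\<close>
  then have c12: "s + s * c1 \<le> c1" "s * (c2 + C * c1) \<le> c2"
    using s C0 c0 mult_right_mono[of s 1 "C * c1"] by (simp_all add: algebra_simps)
  have "finite W0" using W0 finite_subset by blast
  then have "finite W" using \<open>W \<subseteq> W0\<close> finite_subset by blast
  then have "pgf s W S \<le> prod \<psi> S + q * (c1 * (card (W0 - W) + card S) + c2)"
    using \<open>S \<subseteq> W\<close> \<open>W \<subseteq> W0\<close>
  proof (induction "card W" arbitrary: W S)
    case 0
    then show ?case using C c0 by auto
  next
    case (Suc k)
    show ?case
    proof (cases "S = {}")
      case True
      then show ?thesis using C c0 by simp
    next
      case False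
      then obtain v where v: "v \<in> S" by auto
      then have vW: "v \<in> W" "v \<in> W0" using Suc.prems by auto
      let ?N = "\<lambda>X. {w \<in> W - {v}. {v, w} \<in> edges X}" and ?h = "\<lambda>w. 1 - pr v w * (1 - \<psi> w)"
        and ?E = "measure_pmf.expectation edge_pmf"
      define r where "r = real (card (W0 - W) + card S)"
      have fin: "finite S" using Suc.prems finite_subset by auto
      have P: "0 \<le> prod \<psi> (S - {v})" "prod \<psi> (S - {v}) \<le> 1" "prod \<psi> S = prod \<psi> (S - {v}) * \<psi> v"
        using \<psi> Suc.prems prod.remove[OF fin v, of \<psi>]
        by (auto intro!: prod_nonneg prod_le_1 simp: mult.commute)
      have key: "s * prod ?h (W - S) \<le> \<psi> v + s * (r * q)"
      proof -
        define B where "B = W0 - {v} - (W - S)"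
        have "B \<subseteq> (W0 - W) \<union> S" using Suc.prems by (auto simp: B_def)
        then have "card B \<le> card ((W0 - W) \<union> S)" using \<open>finite W0\<close> fin by (intro card_mono) auto
        also have "\<dots> \<le> card (W0 - W) + card S" by (rule card_Un_le)
        finally have B: "real (card B) * q \<le> r * q" using C unfolding r_def by (intro mult_right_mono) auto
        have "(\<Sum>w\<in>B. 1 - ?h w) \<le> (\<Sum>w\<in>B. q)"
        proof (rule sum_mono)
          fix w assume "w \<in> B"
          then have "pr v w * (1 - \<psi> w) \<le> q * 1"
            using q[OF vW(2)] \<psi> C(2) by (intro mult_mono) (auto simp: B_def)
          then show "1 - ?h w \<le> q" by simp
        qed
        moreover have "prod ?h (W - S) \<le> prod ?h (W0 - {v}) + (\<Sum>w\<in>B. 1 - ?h w)"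
          unfolding B_def using v Suc.prems \<open>finite W0\<close> \<psi>
          by (intro prod_subset_bounds conjI factor_bounds) auto
        ultimately have "prod ?h (W - S) \<le> prod ?h (W0 - {v}) + r * q" using B by simp
        from mult_left_mono[OF this s(1)] show ?thesis using sub[OF vW(2)] by (simp add: distrib_left)
      qed
      have "?E (\<lambda>X. real (card (?N X))) = (\<Sum>w\<in>W - {v}. pr v w)"
        using Suc.prems W0 vW by (intro expectation_card_nbrs) auto
      also have "\<dots> \<le> (\<Sum>w\<in>W - {v}. q)"
        using q[OF vW(2)] Suc.prems by (intro sum_mono) auto
      also have "\<dots> \<le> (\<Sum>w\<in>W0. q)"
        using Suc.prems \<open>finite W0\<close> C by (intro sum_mono2) auto
      finally have EN: "?E (\<lambda>X. real (card (?N X))) \<le> C" using C by simp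
      have "pgf s W S = s * ?E (\<lambda>X. pgf s (W - {v}) (S - {v} \<union> ?N X))"
        using pgf_explore[OF v] Suc.prems by simp
      also have "\<dots> \<le> s * ?E (\<lambda>X. prod \<psi> (S - {v} \<union> ?N X) + (q * (c1 * r + c2) + q * c1 * card (?N X)))"
      proof (intro mult_left_mono expectation_mono_finite finite_edge_pmf s(1))
        fix X
        have "W0 - (W - {v}) = insert v (W0 - W)" using vW by auto
        then have "card (W0 - (W - {v})) + card (S - {v} \<union> ?N X) \<le> card (W0 - W) + card S + card (?N X)"
          using vW \<open>finite W0\<close> card_Un_le[of "S - {v}" "?N X"] card.remove[OF fin v] by simp
        then have "real (card (W0 - (W - {v})) + card (S - {v} \<union> ?N X)) \<le> r + card (?N X)"
          unfolding r_def of_nat_add[symmetric] of_nat_le_iff .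
        then have "q * (c1 * real (card (W0 - (W - {v})) + card (S - {v} \<union> ?N X)) + c2)
            \<le> q * (c1 * (r + card (?N X)) + c2)"
          using c0 C by (intro add_mono mult_left_mono) auto
        moreover have "pgf s (W - {v}) (S - {v} \<union> ?N X) \<le> prod \<psi> (S - {v} \<union> ?N X)
            + q * (c1 * (card (W0 - (W - {v})) + card (S - {v} \<union> ?N X)) + c2)"
          using v Suc.prems Suc.hyps(2) by (intro Suc.hyps(1)) auto
        ultimately show "pgf s (W - {v}) (S - {v} \<union> ?N X)
            \<le> prod \<psi> (S - {v} \<union> ?N X) + (q * (c1 * r + c2) + q * c1 * card (?N X))"
          unfolding distrib_left mult.assoc by linarith
      qed
      also have "\<dots> = prod \<psi> (S - {v}) * (s * prod ?h (W - S))
          + s * (q * (c1 * r + c2) + q * c1 * ?E (\<lambda>X. card (?N X)))"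
      proof -
        have "?E (\<lambda>X. prod \<psi> (S - {v} \<union> ?N X)) = prod \<psi> (S - {v}) * prod ?h (W - S)"
          using v Suc.prems W0 \<psi> by (intro expectation_prod_explore) auto
        then show ?thesis
          by (simp add: Bochner_Integration.integral_add[OF integrable_measure_pmf_finite
                integrable_measure_pmf_finite] distrib_left)
      qed
      also have "\<dots> \<le> prod \<psi> (S - {v}) * (\<psi> v + s * (r * q)) + s * (q * (c1 * r + c2) + q * c1 * C)"
        using key EN P c0 C s by (intro add_mono mult_left_mono) auto
      also have "\<dots> \<le> prod \<psi> S + (s * (r * q) + s * (q * (c1 * r + c2) + q * c1 * C))"
      proof -
        have "prod \<psi> (S - {v}) * (s * (r * q)) \<le> 1 * (s * (r * q))"
          using P s C by (intro mult_right_mono) (auto simp: r_def)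
        then show ?thesis unfolding P(3) distrib_left by linarith
      qed
      also have "s * (r * q) + s * (q * (c1 * r + c2) + q * c1 * C)
          = q * ((s + s * c1) * r + s * (c2 + C * c1))"
        by (simp add: algebra_simps)
      also have "\<dots> \<le> q * (c1 * r + c2)"
        using c12 C by (intro mult_left_mono add_mono mult_right_mono) (auto simp: r_def)
      finally show ?thesis by (simp add: r_def)
    qed
  qed
  then show ?thesis by (simp add: c1_def c2_def)
qed

end

section \<open>Asymptotics of the profile equation\<close>

lemma deriv_nonneg_imp_le:
  fixes h :: "real \<Rightarrow> real"
  assumes "u \<le> v" "continuous_on {u..v} h"
    and "\<And>x. \<lbrakk>u < x; x < v\<rbrakk> \<Longrightarrow> (h has_real_derivative h' x) (at x)"
    and "\<And>x. \<lbrakk>u < x; x < v\<rbrakk> \<Longrightarrow> 0 \<le> h' x"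
  shows "h u \<le> h v"
  using assms by (intro DERIV_nonneg_imp_increasing_open[of u v h]) blast+

lemma deriv_nonpos_imp_ge:
  fixes h :: "real \<Rightarrow> real"
  assumes "u \<le> v" "continuous_on {u..v} h"
    and "\<And>x. \<lbrakk>u < x; x < v\<rbrakk> \<Longrightarrow> (h has_real_derivative h' x) (at x)"
    and "\<And>x. \<lbrakk>u < x; x < v\<rbrakk> \<Longrightarrow> h' x \<le> 0"
  shows "h v \<le> h u"
  using assms by (intro DERIV_nonpos_imp_decreasing_open[of u v h]) blast+

lemma incseq_tendsto_0_le:
  fixes h :: "real \<Rightarrow> real"
  assumes "(h \<longlongrightarrow> 0) at_top" "\<And>x. u \<le> x \<Longrightarrow> h u \<le> h x"
  shows "h u \<le> 0"
  using assms(1) eventually_mono[OF eventually_ge_at_top[of u] assms(2)]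
  by (rule tendsto_lowerbound) simp_all

lemma decseq_tendsto_0_ge:
  fixes h :: "real \<Rightarrow> real"
  assumes "(h \<longlongrightarrow> 0) at_top" "\<And>x. u \<le> x \<Longrightarrow> h x \<le> h u"
  shows "0 \<le> h u"
  using assms(1) eventually_mono[OF eventually_ge_at_top[of u] assms(2)]
  by (rule tendsto_upperbound) simp_all

lemma gronwall_le:
  fixes h :: "real \<Rightarrow> real"
  assumes "u \<le> v" "continuous_on {u..v} h"
    and "\<And>x. \<lbrakk>u < x; x < v\<rbrakk> \<Longrightarrow> (h has_real_derivative h' x) (at x)"
    and "\<And>x. \<lbrakk>u < x; x < v\<rbrakk> \<Longrightarrow> h' x \<le> c * h x"
  shows "h v \<le> h u * exp (c * (v - u))"
proof -
  have "h v * exp (- c * v) \<le> h u * exp (- c * u)"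
    using assms(1)
  proof (rule deriv_nonpos_imp_ge[where h = "\<lambda>x. h x * exp (- c * x)"])
    show "continuous_on {u..v} (\<lambda>x. h x * exp (- c * x))" by (intro continuous_intros assms)
    fix x assume x: "u < x" "x < v"
    then show "((\<lambda>x. h x * exp (- c * x)) has_real_derivative (h' x - c * h x) * exp (- c * x)) (at x)"
      by (auto intro!: derivative_eq_intros assms(3) simp: algebra_simps)
    show "(h' x - c * h x) * exp (- c * x) \<le> 0" using assms(4)[OF x] by (simp add: mult_le_0_iff)
  qed
  from mult_right_mono[OF this, of "exp (c * v)"] show ?thesis
    by (simp add: mult.assoc exp_add[symmetric] algebra_simps)
qed

text \<open>A negative \<open>h u\<close> would keep \<open>h\<close> below \<open>h u\<close> for
  ever by \<open>gronwall_le\<close>, against the limit 0. Applied to combinations such as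
  \<open>V1 + a * V\<close>, this turns decay at infinity into bounds on a logarithmic
  derivative.\<close>

lemma gronwall_tendsto_0:
  fixes h :: "real \<Rightarrow> real"
  assumes "(h \<longlongrightarrow> 0) at_top" "0 \<le> c" "\<And>v. continuous_on {u..v} h"
    and "\<And>x. u < x \<Longrightarrow> (h has_real_derivative h' x) (at x)"
    and "\<And>x. u < x \<Longrightarrow> h' x \<le> c * h x"
  shows "0 \<le> h u"
proof (rule ccontr)
  assume neg: "\<not> 0 \<le> h u"
  have "h v \<le> h u" if "u \<le> v" for v
  proof -
    have "h v \<le> h u * exp (c * (v - u))" by (rule gronwall_le[OF that assms(3-5)])
    also have "\<dots> \<le> h u * 1" using neg that assms(2) by (intro mult_left_mono_neg) auto
    finally show ?thesis by simp
  qed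
  with decseq_tendsto_0_ge[OF assms(1)] neg show False by blast
qed

lemma exp_half_cancel: "exp (- x / 2) * (exp (x / 2) * y) = (y :: real)" "exp (x / 2) * (exp (- x / 2) * y) = y"
  by (simp_all add: mult.assoc[symmetric] exp_add[symmetric])

lemma two_power_le_exp: "2 ^ n \<le> exp (real n)"
proof -
  have "(2::real) ^ n \<le> exp 1 ^ n"
    using exp_ge_add_one_self[of 1] by (intro power_mono) auto
  then show ?thesis by (simp flip: exp_of_nat_mult)
qed

text \<open>Below, \<open>g\<close> solves \<open>g'' - g' + g / 4 = a\<^sup>2 * (g - f)\<close>, which for \<open>G = exp (- x / 2) * g\<close>
  becomes the equation of \<open>profile_ode\<close>. As the equation for \<open>g\<close> is autonomous, \<open>V = exp (- x / 2) * g'\<close>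
  solves the linearised equation \<open>V'' = a\<^sup>2 * f * V\<close>; \<open>G1\<close> and \<open>V1\<close> stand for \<open>G'\<close> and \<open>V'\<close>.\<close>

locale profile =
  fixes a s :: real and G G1 :: "real \<Rightarrow> real"
  assumes a_pos: "0 < a" and a_le: "a \<le> 1 / 2"
    and s_pos: "0 < s" and s_less: "s < 1"
begin

definition g :: "real \<Rightarrow> real" where "g x = exp (x / 2) * G x"
definition f :: "real \<Rightarrow> real" where "f x = 1 - s * exp (- g x)"
definition V :: "real \<Rightarrow> real" where "V x = G1 x + G x / 2"
definition V1 :: "real \<Rightarrow> real" where "V1 x = a\<^sup>2 * (G x - exp (- x / 2) * f x) + G1 x / 2"

end

text \<open>\<open>G1_0\<close> is the trace of the killing: with all mass on the positive axis, the
  two-sided exponential kernel depends on \<open>x\<close> near 0 only through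
  \<open>exp (a * x)\<close>. \<open>G_0\<close> reflects that a progeny is never empty, so the
  profile is at least \<open>1 - s\<close>.\<close>

locale profile_ode = profile +
  assumes dG: "\<And>x. 0 < x \<Longrightarrow> (G has_real_derivative G1 x) (at x)"
    and dG1: "\<And>x. 0 < x \<Longrightarrow> (G1 has_real_derivative a\<^sup>2 * (G x - exp (- x / 2) * f x)) (at x)"
    and cont: "\<And>v. continuous_on {0..v} G" "\<And>v. continuous_on {0..v} G1"
    and G_nonneg: "\<And>x. 0 \<le> x \<Longrightarrow> 0 \<le> G x"
    and g_mono: "\<And>x y. \<lbrakk>0 \<le> x; x \<le> y\<rbrakk> \<Longrightarrow> g x \<le> g y"
    and g_unbounded: "\<And>M. \<exists>x\<ge>0. M \<le> g x"
    and G_lim: "(G \<longlongrightarrow> 0) at_top" "(G1 \<longlongrightarrow> 0) at_top"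
    and G1_0: "G1 0 = a * G 0"
    and G_0: "a / 2 * (1 - s) \<le> G 0"
begin

section \<open>Monotonicity, convexity and decay rates of the profile\<close>

lemma cont_G: "0 \<le> u \<Longrightarrow> continuous_on {u..v} G" "0 \<le> u \<Longrightarrow> continuous_on {u..v} G1"
  by (rule continuous_on_subset[OF cont(1)[of v]], simp, rule continuous_on_subset[OF cont(2)[of v]], simp)

lemma cont_g: "0 \<le> u \<Longrightarrow> continuous_on {u..v} g"
  unfolding g_def by (intro continuous_intros cont_G) auto

lemma cont_f: "0 \<le> u \<Longrightarrow> continuous_on {u..v} f"
  unfolding f_def by (intro continuous_intros cont_g) auto

lemma cont_V: "0 \<le> u \<Longrightarrow> continuous_on {u..v} V"
  unfolding V_def by (intro continuous_intros cont_G) auto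

lemma cont_V1: "0 \<le> u \<Longrightarrow> continuous_on {u..v} V1"
  unfolding V1_def by (intro continuous_intros cont_G cont_f) auto

lemma dg: "0 < x \<Longrightarrow> (g has_real_derivative exp (x / 2) * V x) (at x)"
  unfolding g_def V_def by (auto intro!: derivative_eq_intros dG simp: algebra_simps)

lemma df: "0 < x \<Longrightarrow> (f has_real_derivative (1 - f x) * (exp (x / 2) * V x)) (at x)"
  unfolding f_def by (auto intro!: derivative_eq_intros dg simp: algebra_simps)

lemma dV: "0 < x \<Longrightarrow> (V has_real_derivative V1 x) (at x)"
  unfolding V_def V1_def by (auto intro!: derivative_eq_intros dG dG1)

lemma dV1:
  assumes "0 < x"
  shows "(V1 has_real_derivative a\<^sup>2 * f x * V x) (at x)"
proof -
  have "(V1 has_real_derivative a\<^sup>2 * (G1 x - (exp (- x / 2) * ((1 - f x) * (exp (x / 2) * V x))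
      + (- 1 / 2 * exp (- x / 2)) * f x)) + a\<^sup>2 * (G x - exp (- x / 2) * f x) / 2) (at x)"
    unfolding V1_def using assms by (auto intro!: derivative_eq_intros dG dG1 df)
  moreover have "exp (- x / 2) * ((1 - f x) * (exp (x / 2) * V x)) = (1 - f x) * V x"
    using exp_half_cancel(1)[of x "(1 - f x) * V x"] by (simp add: algebra_simps)
  ultimately have "(V1 has_real_derivative a\<^sup>2 * (G1 x - ((1 - f x) * V x
      + (- 1 / 2 * exp (- x / 2)) * f x)) + a\<^sup>2 * (G x - exp (- x / 2) * f x) / 2) (at x)"
    by (simp only:)
  then show ?thesis by (simp add: V_def algebra_simps add_divide_distrib diff_divide_distrib)
qed

lemma g_nonneg: "0 \<le> x \<Longrightarrow> 0 \<le> g x"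
  by (simp add: g_def G_nonneg)

lemma f_bounds:
  assumes "0 \<le> x"
  shows "1 - s \<le> f x" "0 \<le> f x" "f x \<le> 1" "f x \<le> 1 - s + g x"
proof -
  have "s * exp (- g x) \<le> s * 1" using g_nonneg[OF assms] s_pos by (intro mult_left_mono) auto
  then show "1 - s \<le> f x" by (simp add: f_def)
  then show "0 \<le> f x" using s_less by simp
  show "f x \<le> 1" using s_pos by (simp add: f_def)
  have "s * (1 - g x) \<le> s * exp (- g x)"
    using exp_ge_add_one_self[of "- g x"] s_pos by (intro mult_left_mono) auto
  moreover have "s * g x \<le> 1 * g x"
    using s_less g_nonneg[OF assms] by (intro mult_right_mono) auto
  ultimately show "f x \<le> 1 - s + g x" by (simp add: f_def algebra_simps)
qed

lemma a_sq: "a\<^sup>2 \<le> 1 / 4" "a\<^sup>2 \<le> a / 2" "0 < a\<^sup>2"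
proof -
  show "a\<^sup>2 \<le> a / 2" using a_pos a_le mult_left_mono[of a "1/2" a] by (simp add: power2_eq_square)
  then show "a\<^sup>2 \<le> 1 / 4" using a_le by simp
qed (use a_pos in simp)

lemma expF_tendsto_0: "((\<lambda>x. exp (- x / 2) * f x) \<longlongrightarrow> 0) at_top"
proof (rule real_tendsto_sandwich)
  show "\<forall>\<^sub>F x in at_top. 0 \<le> exp (- x / 2) * f x"
    using eventually_ge_at_top[of 0] by eventually_elim (simp add: f_bounds)
  show "\<forall>\<^sub>F x in at_top. exp (- x / 2) * f x \<le> exp (- x / 2)"
    using eventually_ge_at_top[of 0] by eventually_elim (simp add: f_bounds mult_left_le)
  show "((\<lambda>x. exp (- x / 2)) \<longlongrightarrow> (0::real)) at_top" by real_asymp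
qed simp

lemma V_tendsto_0: "(V \<longlongrightarrow> 0) at_top"
  using tendsto_add[OF G_lim(2) tendsto_divide[OF G_lim(1) tendsto_const[of 2]]]
  by (simp add: V_def[abs_def])

lemma V1_tendsto_0: "(V1 \<longlongrightarrow> 0) at_top"
  using tendsto_add[OF tendsto_mult[OF tendsto_const[of "a\<^sup>2"] tendsto_diff[OF G_lim(1) expF_tendsto_0]]
     tendsto_divide[OF G_lim(2) tendsto_const[of 2]]]
  by (simp add: V1_def[abs_def])

lemma V_nonneg:
  assumes "0 \<le> x" shows "0 \<le> V x"
proof -
  have pos: "0 \<le> V x" if "0 < x" for x
  proof -
    have "0 \<le> exp (x / 2) * V x"
    proof (rule ccontr)
      assume "\<not> 0 \<le> exp (x / 2) * V x"
      then have "exp (x / 2) * V x < 0" by simp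
      from DERIV_neg_dec_right[OF dg[OF that] this]
      obtain d where "d > 0" "\<And>h. \<lbrakk>h > 0; h < d\<rbrakk> \<Longrightarrow> g x > g (x + h)" by blast
      from this(2)[of "d / 2"] g_mono[of x "x + d / 2"] \<open>d > 0\<close> that show False by simp
    qed
    then show ?thesis by (simp add: zero_le_mult_iff)
  qed
  show ?thesis
  proof (cases "x = 0")
    case True
    then show ?thesis using G1_0 a_pos G_nonneg[of 0] by (simp add: V_def)
  qed (use pos assms in auto)
qed

text \<open>\<open>V\<close> is convex: \<open>V1\<close> has the nonnegative derivative
  \<open>a\<^sup>2 * f * V\<close>, so it increases to its limit 0.\<close>

lemma V1_nonpos:
  assumes "0 \<le> x" shows "V1 x \<le> 0"
proof (rule incseq_tendsto_0_le[OF V1_tendsto_0])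
  fix y assume "x \<le> y"
  then show "V1 x \<le> V1 y"
    using assms
    by (intro deriv_nonneg_imp_le[OF _ cont_V1 dV1]) (auto simp: f_bounds V_nonneg)
qed

lemma V1_mono:
  assumes "0 \<le> x" "x \<le> y" shows "V1 x \<le> V1 y"
  using assms
  by (intro deriv_nonneg_imp_le[OF _ cont_V1 dV1]) (auto simp: f_bounds V_nonneg)

lemma V_antimono:
  assumes "0 \<le> x" "x \<le> y" shows "V y \<le> V x"
  using assms
  by (intro deriv_nonpos_imp_ge[OF _ cont_V dV]) (auto simp: V1_nonpos)

text \<open>The bound \<open>f <= 1 - s + g\<close> cancels \<open>G\<close> in the equation
  exactly, which is criticality, and leaves \<open>G'' >= - a^2 (1 - s) exp (- x / 2)\<close>.
  Integration from infinity bounds \<open>G1\<close>; \<open>G1_0\<close> turns this at 0 into a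
  bound on \<open>G 0\<close>, and a second integration bounds \<open>G\<close>.\<close>

lemma G_le: 
  assumes "0 \<le> x" shows "G x \<le> 2 * (1 - s)" and "G 0 \<le> 2 * a * (1 - s)"
proof -
  define K where "K = 2 * a\<^sup>2 * (1 - s)"
  have K: "0 \<le> K" using s_less by (simp add: K_def)
  have 1: "G1 x \<le> K * exp (- x / 2)" if "0 \<le> x" for x
  proof -
    have "((\<lambda>x. K * exp (- x / 2)) \<longlongrightarrow> 0) at_top" by real_asymp
    from tendsto_diff[OF G_lim(2) this]
    have lim: "((\<lambda>x. G1 x - K * exp (- x / 2)) \<longlongrightarrow> 0) at_top" by simp
    have "G1 x - K * exp (- x / 2) \<le> 0"
    proof (rule incseq_tendsto_0_le[OF lim])
      fix y assume "x \<le> y"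
      then show "G1 x - K * exp (- x / 2) \<le> G1 y - K * exp (- y / 2)"
      proof (rule deriv_nonneg_imp_le)
        show "continuous_on {x..y} (\<lambda>x. G1 x - K * exp (- x / 2))"
          using that by (intro continuous_intros cont_G) auto
        fix z assume z: "x < z" "z < y"
        then show "((\<lambda>x. G1 x - K * exp (- x / 2)) has_real_derivative
            a\<^sup>2 * (G z - exp (- z / 2) * f z) + K / 2 * exp (- z / 2)) (at z)"
          using that by (auto intro!: derivative_eq_intros dG1)
        have "f z \<le> 1 - s + g z" using z that by (intro f_bounds) auto
        then have "exp (- z / 2) * f z \<le> exp (- z / 2) * (1 - s + g z)" by (intro mult_left_mono) auto
        also have "\<dots> = exp (- z / 2) * (1 - s) + G z"
          unfolding distrib_left g_def exp_half_cancel ..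
        finally have "0 \<le> a\<^sup>2 * (G z - exp (- z / 2) * f z + exp (- z / 2) * (1 - s))" by simp
        then show "0 \<le> a\<^sup>2 * (G z - exp (- z / 2) * f z) + K / 2 * exp (- z / 2)"
          by (simp add: K_def algebra_simps add_divide_distrib diff_divide_distrib)
      qed
    qed
    then show ?thesis by simp
  qed
  have "a * G 0 \<le> a * (2 * a * (1 - s))"
    using 1[of 0] G1_0 by (simp add: K_def power2_eq_square algebra_simps)
  then show G0: "G 0 \<le> 2 * a * (1 - s)" using a_pos by simp
  have "G x + 2 * K * exp (- x / 2) \<le> G 0 + 2 * K * exp (- 0 / 2)"
    using assms
  proof (rule deriv_nonpos_imp_ge)
    show "continuous_on {0..x} (\<lambda>x. G x + 2 * K * exp (- x / 2))"
      by (intro continuous_intros cont_G) auto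
    fix z assume z: "0 < z" "z < x"
    then show "((\<lambda>x. G x + 2 * K * exp (- x / 2)) has_real_derivative G1 z - K * exp (- z / 2)) (at z)"
      by (auto intro!: derivative_eq_intros dG)
    show "G1 z - K * exp (- z / 2) \<le> 0" using 1[of z] z by simp
  qed
  moreover have "0 \<le> 2 * K * exp (- x / 2)" using K by simp
  ultimately have "G x \<le> G 0 + 2 * K" by simp
  also have "\<dots> \<le> (2 * a + 4 * a\<^sup>2) * (1 - s)" using G0 by (simp add: K_def algebra_simps)
  also have "\<dots> \<le> 2 * (1 - s)"
    using a_le a_sq s_less by (intro mult_right_mono) auto
  finally show "G x \<le> 2 * (1 - s)" .
qed

lemma V_0: "V 0 = (a + 1 / 2) * G 0" "G 0 \<le> 2 * V 0" "V 0 \<le> 2 * a * (1 - s)" "0 < V 0"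
proof -
  show *: "V 0 = (a + 1 / 2) * G 0" by (simp add: V_def G1_0 algebra_simps)
  have "0 < a / 2 * (1 - s)" using a_pos s_less by simp
  then have pos: "0 < G 0" using G_0 by linarith
  then show "0 < V 0" using * a_pos by simp
  have "2 * V 0 = G 0 + 2 * (a * G 0)" using * by (simp add: algebra_simps)
  moreover have "0 \<le> a * G 0" using a_pos pos by simp
  ultimately show "G 0 \<le> 2 * V 0" by linarith
  have "V 0 \<le> 1 * G 0" unfolding * using a_le pos by (intro mult_right_mono) auto
  with G_le(2)[of 0] show "V 0 \<le> 2 * a * (1 - s)" by simp
qed

text \<open>This is \<open>g' <= g\<close>. The quantity \<open>exp (x / 2) * (G / 2 - G1)\<close>
  starts nonnegative by the boundary condition and increases because
  \<open>a^2 <= 1 / 4\<close>.\<close>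

lemma V_le_G:
  assumes "0 \<le> x" shows "V x \<le> G x"
proof -
  have "exp (0 / 2) * (G 0 / 2 - G1 0) \<le> exp (x / 2) * (G x / 2 - G1 x)"
    using assms
  proof (rule deriv_nonneg_imp_le)
    show "continuous_on {0..x} (\<lambda>x. exp (x / 2) * (G x / 2 - G1 x))"
      by (intro continuous_intros cont_G) auto
    fix z assume z: "0 < z" "z < x"
    then show "((\<lambda>x. exp (x / 2) * (G x / 2 - G1 x)) has_real_derivative
        exp (z / 2) * (G z * (1 / 4 - a\<^sup>2) + a\<^sup>2 * (exp (- z / 2) * f z))) (at z)"
      by (auto intro!: derivative_eq_intros dG dG1 simp: algebra_simps)
    show "0 \<le> exp (z / 2) * (G z * (1 / 4 - a\<^sup>2) + a\<^sup>2 * (exp (- z / 2) * f z))"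
      using z a_sq G_nonneg[of z] f_bounds[of z]
      by (intro mult_nonneg_nonneg add_nonneg_nonneg) auto
  qed
  moreover have "0 \<le> G 0 / 2 - G1 0"
    using G1_0 a_le G_nonneg[of 0] mult_right_mono[of a "1/2" "G 0"] by simp
  ultimately have "0 \<le> exp (x / 2) * (G x / 2 - G1 x)" by simp
  then have "0 \<le> G x / 2 - G1 x" by (simp add: zero_le_mult_iff)
  then show ?thesis by (simp add: V_def)
qed

text \<open>As \<open>f <= 1\<close>, \<open>V\<close> decays no faster than the solution
  \<open>exp (- a * x)\<close> of \<open>W'' = a^2 W\<close>.\<close>

lemma V1_ge:
  assumes "0 \<le> x" shows "- a * V x \<le> V1 x"
proof -
  have "((\<lambda>x. V1 x + a * V x) \<longlongrightarrow> 0) at_top"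
    using tendsto_add[OF V1_tendsto_0 tendsto_mult[OF tendsto_const V_tendsto_0]] by simp
  then have "0 \<le> V1 x + a * V x"
  proof (rule gronwall_tendsto_0)
    show "continuous_on {x..v} (\<lambda>x. V1 x + a * V x)" for v
      using assms by (intro continuous_intros cont_V cont_V1)
    fix z assume z: "x < z"
    then show "((\<lambda>x. V1 x + a * V x) has_real_derivative a\<^sup>2 * f z * V z + a * V1 z) (at z)"
      using assms by (auto intro!: derivative_eq_intros dV dV1)
    have "f z * V z \<le> 1 * V z"
      using z assms f_bounds[of z] V_nonneg[of z] by (intro mult_right_mono) auto
    then have "a\<^sup>2 * (f z * V z) \<le> a\<^sup>2 * (1 * V z)" by (rule mult_left_mono) simp
    then show "a\<^sup>2 * f z * V z + a * V1 z \<le> a * (V1 z + a * V z)"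
      by (simp add: algebra_simps power2_eq_square)
  qed (use a_pos in simp)
  then show ?thesis by simp
qed

text \<open>The opposite comparison: a potential of at least \<open>c^2\<close> forces decay at rate
  at least \<open>c\<close>, since the limit 0 excludes growing solutions.\<close>

lemma V1_le_beyond:
  assumes "0 \<le> x" "0 < c" "\<And>y. x \<le> y \<Longrightarrow> c\<^sup>2 \<le> a\<^sup>2 * f y"
  shows "V1 x \<le> - c * V x"
proof -
  have "((\<lambda>x. - V1 x - c * V x) \<longlongrightarrow> 0) at_top"
    using tendsto_diff[OF tendsto_minus[OF V1_tendsto_0] tendsto_mult[OF tendsto_const V_tendsto_0]] by simp
  then have "0 \<le> - V1 x - c * V x"
  proof (rule gronwall_tendsto_0)
    show "continuous_on {x..v} (\<lambda>x. - V1 x - c * V x)" for v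
      using assms by (intro continuous_intros cont_V cont_V1)
    fix z assume z: "x < z"
    then show "((\<lambda>x. - V1 x - c * V x) has_real_derivative - (a\<^sup>2 * f z * V z) - c * V1 z) (at z)"
      using assms by (auto intro!: derivative_eq_intros dV dV1)
    have "c\<^sup>2 * V z \<le> a\<^sup>2 * f z * V z"
      using z assms(1) assms(3)[of z] V_nonneg[of z] by (intro mult_right_mono) auto
    then show "- (a\<^sup>2 * f z * V z) - c * V1 z \<le> c * (- V1 z - c * V z)"
      by (simp add: algebra_simps power2_eq_square)
  qed (use assms in simp)
  then show ?thesis by simp
qed

lemma V_tangent:
  assumes "0 \<le> x" "0 \<le> y" shows "V y + V1 y * (x - y) \<le> V x"
proof (cases "x \<le> y")
  case True
  then have "V y - V1 y * y \<le> V x - V1 y * x"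
  proof (rule deriv_nonpos_imp_ge)
    show "continuous_on {x..y} (\<lambda>z. V z - V1 y * z)"
      using assms by (intro continuous_intros cont_V)
    fix z assume "x < z" "z < y"
    then show "((\<lambda>z. V z - V1 y * z) has_real_derivative V1 z - V1 y) (at z)" "V1 z - V1 y \<le> 0"
      using V1_mono[of z y] assms by (auto intro!: derivative_eq_intros dV)
  qed
  then show ?thesis by (simp add: algebra_simps)
next
  case False
  then have "V y - V1 y * y \<le> V x - V1 y * x"
  proof (intro deriv_nonneg_imp_le[of y x "\<lambda>z. V z - V1 y * z"])
    show "continuous_on {y..x} (\<lambda>z. V z - V1 y * z)"
      using assms by (intro continuous_intros cont_V)
    fix z assume "y < z" "z < x"
    then show "((\<lambda>z. V z - V1 y * z) has_real_derivative V1 z - V1 y) (at z)" "0 \<le> V1 z - V1 y"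
      using V1_mono[of y z] assms by (auto intro!: derivative_eq_intros dV)
  qed simp
  then show ?thesis by (simp add: algebra_simps)
qed

lemma ex_cut:
  assumes "1 - s \<le> exp (- 40)"
  shows "\<exists>X\<ge>0. g X = 1 / 128"
proof -
  obtain x where x: "0 \<le> x" "1 / 128 \<le> g x" using g_unbounded by blast
  have "1 - s \<le> 1 / 2 ^ 40"
    using assms two_power_le_exp[of 40] by (intro order_trans[OF assms]) (simp add: exp_minus field_simps)
  moreover have "g 0 \<le> 2 * (1 - s)" using G_le(1)[of 0] by (simp add: g_def)
  ultimately have "g 0 \<le> 1 / 128" by simp
  from IVT'[OF this x(2) x(1) cont_g] show ?thesis by auto
qed

end

text \<open>The profile is close to linear up to the point \<open>X\<close> where \<open>g\<close> reaches a small constant, and \<open>V\<close> decays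
  exponentially beyond. Comparing the linear decay of \<open>V\<close> on \<open>{0..X}\<close> with its size at \<open>X\<close> gives
  \<open>exp (- X / 2)\<close> of order \<open>(1 - s) / X\<close>, in \<open>exp_cut_le\<close> and \<open>exp_cut_ge\<close>. The constants \<open>1 / 128\<close> and
  \<open>exp (- 40)\<close> only have to be small enough.\<close>

locale profile_cut = profile_ode +
  fixes X :: real
  assumes X_nonneg: "0 \<le> X" and g_X: "g X = 1 / 128" and small: "1 - s \<le> exp (- 40)"
begin

section \<open>Position of the cut and exponential estimates to its left\<close>

lemma small': "1 - s \<le> 1 / 1024"
proof -
  have "1 - s \<le> 1 / 2 ^ 40"
    using two_power_le_exp[of 40] by (intro order_trans[OF small]) (simp add: exp_minus field_simps)
  then show ?thesis by simp
qed

lemma G_X: "G X = exp (- X / 2) / 128"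
proof -
  have "exp (- X / 2) * g X = G X" unfolding g_def exp_half_cancel ..
  then show ?thesis by (simp add: g_X)
qed

lemma G_0_upper: "G 0 \<le> 2 * (1 - s)"
  using G_le(1)[of 0] by simp

lemma V_X: "V X \<le> exp (- X / 2) / 128"
  using V_le_G[OF X_nonneg] G_X by simp

lemma g_growth:
  assumes "0 \<le> x" "x \<le> y" shows "g y \<le> g x * exp (y - x)"
proof -
  have "g y \<le> g x * exp (1 * (y - x))"
    using assms(2)
  proof (rule gronwall_le)
    fix z assume "x < z" "z < y"
    then show "(g has_real_derivative exp (z / 2) * V z) (at z)" "exp (z / 2) * V z \<le> 1 * g z"
      using assms V_le_G[of z] by (auto simp: g_def[of z] intro: dg)
  qed (use assms cont_g in auto)
  then show ?thesis by simp
qed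

text \<open>By \<open>g' <= g\<close>, the climb from at most \<open>2 * (1 - s)\<close> to
  \<open>1 / 128\<close> needs this much room; \<open>exp 8\<close> absorbs the factor 256.\<close>

lemma exp_X_ge: "exp (- 8) / (1 - s) \<le> exp X"
proof -
  have "1 / 128 \<le> G 0 * exp X" using g_growth[of 0 X] X_nonneg g_X by (simp add: g_def)
  also have "\<dots> \<le> 2 * (1 - s) * exp X" using G_0_upper by (intro mult_right_mono) auto
  finally have "1 \<le> 256 * ((1 - s) * exp X)" by (simp add: algebra_simps)
  moreover have "(256::real) \<le> exp 8" using two_power_le_exp[of 8] by simp
  then have "256 * ((1 - s) * exp X) \<le> exp 8 * ((1 - s) * exp X)"
    using s_less by (intro mult_right_mono) auto
  ultimately have "1 \<le> exp 8 * ((1 - s) * exp X)" by linarith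
  then show ?thesis using s_less by (simp add: exp_minus field_simps)
qed

lemma X_ge: "ln (1 / (1 - s)) - 8 \<le> X" "32 \<le> X"
proof -
  have "ln (exp (- 8) / (1 - s)) \<le> X"
    using exp_X_ge s_less ln_le_cancel_iff[of "exp (- 8) / (1 - s)" "exp X"] by simp
  then show *: "ln (1 / (1 - s)) - 8 \<le> X" using s_less by (simp add: ln_div)
  have "ln (1 - s) \<le> - 40" using small s_less ln_le_cancel_iff[of "1 - s" "exp (- 40)"] by simp
  then show "32 \<le> X" using * s_less by (simp add: ln_div)
qed

text \<open>The tangent at \<open>y\<close> is evaluated at both ends \<open>0\<close> and
  \<open>X\<close>; with weights \<open>X - y\<close> and \<open>y\<close> the slope terms
  cancel.\<close>

lemma V_chord:
  assumes "0 \<le> y" "y \<le> X"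
  shows "X * V y \<le> (X - y) * V 0 + y * V X"
proof -
  have "(X - y) * (V y + V1 y * (0 - y)) \<le> (X - y) * V 0" "y * (V y + V1 y * (X - y)) \<le> y * V X"
    using assms by (intro mult_left_mono V_tangent; simp)+
  then show ?thesis by (simp add: algebra_simps)
qed

text \<open>Right of \<open>X\<close> the potential \<open>a\<^sup>2 * f\<close> is at least
  \<open>(a / 16)^2\<close>, so \<open>V\<close> has relative slope at most \<open>- a / 16\<close>
  at \<open>X\<close>; by convexity the tangent there, followed back to 0, stays below
  \<open>V 0\<close>. Hence \<open>V X\<close> is smaller than \<open>V 0\<close> by a factor of
  order \<open>X\<close>.\<close>

lemma V_X_le: "a * X * V X \<le> 16 * V 0"
proof -
  have f_ge: "1 / 256 \<le> f y" if "X \<le> y" for y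
  proof -
    have "f X \<le> f y"
      using g_mono[of X y] that X_nonneg s_pos by (simp add: f_def)
    moreover have "exp (- (1 / 128)) \<le> (255 / 256 :: real)"
    proof -
      have "1 + 1 / 128 \<le> exp (1 / 128 :: real)" by (rule exp_ge_add_one_self)
      then have "exp (- (1 / 128)) \<le> 1 / (1 + 1 / 128 :: real)" by (simp add: exp_minus field_simps)
      then show ?thesis by simp
    qed
    then have "s * exp (- (1 / 128)) \<le> 1 * (255 / 256)"
      using s_less s_pos by (intro mult_mono) auto
    then have "1 / 256 \<le> f X" by (simp add: f_def g_X)
    ultimately show ?thesis by simp
  qed
  have "V1 X \<le> - (a / 16) * V X"
  proof (rule V1_le_beyond[OF X_nonneg])
    fix y assume "X \<le> y"
    then have "a\<^sup>2 * (1 / 256) \<le> a\<^sup>2 * f y" by (intro mult_left_mono f_ge) auto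
    then show "(a / 16)\<^sup>2 \<le> a\<^sup>2 * f y" by (simp add: power_divide)
  qed (use a_pos in simp)
  moreover have "V X + V1 X * (0 - X) \<le> V 0" using X_nonneg by (intro V_tangent) auto
  moreover have "0 \<le> V X" by (rule V_nonneg[OF X_nonneg])
  ultimately have "a / 16 * V X * X \<le> V 0"
    using X_nonneg mult_right_mono[of "V1 X" "- (a / 16) * V X" X] by simp
  then show ?thesis by (simp add: algebra_simps)
qed

text \<open>By \<open>V_chord\<close> and \<open>V_X_le\<close>, \<open>V\<close> lies below an
  affine function that almost vanishes at \<open>X\<close>. Integrating
  \<open>g' = exp (x / 2) * V\<close> bounds the rise of \<open>g\<close> by a multiple of
  \<open>V 0 * exp (X / 2) / X\<close>. The factor \<open>a\<close> in the bound on
  \<open>V 0\<close> cancels the \<open>1 / a\<close> from \<open>V_X_le\<close>.\<close>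

lemma exp_cut_le: "X * exp (- X / 2) \<le> 18432 * (1 - s)"
proof -
  define \<eta> where "\<eta> = V 0 / X"
  have X: "0 < X" using X_ge by simp
  have eta: "0 < \<eta>" using V_0(4) X by (simp add: \<eta>_def)
  have V: "V y \<le> \<eta> * (X - y + 16 / a)" if "0 \<le> y" "y \<le> X" for y
  proof -
    have "y * V X \<le> X * V X" using that V_nonneg[OF X_nonneg] by (intro mult_right_mono) auto
    also have "\<dots> \<le> 16 / a * V 0" using V_X_le a_pos by (simp add: field_simps)
    finally have "X * V y \<le> V 0 * (X - y + 16 / a)"
      using V_chord[OF that] by (simp add: algebra_simps)
    then show ?thesis using X by (simp add: \<eta>_def field_simps)
  qed
  \<comment> \<open>The subtracted term is an antiderivative of
    \<open>\<eta> * exp (x / 2) * (X - x + 16 / a)\<close>.\<close>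
  have "g X - \<eta> * exp (X / 2) * (2 * (X - X + 16 / a) + 4)
      \<le> g 0 - \<eta> * exp (0 / 2) * (2 * (X - 0 + 16 / a) + 4)"
    using X_nonneg
  proof (rule deriv_nonpos_imp_ge)
    show "continuous_on {0..X} (\<lambda>x. g x - \<eta> * exp (x / 2) * (2 * (X - x + 16 / a) + 4))"
      by (intro continuous_intros cont_g) auto
    fix z assume z: "0 < z" "z < X"
    then show "((\<lambda>x. g x - \<eta> * exp (x / 2) * (2 * (X - x + 16 / a) + 4)) has_real_derivative
        exp (z / 2) * (V z - \<eta> * (X - z + 16 / a))) (at z)"
      using a_pos by (auto intro!: derivative_eq_intros dg simp: algebra_simps)
    show "exp (z / 2) * (V z - \<eta> * (X - z + 16 / a)) \<le> 0"
      using V[of z] z by (simp add: mult_le_0_iff)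
  qed
  moreover have "0 \<le> \<eta> * (2 * (X + 16 / a) + 4)" using eta X a_pos by simp
  \<comment> \<open>\<open>g\<close> starts below half of its value at \<open>X\<close>, so it still
    has to rise by \<open>1 / 256\<close>; together with the factor 72 below this makes
    \<open>18432 = 256 * 72\<close>.\<close>
  moreover have "g 0 \<le> 1 / 256" using G_0_upper small' by (simp add: g_def)
  ultimately have "1 / 256 \<le> \<eta> * exp (X / 2) * (32 / a + 4)" using g_X by simp
  also have "\<dots> \<le> \<eta> * exp (X / 2) * (36 / a)"
    using eta a_pos a_le by (intro mult_left_mono) (auto simp: field_simps)
  finally have "X * exp (- X / 2) * (1 / 256) \<le> X * exp (- X / 2) * (\<eta> * exp (X / 2) * (36 / a))"
    using X by (intro mult_left_mono) auto
  also have "\<dots> = V 0 * (36 / a) * (exp (- X / 2) * (exp (X / 2) * 1))"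
    using X by (simp add: \<eta>_def)
  also have "\<dots> = V 0 * (36 / a)" by (subst exp_half_cancel) simp
  also have "\<dots> \<le> 2 * a * (1 - s) * (36 / a)" using V_0(3) a_pos by (intro mult_right_mono) auto
  also have "\<dots> = 72 * (1 - s)" using a_pos by simp
  finally show ?thesis by simp
qed

text \<open>Left of \<open>X\<close>, \<open>f <= 1 / 64\<close> keeps the potential below
  \<open>m^2\<close> with \<open>m = a / 8\<close>. Going back from \<open>X\<close>, where the
  slope is at least \<open>- a * V X\<close>, \<open>V\<close> grows no faster than
  \<open>exp (m * (X - y))\<close>; the factor 5 is \<open>1 + a / (2 * m)\<close>.\<close>

lemma V_le:
  assumes "0 \<le> y" "y \<le> X"
  shows "V y \<le> 5 / 128 * exp (- X / 2) * exp (a / 8 * (X - y))"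
proof -
  define m where "m = a / 8"
  have m: "0 < m" "a / (2 * m) = 4" using a_pos by (auto simp: m_def)
  have f_le: "a\<^sup>2 * f z \<le> m\<^sup>2" if "0 \<le> z" "z \<le> X" for z
  proof -
    have "f z \<le> 1 - s + g X" using f_bounds(4)[of z] g_mono[of z X] that by simp
    then have "a\<^sup>2 * f z \<le> a\<^sup>2 * (1 / 64)" using small' g_X by (intro mult_left_mono) auto
    then show ?thesis by (simp add: m_def power_divide)
  qed
  have P: "- a * V X * exp (m * (z - X)) \<le> V1 z + m * V z" if "0 \<le> z" "z \<le> X" for z
  proof -
    have "V1 X + m * V X \<le> (V1 z + m * V z) * exp (m * (X - z))"
      using that(2)
    proof (rule gronwall_le)
      show "continuous_on {z..X} (\<lambda>x. V1 x + m * V x)"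
        using that by (intro continuous_intros cont_V cont_V1)
      fix w assume w: "z < w" "w < X"
      then show "((\<lambda>x. V1 x + m * V x) has_real_derivative a\<^sup>2 * f w * V w + m * V1 w) (at w)"
        using that by (auto intro!: derivative_eq_intros dV dV1)
      have "a\<^sup>2 * f w * V w \<le> m\<^sup>2 * V w"
        using that w f_le[of w] V_nonneg[of w] by (intro mult_right_mono) auto
      then show "a\<^sup>2 * f w * V w + m * V1 w \<le> m * (V1 w + m * V w)"
        by (simp add: algebra_simps power2_eq_square)
    qed
    moreover have "- a * V X \<le> V1 X + m * V X"
      using V1_ge[OF X_nonneg] V_nonneg[OF X_nonneg] m by (simp add: add_increasing2)
    ultimately have "- a * V X * exp (m * (z - X)) \<le> (V1 z + m * V z) * exp (m * (X - z)) * exp (m * (z - X))"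
      by (intro mult_right_mono) auto
    moreover have "exp (m * (X - z)) * exp (m * (z - X)) = 1"
      by (simp add: exp_add[symmetric] algebra_simps)
    ultimately show ?thesis by (simp add: mult.assoc)
  qed
  have "V y * exp (m * y) + 4 * V X * exp (m * (2 * y - X)) \<le> V X * exp (m * X) + 4 * V X * exp (m * (2 * X - X))"
    using assms(2)
  proof (rule deriv_nonneg_imp_le)
    show "continuous_on {y..X} (\<lambda>y. V y * exp (m * y) + 4 * V X * exp (m * (2 * y - X)))"
      using assms by (intro continuous_intros cont_V) auto
    fix z assume z: "y < z" "z < X"
    have "exp (m * (2 * z - X)) = exp (m * z) * exp (m * (z - X))"
      by (simp add: exp_add[symmetric] algebra_simps)
    moreover have "((\<lambda>y. V y * exp (m * y) + 4 * V X * exp (m * (2 * y - X))) has_real_derivative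
        V1 z * exp (m * z) + V z * (exp (m * z) * m) + 4 * V X * (exp (m * (2 * z - X)) * (m * 2))) (at z)"
      using z assms by (auto intro!: derivative_eq_intros dV simp: algebra_simps)
    ultimately show "((\<lambda>y. V y * exp (m * y) + 4 * V X * exp (m * (2 * y - X))) has_real_derivative
        exp (m * z) * (V1 z + m * V z + 8 * m * V X * exp (m * (z - X)))) (at z)"
      by (simp add: algebra_simps)
    have "8 * m = a" by (simp add: m_def)
    then show "0 \<le> exp (m * z) * (V1 z + m * V z + 8 * m * V X * exp (m * (z - X)))"
      using P[of z] z assms by simp
  qed
  moreover have "0 \<le> 4 * V X * exp (m * (2 * y - X))" using V_nonneg[OF X_nonneg] by simp
  ultimately have "V y * exp (m * y) \<le> 5 * V X * exp (m * X)" by simp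
  also have "\<dots> \<le> 5 * (exp (- X / 2) / 128) * exp (m * X)"
    using V_X by (intro mult_right_mono) auto
  finally have "V y * exp (m * y) * exp (- m * y) \<le> 5 * (exp (- X / 2) / 128) * exp (m * X) * exp (- m * y)"
    by (intro mult_right_mono) auto
  then show ?thesis
    unfolding m_def[symmetric] by (simp add: mult.assoc exp_add[symmetric] algebra_simps)
qed

text \<open>Integrating \<open>g' = exp (x / 2) * V\<close> with \<open>V_le\<close> yields growth
  towards \<open>X\<close> at rate \<open>1 / 2 - m >= 7 / 16\<close>. The constant part
  \<open>1 - s\<close> of \<open>f\<close> is equally small: \<open>G_0\<close> bounds it by a
  multiple of \<open>G 0 <= 2 * V 0\<close>, to which \<open>V_le\<close> applies.\<close>

lemma f_le:
  assumes "0 \<le> y" "y \<le> X"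
  shows "f y \<le> 1 / a * exp (- (7 / 16) * (X - y))"
proof -
  define m where "m = a / 8"
  have m: "0 < m" "m \<le> 1 / 16" using a_pos a_le by (auto simp: m_def)
  define A where "A = exp (- X / 2)"
  define E where "E = exp (m * (X - y) + y / 2)"
  have A: "0 < A" and E: "0 < E" by (simp_all add: A_def E_def)
  define B where "B = 5 / 128 * A / (1 / 2 - m)"
  have B: "0 \<le> B" using m A by (simp add: B_def)
  have "g y - B * exp (m * (X - y) + y / 2) \<le> g 0 - B * exp (m * (X - 0) + 0 / 2)"
    using assms(1)
  proof (rule deriv_nonpos_imp_ge)
    show "continuous_on {0..y} (\<lambda>y. g y - B * exp (m * (X - y) + y / 2))"
      by (intro continuous_intros cont_g) auto
    fix z assume z: "0 < z" "z < y"
    have eq: "exp (m * (X - z) + z / 2) = exp (z / 2) * exp (m * (X - z))"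
      by (simp add: exp_add[symmetric] algebra_simps)
    have "((\<lambda>y. g y - B * exp (m * (X - y) + y / 2)) has_real_derivative
        exp (z / 2) * V z - B * (exp (m * (X - z) + z / 2) * (1 / 2 - m))) (at z)"
      using z by (auto intro!: derivative_eq_intros dg simp: algebra_simps)
    moreover have "B * (exp (m * (X - z) + z / 2) * (1 / 2 - m)) = exp (z / 2) * (5 / 128 * A * exp (m * (X - z)))"
    proof -
      have "b / d * d = b" if "d \<noteq> 0" for b d :: real using that by simp
      from this[of "1 / 2 - m" "5 / 128 * A"] have "B * (1 / 2 - m) = 5 / 128 * A"
        using m unfolding B_def by linarith
      moreover have "B * (exp (z / 2) * exp (m * (X - z)) * (1 / 2 - m))
          = B * (1 / 2 - m) * (exp (z / 2) * exp (m * (X - z)))" by (simp only: mult_ac)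
      ultimately show ?thesis unfolding eq by (simp only: mult_ac)
    qed
    ultimately show "((\<lambda>y. g y - B * exp (m * (X - y) + y / 2)) has_real_derivative
        exp (z / 2) * (V z - 5 / 128 * A * exp (m * (X - z)))) (at z)"
      by (simp only: right_diff_distrib)
    show "exp (z / 2) * (V z - 5 / 128 * A * exp (m * (X - z))) \<le> 0"
      using V_le[of z] z assms by (simp add: mult_le_0_iff A_def m_def)
  qed
  moreover have "0 \<le> B * exp (m * (X - 0) + 0 / 2)" using B by simp
  ultimately have g: "g y \<le> g 0 + B * E" by (simp add: E_def)
  have "B \<le> 12 / 128 * A"
  proof -
    have "5 / (1 / 2 - m) \<le> 12" using m by (simp add: field_simps)
    then have "5 / (1 / 2 - m) * (A / 128) \<le> 12 * (A / 128)" using A by (intro mult_right_mono) auto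
    then show ?thesis by (simp add: B_def field_simps)
  qed
  then have BE: "B * E \<le> 12 / 128 * A * E" using E by (intro mult_right_mono) auto
  have "G 0 \<le> 2 * V 0" by (rule V_0)
  also have "\<dots> \<le> 10 / 128 * A * exp (m * X)"
    using V_le[of 0] X_nonneg by (simp add: A_def m_def)
  also have "\<dots> \<le> 10 / 128 * A * E"
  proof -
    have "m * y \<le> 1 / 2 * y" using m assms by (intro mult_right_mono) auto
    then have "exp (m * X) \<le> E" by (simp add: E_def algebra_simps)
    then show ?thesis using A by (intro mult_left_mono) auto
  qed
  finally have G0: "G 0 \<le> 10 / 128 * (A * E)" by simp
  have eps: "1 - s \<le> 2 / a * (10 / 128 * (A * E))"
  proof -
    have "1 - s \<le> 2 / a * G 0" using G_0 a_pos by (simp add: field_simps)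
    also have "\<dots> \<le> 2 / a * (10 / 128 * (A * E))" using G0 a_pos by (intro mult_left_mono) auto
    finally show ?thesis .
  qed
  have "f y \<le> 1 - s + g y" by (rule f_bounds[OF assms(1)])
  also have "\<dots> \<le> (20 / a + 22) * (A * E / 128)"
    using g BE G0 eps by (simp add: g_def algebra_simps)
  also have "\<dots> \<le> (128 / a) * (A * E / 128)"
    using A E a_pos a_le by (intro mult_right_mono) (auto simp: field_simps)
  also have "\<dots> = 1 / a * exp (- (1 / 2 - m) * (X - y))"
    by (simp add: A_def E_def exp_add[symmetric] algebra_simps diff_divide_distrib)
  also have "\<dots> \<le> 1 / a * exp (- (7 / 16) * (X - y))"
  proof -
    have "m * (X - y) \<le> 1 / 16 * (X - y)" using m assms by (intro mult_right_mono) auto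
    then show ?thesis
      using a_pos by (intro mult_left_mono) (auto simp: algebra_simps add_divide_distrib diff_divide_distrib)
  qed
  finally show ?thesis .
qed

lemma V_le':
  assumes "0 \<le> y" "y \<le> X"
  shows "V y \<le> exp (- X / 2) * exp (1 / 16 * (X - y))"
proof -
  have "V y \<le> 5 / 128 * (exp (- X / 2) * exp (a / 8 * (X - y)))" using V_le[OF assms] by simp
  also have "\<dots> \<le> 1 * (exp (- X / 2) * exp (a / 8 * (X - y)))" by (intro mult_right_mono) auto
  also have "a / 8 * (X - y) \<le> 1 / 16 * (X - y)" using a_le assms by (intro mult_right_mono) auto
  finally show ?thesis by simp
qed

text \<open>\<open>V y - y * V1 y\<close> is the intercept at 0 of the tangent at \<open>y\<close>.
  It starts from \<open>V 0\<close> and decreases by the integral of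
  \<open>y * a\<^sup>2 * f * V\<close>, whose integrand decays away from \<open>X\<close> at rate
  \<open>7 / 16 - 1 / 16 = 3 / 8\<close>. The total loss is therefore of order
  \<open>a * X * exp (- X / 2)\<close>, and the final intercept is bounded through
  \<open>V1 X >= - a * V X\<close>.\<close>

lemma exp_cut_ge: "a * (1 - s) \<le> 12 * X * exp (- X / 2)"
proof -
  define A where "A = exp (- X / 2)"
  have A: "0 < A" by (simp add: A_def)
  have fV: "f y * V y \<le> 1 / a * (A * exp (- (3 / 8) * (X - y)))" if "0 \<le> y" "y \<le> X" for y
  proof -
    have "f y * V y \<le> (1 / a * exp (- (7 / 16) * (X - y))) * (A * exp (1 / 16 * (X - y)))"
      using f_le[OF that] V_le'[OF that] V_nonneg[of y] that a_pos
      by (intro mult_mono) (auto simp: A_def)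
    also have "\<dots> = 1 / a * (A * (exp (- (7 / 16) * (X - y)) * exp (1 / 16 * (X - y))))" by simp
    also have "exp (- (7 / 16) * (X - y)) * exp (1 / 16 * (X - y)) = exp (- (3 / 8) * (X - y))"
      by (subst exp_add[symmetric]) (rule arg_cong[where f = exp], linarith)
    finally show ?thesis .
  qed
  let ?h = "\<lambda>y. V y - y * V1 y + 8 / 3 * a * X * A * exp (- (3 / 8) * (X - y))"
  have "?h 0 \<le> ?h X"
    using X_nonneg
  proof (rule deriv_nonneg_imp_le)
    show "continuous_on {0..X} ?h" by (intro continuous_intros cont_V cont_V1) auto
    fix z assume z: "0 < z" "z < X"
    then show "(?h has_real_derivative a * X * A * exp (- (3 / 8) * (X - z)) - z * (a\<^sup>2 * f z * V z)) (at z)"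
      by (auto intro!: derivative_eq_intros dV dV1 simp: algebra_simps)
    have "z * (a\<^sup>2 * f z * V z) = a\<^sup>2 * (z * (f z * V z))" by simp
    also have "\<dots> \<le> a\<^sup>2 * (X * (1 / a * (A * exp (- (3 / 8) * (X - z)))))"
      using fV[of z] z f_bounds[of z] V_nonneg[of z] by (intro mult_left_mono[OF mult_mono]) auto
    also have "\<dots> = a * X * A * exp (- (3 / 8) * (X - z))"
      using a_pos by (simp add: power2_eq_square)
    finally show "0 \<le> a * X * A * exp (- (3 / 8) * (X - z)) - z * (a\<^sup>2 * f z * V z)" by simp
  qed
  moreover have "0 \<le> 8 / 3 * a * X * A * exp (- (3 / 8) * (X - 0))" using A a_pos X_nonneg by simp
  ultimately have "V 0 \<le> V X - X * V1 X + 8 / 3 * a * X * A" by (simp add: algebra_simps)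
  also have "\<dots> \<le> V X + X * (a * V X) + 8 / 3 * a * X * A"
    using V1_ge[OF X_nonneg] X_nonneg mult_left_mono[of "- a * V X" "V1 X" X] by simp
  also have "\<dots> \<le> A + X * (a * A) + 8 / 3 * a * X * A"
  proof -
    have "V X \<le> A" using V_X A unfolding A_def by linarith
    then show ?thesis using a_pos X_nonneg by (intro add_mono mult_left_mono) auto
  qed
  also have "\<dots> = (1 + 11 / 3 * (a * X)) * A" by (simp add: algebra_simps)
  also have "\<dots> \<le> 3 * X * A"
  proof -
    have "a * X \<le> 1 / 2 * X" using a_le X_nonneg by (intro mult_right_mono) auto
    then have "1 + 11 / 3 * (a * X) \<le> 3 * X" using X_ge(2) by linarith
    then show ?thesis using A by (intro mult_right_mono) auto
  qed
  finally have "V 0 \<le> 3 * X * A" .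
  moreover have "a * (1 - s) \<le> 4 * V 0" using G_0 V_0(2) by simp
  ultimately show ?thesis by (simp add: A_def)
qed

end

text \<open>If \<open>p.f x = 1 - E s\<^sup>T\<close> and \<open>q.f x = 1 - E s\<^sup>2\<^sup>T\<close>, then \<open>d = E (1 - s\<^sup>T)\<^sup>2\<close>.\<close>

locale profile_pair =
  p: profile_ode a s G G1 + q: profile_ode a "s\<^sup>2" H H1 for a s G G1 H H1 +
  assumes H_le: "\<And>x. 0 \<le> x \<Longrightarrow> H x \<le> 2 * G x"
    and f_le_f: "\<And>x. 0 \<le> x \<Longrightarrow> p.f x \<le> q.f x"
begin

definition D :: "real \<Rightarrow> real" where "D x = 2 * G x - H x"
definition D1 :: "real \<Rightarrow> real" where "D1 x = 2 * G1 x - H1 x"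
definition d :: "real \<Rightarrow> real" where "d x = 2 * p.f x - q.f x"

section \<open>The difference of the solutions at \<open>s\<close> and at its square\<close>

lemma D_nonneg: "0 \<le> x \<Longrightarrow> 0 \<le> D x"
  using H_le by (simp add: D_def)

lemma cont_D: "0 \<le> u \<Longrightarrow> continuous_on {u..v} D" "0 \<le> u \<Longrightarrow> continuous_on {u..v} D1"
  unfolding D_def D1_def by (intro continuous_intros p.cont_G q.cont_G; simp)+

lemma dD: "0 < x \<Longrightarrow> (D has_real_derivative D1 x) (at x)"
  unfolding D_def D1_def by (auto intro!: derivative_eq_intros p.dG q.dG)

lemma dD1: "0 < x \<Longrightarrow> (D1 has_real_derivative a\<^sup>2 * (D x - exp (- x / 2) * d x)) (at x)"
  unfolding D_def D1_def d_def
  by (auto intro!: derivative_eq_intros p.dG1 q.dG1 simp: algebra_simps)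

lemma D_tendsto_0: "(D \<longlongrightarrow> 0) at_top" "(D1 \<longlongrightarrow> 0) at_top"
  using tendsto_diff[OF tendsto_mult[OF tendsto_const[of 2] p.G_lim(1)] q.G_lim(1)]
    tendsto_diff[OF tendsto_mult[OF tendsto_const[of 2] p.G_lim(2)] q.G_lim(2)]
  by (simp_all add: D_def[abs_def] D1_def[abs_def])

lemma D1_0: "D1 0 = a * D 0"
  by (simp add: D_def D1_def p.G1_0 q.G1_0 algebra_simps)

text \<open>With \<open>\<delta> = 2 g - h\<close>, the exponents satisfy \<open>1 - q.f x = (1 - p.f x)\<^sup>2 * exp \<delta>\<close>;
  both bounds are instances of \<open>1 + t \<le> exp t\<close>.\<close>

lemma d_ge:
  shows "(p.f x)\<^sup>2 + (1 - p.f x)\<^sup>2 * (exp (x / 2) * D x) \<le> d x"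
    and "d x \<le> (p.f x)\<^sup>2 + (1 - q.f x) * (exp (x / 2) * D x)"
proof -
  define \<delta> where "\<delta> = exp (x / 2) * D x"
  have delta: "\<delta> = 2 * p.g x - q.g x" by (simp add: \<delta>_def D_def p.g_def q.g_def algebra_simps)
  have 1: "1 - q.f x = (1 - p.f x)\<^sup>2 * exp \<delta>"
  proof -
    have "(exp (- p.g x))\<^sup>2 * exp \<delta> = exp (- p.g x + - p.g x + \<delta>)"
      by (simp only: exp_add power2_eq_square)
    also have "- p.g x + - p.g x + \<delta> = - q.g x" by (simp add: delta)
    finally show ?thesis by (simp add: p.f_def q.f_def power_mult_distrib)
  qed
  have "(1 - p.f x)\<^sup>2 * (1 + \<delta>) \<le> (1 - p.f x)\<^sup>2 * exp \<delta>"
    by (intro mult_left_mono) auto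
  with 1 show "(p.f x)\<^sup>2 + (1 - p.f x)\<^sup>2 * (exp (x / 2) * D x) \<le> d x"
    unfolding \<delta>_def[symmetric] by (simp add: d_def power2_eq_square algebra_simps)
  have "(1 - p.f x)\<^sup>2 = (1 - q.f x) * exp (- \<delta>)" using 1 by (simp add: exp_minus)
  moreover have "(1 - q.f x) * (1 - \<delta>) \<le> (1 - q.f x) * exp (- \<delta>)"
    using exp_ge_add_one_self[of "- \<delta>"] by (intro mult_left_mono) (auto simp: q.f_def)
  ultimately show "d x \<le> (p.f x)\<^sup>2 + (1 - q.f x) * (exp (x / 2) * D x)"
    unfolding \<delta>_def[symmetric] by (simp add: d_def power2_eq_square algebra_simps)
qed

lemma d_nonneg: "0 \<le> x \<Longrightarrow> 0 \<le> d x"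
  using d_ge(1)[of x] D_nonneg[of x] by (smt (verit) exp_ge_zero mult_nonneg_nonneg zero_le_power2)

text \<open>\<open>d >= 0\<close> gives \<open>D'' <= a^2 D\<close>; then \<open>D1 + a * D\<close>
  cannot be negative anywhere without staying so up to infinity, where it vanishes.\<close>

lemma D_decay:
  assumes "0 \<le> x" shows "D 0 \<le> D x * exp (a * x)"
proof -
  have P: "0 \<le> D1 x + a * D x" if "0 \<le> x" for x
    using tendsto_add[OF D_tendsto_0(2) tendsto_mult[OF tendsto_const[of a] D_tendsto_0(1)]]
    unfolding mult_zero_right add_0
  proof (rule gronwall_tendsto_0)
    show "continuous_on {x..v} (\<lambda>x. D1 x + a * D x)" for v
      using that by (intro continuous_intros cont_D)
    fix z assume z: "x < z"
    then show "((\<lambda>x. D1 x + a * D x) has_real_derivative a\<^sup>2 * (D z - exp (- z / 2) * d z) + a * D1 z) (at z)"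
      using that by (auto intro!: derivative_eq_intros dD dD1)
    show "a\<^sup>2 * (D z - exp (- z / 2) * d z) + a * D1 z \<le> a * (D1 z + a * D z)"
      using z that d_nonneg[of z] p.a_pos by (simp add: algebra_simps power2_eq_square)
  qed (use p.a_pos in simp)
  have "- D x \<le> - D 0 * exp (- a * (x - 0))"
    using assms
  proof (rule gronwall_le)
    fix z assume z: "0 < z" "z < x"
    then show "((\<lambda>x. - D x) has_real_derivative - D1 z) (at z)" by (intro derivative_intros dD)
    show "- D1 z \<le> - a * - D z" using P[of z] z by simp
  qed (intro continuous_intros cont_D; simp)
  then have "D 0 * exp (- a * x) * exp (a * x) \<le> D x * exp (a * x)" by (intro mult_right_mono) auto
  then show ?thesis by (simp add: mult.assoc exp_add[symmetric])
qed

end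

locale profile_pair_cut = profile_pair a s G G1 H H1 + p: profile_cut a s G G1 X
  for a s G G1 H H1 X
begin

text \<open>The Wronskian \<open>D' * V - D * V'\<close> equals \<open>a\<^sup>2 * D 0 * p.f 0\<close> at \<open>0\<close> and vanishes at infinity.\<close>

lemma D_0_upper: "D 0 * (a\<^sup>2 * (1 - s)) \<le> 4 * (exp (- X / 2))\<^sup>2"
proof -
  define A where "A = exp (- X / 2)"
  have A: "0 < A" by (simp add: A_def)
  define U where "U x = D1 x * p.V x - D x * p.V1 x" for x
  define U1 where "U1 x = a\<^sup>2 * p.V x * (D x - exp (- x / 2) * d x - p.f x * D x)" for x
  have contU: "continuous_on {u..v} U" if "0 \<le> u" for u v
    unfolding U_def using that by (intro continuous_intros cont_D p.cont_V p.cont_V1)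
  have dU: "(U has_real_derivative U1 x) (at x)" if "0 < x" for x
    unfolding U_def U1_def using that
    by (auto intro!: derivative_eq_intros dD dD1 p.dV p.dV1 simp: algebra_simps)
  \<comment> \<open>With the upper bound in \<open>d_ge\<close> the terms linear in \<open>D\<close>
    combine to \<open>(q.f x - p.f x) * D x >= 0\<close>; only the square of \<open>p.f\<close> can
    make \<open>U\<close> fall.\<close>
  have U1: "- (a\<^sup>2 * p.V x * (exp (- x / 2) * (p.f x)\<^sup>2)) \<le> U1 x" if "0 \<le> x" for x
  proof -
    have "exp (- x / 2) * d x \<le> exp (- x / 2) * ((p.f x)\<^sup>2 + (1 - q.f x) * (exp (x / 2) * D x))"
      by (intro mult_left_mono d_ge) auto
    also have "\<dots> = exp (- x / 2) * (p.f x)\<^sup>2 + (1 - q.f x) * (exp (- x / 2) * (exp (x / 2) * D x))"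
      by (simp add: algebra_simps)
    also have "exp (- x / 2) * (exp (x / 2) * D x) = D x" by (rule exp_half_cancel)
    finally have "- (exp (- x / 2) * (p.f x)\<^sup>2) + (q.f x - p.f x) * D x
        \<le> D x - exp (- x / 2) * d x - p.f x * D x" by (simp add: algebra_simps)
    moreover have "0 \<le> (q.f x - p.f x) * D x"
      using D_nonneg f_le_f that by (intro mult_nonneg_nonneg) auto
    ultimately have "- (exp (- x / 2) * (p.f x)\<^sup>2) \<le> D x - exp (- x / 2) * d x - p.f x * D x" by simp
    from mult_left_mono[OF this, of "a\<^sup>2 * p.V x"] show ?thesis
      using p.V_nonneg[OF that] by (simp add: U1_def)
  qed
  have limU: "(U \<longlongrightarrow> 0) at_top"
    using tendsto_diff[OF tendsto_mult[OF D_tendsto_0(2) p.V_tendsto_0] tendsto_mult[OF D_tendsto_0(1) p.V1_tendsto_0]]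
    by (simp add: U_def[abs_def])
  \<comment> \<open>Right of \<open>X\<close>, \<open>V <= A\<close> and \<open>f <= 1\<close>
    suffice: the subtracted term is the tail integral of the resulting bound
    \<open>a\<^sup>2 * A * exp (- x / 2)\<close>.\<close>
  have "U X - 2 * a\<^sup>2 * A * exp (- X / 2) \<le> 0"
  proof (rule incseq_tendsto_0_le[where h = "\<lambda>x. U x - 2 * a\<^sup>2 * A * exp (- x / 2)"])
    have "((\<lambda>x. 2 * a\<^sup>2 * A * exp (- x / 2)) \<longlongrightarrow> 0) at_top" by real_asymp
    from tendsto_diff[OF limU this] show "((\<lambda>x. U x - 2 * a\<^sup>2 * A * exp (- x / 2)) \<longlongrightarrow> 0) at_top" by simp
    fix y assume "X \<le> y"
    then show "U X - 2 * a\<^sup>2 * A * exp (- X / 2) \<le> U y - 2 * a\<^sup>2 * A * exp (- y / 2)"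
    proof (rule deriv_nonneg_imp_le)
      show "continuous_on {X..y} (\<lambda>x. U x - 2 * a\<^sup>2 * A * exp (- x / 2))"
        using p.X_nonneg by (intro continuous_intros contU) auto
      fix z assume z: "X < z" "z < y"
      have z0: "0 < z" using z p.X_nonneg by simp
      then show "((\<lambda>x. U x - 2 * a\<^sup>2 * A * exp (- x / 2)) has_real_derivative
          U1 z + a\<^sup>2 * A * exp (- z / 2)) (at z)"
        by (auto intro!: derivative_eq_intros dU)
      have "p.V X \<le> A" using p.V_X A unfolding A_def by linarith
      then have "p.V z \<le> A" using p.V_antimono[of X z] z p.X_nonneg by simp
      then have "p.V z * (exp (- z / 2) * (p.f z)\<^sup>2) \<le> A * (exp (- z / 2) * 1)"
        using z0 p.f_bounds[of z] A by (intro mult_mono) (auto intro: power_le_one)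
      from mult_left_mono[OF this, of "a\<^sup>2"] show "0 \<le> U1 z + a\<^sup>2 * A * exp (- z / 2)"
        using U1[of z] z0 by (simp add: mult.assoc)
    qed
  qed
  then have "U X \<le> 2 * (a\<^sup>2 * A\<^sup>2)" by (simp add: A_def power2_eq_square)
  moreover have "a\<^sup>2 * A\<^sup>2 \<le> 1 / 4 * A\<^sup>2" by (intro mult_right_mono p.a_sq) simp
  ultimately have UX: "U X \<le> 1 / 2 * A\<^sup>2" by linarith
  \<comment> \<open>Left of \<open>X\<close> the rates in \<open>X - y\<close> are
    \<open>1 / 16\<close> from \<open>V\<close>, \<open>- 7 / 8\<close> from the square of
    \<open>f\<close>, and \<open>1 / 2\<close> from \<open>exp (- y / 2)\<close> after a factor
    \<open>A\<close> is split off: in total \<open>- 5 / 16\<close>, with integral at most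
    \<open>16 / 5\<close>.\<close>
  let ?h = "\<lambda>y. U y + 16 / 5 * A\<^sup>2 * exp (- (5 / 16) * (X - y))"
  have "?h 0 \<le> ?h X"
    using p.X_nonneg
  proof (rule deriv_nonneg_imp_le)
    show "continuous_on {0..X} ?h" by (intro continuous_intros contU) auto
    fix z assume z: "0 < z" "z < X"
    then show "(?h has_real_derivative U1 z + A\<^sup>2 * exp (- (5 / 16) * (X - z))) (at z)"
      by (auto intro!: derivative_eq_intros dU simp: algebra_simps)
    have "p.V z * (exp (- z / 2) * (p.f z)\<^sup>2)
        \<le> (A * exp (1 / 16 * (X - z))) * (exp (- z / 2) * (1 / a * exp (- (7 / 16) * (X - z)))\<^sup>2)"
      using p.V_le'[of z] p.f_le[of z] z p.f_bounds[of z] p.a_pos A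
      by (intro mult_mono power_mono) (auto simp: A_def)
    also have "\<dots> = 1 / a\<^sup>2 * (A * (A * exp (- (5 / 16) * (X - z))))"
    proof -
      have "exp (1 / 16 * (X - z)) * (exp (- z / 2) * (exp (- (7 / 16) * (X - z)))\<^sup>2)
          = exp (1 / 16 * (X - z) + (- z / 2 + (- (7 / 16) * (X - z) + - (7 / 16) * (X - z))))"
        by (simp only: exp_add power2_eq_square)
      also have "1 / 16 * (X - z) + (- z / 2 + (- (7 / 16) * (X - z) + - (7 / 16) * (X - z)))
          = - X / 2 + - (5 / 16) * (X - z)" by (simp add: field_simps)
      finally have "exp (1 / 16 * (X - z)) * (exp (- z / 2) * (exp (- (7 / 16) * (X - z)))\<^sup>2)
          = A * exp (- (5 / 16) * (X - z))" by (simp only: exp_add A_def)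
      moreover have "(A * exp (1 / 16 * (X - z))) * (exp (- z / 2) * (1 / a * exp (- (7 / 16) * (X - z)))\<^sup>2)
          = 1 / a\<^sup>2 * (A * (exp (1 / 16 * (X - z)) * (exp (- z / 2) * (exp (- (7 / 16) * (X - z)))\<^sup>2)))"
        unfolding power_mult_distrib power_divide power_one by (simp only: mult_ac)
      ultimately show ?thesis by (simp only:)
    qed
    finally have "a\<^sup>2 * (p.V z * (exp (- z / 2) * (p.f z)\<^sup>2))
        \<le> a\<^sup>2 * (1 / a\<^sup>2 * (A * (A * exp (- (5 / 16) * (X - z)))))"
      by (rule mult_left_mono) simp
    also have "\<dots> = A\<^sup>2 * exp (- (5 / 16) * (X - z))"
      using p.a_pos by (simp add: power2_eq_square)
    finally show "0 \<le> U1 z + A\<^sup>2 * exp (- (5 / 16) * (X - z))"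
      using U1[of z] z by (simp add: mult.assoc)
  qed
  then have "U 0 + 16 * A\<^sup>2 * exp (- (5 * X / 16)) / 5 \<le> U X + 16 / 5 * A\<^sup>2" by simp
  moreover have "0 \<le> 16 * A\<^sup>2 * exp (- (5 * X / 16)) / 5" by simp
  ultimately have "U 0 \<le> U X + 16 / 5 * A\<^sup>2" by linarith
  then have U0: "U 0 \<le> 4 * A\<^sup>2" using UX zero_le_power2[of A] by linarith
  have "U 0 = D 0 * (a\<^sup>2 * p.f 0)"
    by (simp add: U_def D1_0 p.V_def p.V1_def p.G1_0 power2_eq_square algebra_simps)
  then have "D 0 * (a\<^sup>2 * (1 - s)) \<le> U 0"
    using D_nonneg[of 0] p.f_bounds[of 0] by (auto intro!: mult_left_mono)
  with U0 show ?thesis by (simp add: A_def)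
qed

text \<open>Here the Wronskian is taken with \<open>Z\<close>, which is comparable to the distance from \<open>X - 16\<close> and
  satisfies \<open>Z'' \<ge> 2 * a\<^sup>2 * p.f * Z\<close> thanks to the exponential smallness of \<open>p.f\<close> left of \<open>X\<close>.\<close>

lemma D_0_lower: "a\<^sup>2 / 2 * (1 - exp (- (exp (- 18) / 128)))\<^sup>2 * exp (- X / 2) \<le> X * D 0"
proof -
  define A where "A = exp (- X / 2)"
  define c where "c = 1 - exp (- (exp (- 18) / 128) :: real)"
  have c: "0 < c" by (simp add: c_def)
  \<comment> \<open>The margin 16 puts a factor \<open>exp (- 7) <= 1 / 128\<close> into the bound
    on \<open>p.f\<close>, enough for the differential inequality of \<open>Z\<close>.\<close>
  define Y where "Y = X - 16"
  have Y: "16 \<le> Y" using p.X_ge by (simp add: Y_def)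
  \<comment> \<open>The correction costs at most half of the distance to \<open>Y\<close>. Its
    second derivative decays at rate \<open>1 / 8\<close>, slower than the rate
    \<open>7 / 16\<close> of \<open>p.f\<close>; the remaining \<open>5 / 16\<close> absorbs the
    linear factor.\<close>
  define Z where "Z y = Y - y - 4 * (1 - exp (- (Y - y) / 8))" for y
  define Z1 where "Z1 y = - 1 + exp (- (Y - y) / 8) / 2" for y
  define Z2 where "Z2 y = exp (- (Y - y) / 8) / 16" for y
  have dZ: "(Z has_real_derivative Z1 y) (at y)" "(Z1 has_real_derivative Z2 y) (at y)" for y
    unfolding Z_def Z1_def Z2_def by (auto intro!: derivative_eq_intros)
  have Z_ge: "(Y - y) / 2 \<le> Z y" for y
    using exp_ge_add_one_self[of "- (Y - y) / 8"] by (simp add: Z_def field_simps)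
  have Z_le: "Z y \<le> Y - y" if "y \<le> Y" for y
    using that by (simp add: Z_def)
  have Z2: "a\<^sup>2 * (2 * p.f y) * Z y \<le> Z2 y" if y: "0 \<le> y" "y \<le> Y" for y
  proof -
    define r where "r = Y - y"
    have r: "0 \<le> r" "X - y = r + 16" using y by (auto simp: r_def Y_def)
    have f: "0 \<le> p.f y" "p.f y \<le> 1 / a * exp (- (7 / 16) * (r + 16))"
      using p.f_bounds[OF y(1)] p.f_le[of y] y unfolding r(2)[symmetric] by (auto simp: Y_def)
    have Z: "0 \<le> Z y" "Z y \<le> r" using Z_ge[of y] Z_le[OF y(2)] r by (auto simp: r_def)
    have "2 * p.f y \<le> 2 * (1 / a * exp (- (7 / 16) * (r + 16)))" using f by linarith
    then have "a\<^sup>2 * (2 * p.f y) * Z y \<le> a\<^sup>2 * (2 * (1 / a * exp (- (7 / 16) * (r + 16)))) * r"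
      using f Z r p.a_pos by (intro mult_mono mult_left_mono) simp_all
    also have "\<dots> = 2 * a * (exp (- (7 / 16) * (r + 16)) * r)"
      using p.a_pos by (simp add: power2_eq_square)
    also have "\<dots> \<le> 1 * (exp (- (7 / 16) * (r + 16)) * r)"
      using p.a_le r by (intro mult_right_mono) auto
    also have "\<dots> = exp (- 7) * (exp (- r / 8) * (exp (- (5 / 16) * r) * r))"
    proof -
      have "- (7 / 16) * (r + 16) = - 7 + (- r / 8 + - (5 / 16) * r)" by (simp add: field_simps)
      then have "exp (- (7 / 16) * (r + 16)) = exp (- 7) * (exp (- r / 8) * exp (- (5 / 16) * r))"
        by (simp only: exp_add)
      then show ?thesis by simp
    qed
    also have "\<dots> \<le> 1 / 128 * (exp (- r / 8) * (16 / 5))"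
    proof (intro mult_mono)
      show "exp (- 7 :: real) \<le> 1 / 128"
        using two_power_le_exp[of 7] by (simp add: exp_minus field_simps)
      have "5 / 16 * r \<le> exp (5 / 16 * r)"
        using exp_ge_add_one_self[of "5 / 16 * r"] by linarith
      then show "exp (- (5 / 16) * r) * r \<le> 16 / 5" by (simp add: exp_minus field_simps)
    qed (use r in auto)
    also have "\<dots> \<le> Z2 y" by (simp add: Z2_def r_def)
    finally show ?thesis .
  qed
  define U where "U x = D1 x * Z x - D x * Z1 x" for x
  define U1 where "U1 x = a\<^sup>2 * (D x - exp (- x / 2) * d x) * Z x - D x * Z2 x" for x
  have contU: "continuous_on {u..v} U" if "0 \<le> u" for u v
    unfolding U_def Z_def Z1_def using that by (intro continuous_intros cont_D) auto
  have dU: "(U has_real_derivative U1 x) (at x)" if "0 < x" for x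
    unfolding U_def U1_def using that
    by (auto intro!: derivative_eq_intros dD dD1 dZ simp: algebra_simps)
  have U1: "U1 x \<le> - (a\<^sup>2 * (exp (- x / 2) * (p.f x)\<^sup>2) * Z x)" if x: "0 \<le> x" "x \<le> Y" for x
  proof -
    have "exp (- x / 2) * ((p.f x)\<^sup>2 + (1 - p.f x)\<^sup>2 * (exp (x / 2) * D x)) \<le> exp (- x / 2) * d x"
      by (intro mult_left_mono d_ge) auto
    moreover have "exp (- x / 2) * ((1 - p.f x)\<^sup>2 * (exp (x / 2) * D x)) = (1 - p.f x)\<^sup>2 * D x"
      using exp_half_cancel(1)[of x "(1 - p.f x)\<^sup>2 * D x"] by (simp only: mult_ac)
    ultimately have "D x - exp (- x / 2) * d x \<le> D x - exp (- x / 2) * (p.f x)\<^sup>2 - (1 - p.f x)\<^sup>2 * D x"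
      unfolding distrib_left by linarith
    also have "\<dots> \<le> 2 * p.f x * D x - exp (- x / 2) * (p.f x)\<^sup>2"
      using D_nonneg[OF x(1)] p.f_bounds[OF x(1)] by (simp add: power2_eq_square algebra_simps)
    finally have "a\<^sup>2 * (D x - exp (- x / 2) * d x) * Z x
        \<le> a\<^sup>2 * (2 * p.f x * D x - exp (- x / 2) * (p.f x)\<^sup>2) * Z x"
      using Z_ge[of x] x by (intro mult_right_mono mult_left_mono) auto
    also have "\<dots> = (a\<^sup>2 * (2 * p.f x) * Z x) * D x - a\<^sup>2 * (exp (- x / 2) * (p.f x)\<^sup>2) * Z x"
      by (simp add: algebra_simps)
    also have "\<dots> \<le> Z2 x * D x - a\<^sup>2 * (exp (- x / 2) * (p.f x)\<^sup>2) * Z x"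
      using Z2[OF x] D_nonneg[OF x(1)] by (intro diff_right_mono mult_right_mono) auto
    finally show ?thesis by (simp add: U1_def mult.commute)
  qed
  have dec: "U v \<le> U u" if "0 \<le> u" "u \<le> v" "v \<le> Y" for u v
    using that(2)
  proof (rule deriv_nonpos_imp_ge)
    fix x assume x: "u < x" "x < v"
    show "(U has_real_derivative U1 x) (at x)" using x that by (intro dU) auto
    have "0 \<le> a\<^sup>2 * (exp (- x / 2) * (p.f x)\<^sup>2) * Z x"
      using Z_ge[of x] x that by (intro mult_nonneg_nonneg) auto
    then show "U1 x \<le> 0" using U1[of x] x that by simp
  qed (use that contU in auto)
  \<comment> \<open>On this window the distance to \<open>X\<close> is at most 18, so
    \<open>g_growth\<close> gives \<open>p.g >= exp (- 18) / 128\<close> and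
    \<open>p.f >= c\<close>; also \<open>Z >= 1 / 2\<close>. The square of \<open>p.f\<close> thus
    lowers \<open>U\<close> by a definite multiple of \<open>A\<close>.\<close>
  have "U (Y - 1) + a\<^sup>2 / 2 * c\<^sup>2 * A * (Y - 1) \<le> U (Y - 2) + a\<^sup>2 / 2 * c\<^sup>2 * A * (Y - 2)"
  proof (rule deriv_nonpos_imp_ge[where h = "\<lambda>y. U y + a\<^sup>2 / 2 * c\<^sup>2 * A * y"])
    show "continuous_on {Y - 2..Y - 1} (\<lambda>y. U y + a\<^sup>2 / 2 * c\<^sup>2 * A * y)"
      using Y by (intro continuous_intros contU) auto
    fix y assume y: "Y - 2 < y" "y < Y - 1"
    then show "((\<lambda>y. U y + a\<^sup>2 / 2 * c\<^sup>2 * A * y) has_real_derivative U1 y + a\<^sup>2 / 2 * c\<^sup>2 * A) (at y)"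
      using Y by (auto intro!: derivative_eq_intros dU)
    have y0: "0 \<le> y" "y \<le> X" "y \<le> Y" using y Y by (auto simp: Y_def)
    have "c \<le> p.f y"
    proof -
      have "1 / 128 \<le> p.g y * exp (X - y)" using p.g_growth[of y X] y0 p.g_X by simp
      also have "\<dots> \<le> p.g y * exp 18"
        using y p.g_nonneg[OF y0(1)] by (intro mult_left_mono) (auto simp: Y_def)
      finally have "exp (- 18) / 128 \<le> p.g y" by (simp add: exp_minus field_simps)
      then have "s * exp (- p.g y) \<le> 1 * exp (- (exp (- 18) / 128))"
        using p.s_less p.s_pos by (intro mult_mono) auto
      then show ?thesis by (simp add: p.f_def c_def)
    qed
    then have "A * c\<^sup>2 * (1 / 2) \<le> exp (- y / 2) * (p.f y)\<^sup>2 * Z y"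
      using y0 Z_ge[of y] y c by (intro mult_mono power_mono) (auto simp: A_def)
    from mult_left_mono[OF this, of "a\<^sup>2"] show "U1 y + a\<^sup>2 / 2 * c\<^sup>2 * A \<le> 0"
      using U1[OF y0(1,3)] by (simp add: mult_ac)
  qed simp
  then have "a\<^sup>2 / 2 * c\<^sup>2 * A \<le> U (Y - 2) - U (Y - 1)"
    by (simp add: algebra_simps diff_divide_distrib)
  also have "\<dots> \<le> U 0 - U Y" using dec[of 0 "Y - 2"] dec[of "Y - 1" Y] Y by simp
  also have "\<dots> \<le> U 0" using D_nonneg[of Y] Y by (simp add: U_def Z_def Z1_def)
  also have "U 0 = D 0 * (a * Z 0 - Z1 0)" by (simp add: U_def D1_0 algebra_simps)
  also have "\<dots> \<le> D 0 * X"
  proof (rule mult_left_mono)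
    have "a * Z 0 \<le> 1 / 2 * Y"
      using p.a_le p.a_pos Z_le[of 0] Z_ge[of 0] Y by (intro mult_mono) auto
    moreover have "- 1 \<le> Z1 0" by (simp add: Z1_def)
    ultimately show "a * Z 0 - Z1 0 \<le> X" using p.X_ge(2) unfolding Y_def by argo
  qed (use D_nonneg in simp)
  finally show ?thesis by (simp add: c_def A_def mult.commute)
qed

text \<open>Near 0 the linear term in \<open>d_ge\<close> has weight at least \<open>1 / 2\<close>,
  since the profile is small there, and \<open>D\<close> loses at most a factor 2 by
  \<open>D_decay\<close>.\<close>

lemma d_lower:
  assumes "0 \<le> y" "y \<le> 1" shows "D 0 / 4 \<le> d y"
proof -
  have "p.g y \<le> p.g 0 * exp (y - 0)" by (rule p.g_growth) (use assms in auto)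
  also have "\<dots> \<le> (2 * (1 - s)) * 3"
    using p.G_0_upper assms exp_le p.s_less
    by (intro mult_mono) (auto simp: p.g_def intro: order_trans[of _ "exp 1"])
  finally have "7 / 8 \<le> 1 - p.f y" using p.f_bounds(4)[OF assms(1)] p.small' by simp
  then have "(7 / 8)\<^sup>2 \<le> (1 - p.f y)\<^sup>2" by (intro power_mono) auto
  then have f: "1 / 2 \<le> (1 - p.f y)\<^sup>2" by (simp add: power2_eq_square)
  have "a * y \<le> 1 / 2 * 1" using p.a_le p.a_pos assms by (intro mult_mono) auto
  then have "exp (a * y) \<le> exp (1 / 2)" by simp
  also have "\<dots> \<le> (2::real)"
  proof (rule power2_le_imp_le)
    have "(exp (1 / 2))\<^sup>2 = (exp 1 :: real)" by (simp add: power2_eq_square exp_add[symmetric])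
    then show "(exp (1 / 2))\<^sup>2 \<le> (2::real)\<^sup>2" using exp_le by simp
  qed simp
  finally have e: "exp (a * y) \<le> 2" .
  have Dy: "0 \<le> D y" by (rule D_nonneg[OF assms(1)])
  have "D 0 \<le> D y * exp (a * y)" by (rule D_decay[OF assms(1)])
  also have "\<dots> \<le> D y * 2" using e Dy by (intro mult_left_mono) auto
  finally have "D 0 / 4 \<le> 1 / 2 * (1 * D y)" by simp
  also have "\<dots> \<le> (1 - p.f y)\<^sup>2 * (exp (y / 2) * D y)"
    using f Dy assms by (intro mult_mono) auto
  also have "\<dots> \<le> d y" using d_ge(1)[of y] zero_le_power2[of "p.f y"] by linarith
  finally show ?thesis .
qed

end

section \<open>The fixed point of the limiting branching process\<close>

lemma has_bochner_integral_exp_Ici: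
  assumes "0 < (c::real)"
  shows "has_bochner_integral lborel (\<lambda>y. indicator {X..} y * exp (- c * y)) (exp (- c * X) / c)"
proof (rule has_bochner_integral_nn_integral)
  have "(\<integral>\<^sup>+y. ennreal (exp (- c * y)) * indicator {X..} y \<partial>lborel) = ennreal (0 - (- exp (- c * X) / c))"
  proof (rule nn_integral_FTC_atLeast)
    show "((\<lambda>y. - exp (- c * y) / c) has_real_derivative exp (- c * x)) (at x)" for x
      using assms by (auto intro!: derivative_eq_intros)
    show "((\<lambda>y. - exp (- c * y) / c) \<longlongrightarrow> 0) at_top" using assms by real_asymp
  qed auto
  then show "(\<integral>\<^sup>+y. ennreal (indicator {X..} y * exp (- c * y)) \<partial>lborel) = ennreal (exp (- c * X) / c)"
    by (simp add: ennreal_mult' mult.commute ennreal_indicator)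
qed (use assms in auto)

lemmas integrable_exp_Ici = integrable.intros[OF has_bochner_integral_exp_Ici]
lemmas integral_exp_Ici = has_bochner_integral_integral_eq[OF has_bochner_integral_exp_Ici]

lemma integrable_exp_bound:
  fixes h :: "real \<Rightarrow> real"
  assumes "h \<in> borel_measurable borel" "0 < c"
    and "\<And>y. \<bar>h y\<bar> \<le> C * (indicator {0..} y * exp (- c * y))"
  shows "integrable lborel h"
proof (rule Bochner_Integration.integrable_bound)
  show "integrable lborel (\<lambda>y. C * (indicator {0..} y * exp (- c * y)))"
    using integrable_exp_Ici[OF assms(2), of 0] by (rule integrable_mult_right)
  show "AE y in lborel. norm (h y) \<le> norm (C * (indicator {0..} y * exp (- c * y)))"
    using assms(3) by (auto intro: order_trans[OF _ abs_ge_self])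
qed (use assms(1) in simp)

text \<open>Vertex \<open>v\<close> of \<open>{1..n}\<close> is placed at \<open>ln (n / v)\<close>, and \<open>a = 1 / 2 - \<gamma>\<close>, so that \<open>\<beta>\<^sub>c = a / 2\<close>. In the local
  limit the neighbours of a vertex at \<open>x\<close> form a Poisson process on \<open>{0..}\<close> with intensity \<open>ker x y dy\<close>,
  and \<open>prof s x\<close> is \<open>1 - E s\<^sup>T\<close> for the total progeny \<open>T\<close> of the branching process started at \<open>x\<close>.
  Since \<open>prof s\<close> vanishes on the negative axis, integrals run over the whole line.\<close>

locale kernel =
  fixes a :: real
  assumes a_pos: "0 < a" and a_le: "a \<le> 1 / 2"
begin

definition ker :: "real \<Rightarrow> real \<Rightarrow> real" where
  "ker x y = a / 2 * exp ((x - y) / 2 - a * \<bar>x - y\<bar>)"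

definition conv :: "(real \<Rightarrow> real) \<Rightarrow> real \<Rightarrow> real" where
  "conv f x = (LINT y|lborel. ker x y * f y)"

text \<open>Monotone because a larger coordinate is an older vertex, with more offspring. The class
  is preserved by \<open>step\<close> and by pointwise limits.\<close>

definition adm :: "(real \<Rightarrow> real) \<Rightarrow> bool" where
  "adm f \<longleftrightarrow> mono f \<and> (\<forall>x<0. f x = 0) \<and> (\<forall>x. f x \<le> 1)"

definition step :: "real \<Rightarrow> (real \<Rightarrow> real) \<Rightarrow> real \<Rightarrow> real" where
  "step s f x = (if x < 0 then 0 else 1 - s * exp (- conv f x))"

text \<open>1 minus the generating function of the number of individuals in the first
  \<open>m\<close> generations.\<close>

definition approx :: "real \<Rightarrow> nat \<Rightarrow> real \<Rightarrow> real" where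
  "approx s m = (step s ^^ m) (\<lambda>_. 0)"

definition prof :: "real \<Rightarrow> real \<Rightarrow> real" where
  "prof s x = lim (\<lambda>m. approx s m x)"

section \<open>Monotone iteration to the fixed point\<close>

lemma adm_bounds:
  assumes "adm f" shows "0 \<le> f x" "f x \<le> 1" "x < 0 \<Longrightarrow> f x = 0" "x \<le> y \<Longrightarrow> f x \<le> f y"
proof -
  show "f x \<le> 1" "x < 0 \<Longrightarrow> f x = 0" "x \<le> y \<Longrightarrow> f x \<le> f y"
    using assms by (auto simp: adm_def mono_def)
  show "0 \<le> f x"
  proof (cases "x < 0")
    case False
    have "f (- 1) = 0" using assms by (simp add: adm_def)
    moreover have "f (- 1) \<le> f x" using assms False monoD[of f "- 1" x] by (simp add: adm_def)
    ultimately show ?thesis by simp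
  qed (use assms in \<open>simp add: adm_def\<close>)
qed

lemma adm_measurable [measurable_dest]: "adm f \<Longrightarrow> f \<in> borel_measurable borel"
  by (auto simp: adm_def intro: borel_measurable_mono)

lemma ker_measurable [measurable]: "ker x \<in> borel_measurable borel"
  unfolding ker_def[abs_def] by measurable

lemma ker_pos: "0 < ker x y"
  using a_pos by (simp add: ker_def)

lemma ker_le: "ker x y \<le> a / 2 * exp (x / 2) * exp (- (1 / 2) * y)"
proof -
  have "(x - y) / 2 - a * \<bar>x - y\<bar> \<le> x / 2 + - (1 / 2) * y"
    using a_pos by (simp add: diff_divide_distrib)
  then have "exp ((x - y) / 2 - a * \<bar>x - y\<bar>) \<le> exp (x / 2 + - (1 / 2) * y)"
    by (simp only: exp_le_cancel_iff)
  then have "ker x y \<le> a / 2 * exp (x / 2 + - (1 / 2) * y)"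
    unfolding ker_def using a_pos by (intro mult_left_mono) auto
  also have "\<dots> = a / 2 * exp (x / 2) * exp (- (1 / 2) * y)" by (simp only: exp_add mult.assoc)
  finally show ?thesis .
qed

lemma ker_adm_le:
  assumes "adm f"
  shows "\<bar>ker x y * f y\<bar> \<le> a / 2 * exp (x / 2) * (indicator {0..} y * exp (- (1 / 2) * y))"
proof (cases "y < 0")
  case False
  have "ker x y * f y \<le> (a / 2 * exp (x / 2) * exp (- (1 / 2) * y)) * 1"
    using adm_bounds[OF assms, of y] ker_pos[of x y] ker_le[of x y] by (intro mult_mono) auto
  then show ?thesis
    using adm_bounds[OF assms, of y] ker_pos[of x y] False by (simp add: abs_mult)
qed (use adm_bounds[OF assms] a_pos in auto)

lemma integrable_ker_adm:
  assumes "adm f" shows "integrable lborel (\<lambda>y. ker x y * f y)"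
proof (rule integrable_exp_bound[OF _ _ ker_adm_le[OF assms]])
  show "(\<lambda>y. ker x y * f y) \<in> borel_measurable borel"
    using adm_measurable[OF assms] by measurable
qed simp

lemma conv_nonneg: "adm f \<Longrightarrow> 0 \<le> conv f x"
  unfolding conv_def using ker_pos[of x] adm_bounds[of f]
  by (intro integral_nonneg_AE AE_I2 mult_nonneg_nonneg) (auto intro: less_imp_le)

lemma conv_le:
  assumes "adm f" "adm f'" "\<And>y. f y \<le> C * f' y"
  shows "conv f x \<le> C * conv f' x"
proof -
  have "conv f x \<le> (LINT y|lborel. C * (ker x y * f' y))"
    unfolding conv_def
  proof (rule integral_mono)
    show "ker x y * f y \<le> C * (ker x y * f' y)" for y
      using mult_left_mono[OF assms(3)[of y], of "ker x y"] ker_pos[of x y] by (simp add: mult_ac)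
  qed (intro integrable_ker_adm integrable_mult_right assms)+
  then show ?thesis by (simp add: conv_def)
qed

lemma conv_mono:
  assumes "adm f" "x \<le> x'" shows "conv f x \<le> conv f x'"
proof -
  \<comment> \<open>The substitution \<open>y = x - t\<close> moves the dependence on
    \<open>x\<close> from the kernel into the monotone function.\<close>
  have *: "conv f x = (LINT t|lborel. a / 2 * exp (t / 2 - a * \<bar>t\<bar>) * f (x - t))"
    "integrable lborel (\<lambda>t. a / 2 * exp (t / 2 - a * \<bar>t\<bar>) * f (x - t))" for x
    using lborel_integral_real_affine[of "- 1" "\<lambda>y. ker x y * f y" x]
      lborel_integrable_real_affine[OF integrable_ker_adm[OF assms(1), of x], of "- 1" x]
    by (simp_all add: conv_def ker_def)
  show ?thesis
    unfolding *(1)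
  proof (intro integral_mono *(2) mult_left_mono)
    show "f (x - t) \<le> f (x' - t)" for t using adm_bounds(4)[OF assms(1)] assms(2) by simp
  qed (use a_pos in simp)
qed

lemma adm_step:
  assumes "adm f" "0 \<le> s" "s \<le> 1" shows "adm (step s f)"
proof -
  have le: "s * exp (- conv f x) \<le> 1" for x
    using mult_mono[of s 1 "exp (- conv f x)" 1] assms conv_nonneg[OF assms(1), of x] by simp
  have "step s f x \<le> step s f y" if "x \<le> y" for x y
    using conv_mono[OF assms(1) that] assms le[of y] that
    by (auto simp: step_def intro!: mult_left_mono)
  then show ?thesis using assms by (auto simp: adm_def step_def mono_def)
qed

lemma adm_zero: "adm (\<lambda>_. 0)"
  by (simp add: adm_def mono_def)

lemma approx_Suc: "approx s (Suc m) = step s (approx s m)"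
  by (simp add: approx_def)

lemma adm_approx: "0 \<le> s \<Longrightarrow> s \<le> 1 \<Longrightarrow> adm (approx s m)"
  by (induction m) (auto simp: approx_Suc adm_step, simp add: approx_def adm_zero)

lemma approx_0: "approx s 0 x = 0"
  by (simp add: approx_def)

lemma approx_compare:
  assumes "0 \<le> s" "s \<le> s'" "s' \<le> 1"
  shows "approx s' m x \<le> approx s m x"
proof (induction m arbitrary: x)
  case (Suc m)
  have "conv (approx s' m) x \<le> 1 * conv (approx s m) x"
    using Suc assms by (intro conv_le adm_approx) auto
  then have "s * exp (- conv (approx s m) x) \<le> s' * exp (- conv (approx s' m) x)"
    using assms by (intro mult_mono) auto
  then show ?case by (simp add: approx_Suc step_def)
qed (simp add: approx_0)

lemma approx_incseq:
  assumes "0 \<le> s" "s \<le> 1" shows "incseq (\<lambda>m. approx s m x)"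
proof (rule incseq_SucI)
  show "approx s m x \<le> approx s (Suc m) x" for m
  proof (induction m arbitrary: x)
    case 0
    then show ?case using adm_bounds(1)[OF adm_approx[OF assms]] by (simp add: approx_0)
  next
    case (Suc m)
    have "conv (approx s m) x \<le> 1 * conv (approx s (Suc m)) x"
      using Suc assms by (intro conv_le adm_approx) auto
    then show ?case
      using assms by (auto simp: approx_Suc[of s "Suc m"] approx_Suc[of s m] step_def intro!: mult_left_mono)
  qed
qed

text \<open>Each induction step is \<open>(1 - s * u)^2 >= 0\<close> with \<open>u\<close> the
  exponential of minus the convolution, the branching form of
  \<open>E (1 - s^T)^2 >= 0\<close>.\<close>

lemma approx_square:
  assumes "0 \<le> s" "s \<le> 1"
  shows "approx (s\<^sup>2) m x \<le> 2 * approx s m x"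
proof (induction m arbitrary: x)
  case (Suc m)
  have s2: "0 \<le> s\<^sup>2" "s\<^sup>2 \<le> 1" using assms by (auto intro: power_le_one)
  define u where "u = exp (- conv (approx s m) x)"
  have "conv (approx (s\<^sup>2) m) x \<le> 2 * conv (approx s m) x"
    using Suc assms s2 by (intro conv_le adm_approx) auto
  then have "u\<^sup>2 \<le> exp (- conv (approx (s\<^sup>2) m) x)"
    by (simp add: u_def power2_eq_square exp_add[symmetric])
  then have "s\<^sup>2 * u\<^sup>2 \<le> s\<^sup>2 * exp (- conv (approx (s\<^sup>2) m) x)" by (intro mult_left_mono) auto
  moreover have "0 \<le> (1 - s * u)\<^sup>2" by simp
  ultimately have "1 - s\<^sup>2 * exp (- conv (approx (s\<^sup>2) m) x) \<le> 2 * (1 - s * u)"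
    by (simp add: power2_eq_square algebra_simps)
  then show ?case by (simp add: approx_Suc step_def u_def)
qed (simp add: approx_0)

lemma approx_tendsto:
  assumes "0 \<le> s" "s \<le> 1" shows "(\<lambda>m. approx s m x) \<longlonglongrightarrow> prof s x"
proof -
  have "convergent (\<lambda>m. approx s m x)"
    using adm_bounds(1,2)[OF adm_approx[OF assms]]
    by (intro Bseq_monoseq_convergent BseqI'[of _ 1] incseq_imp_monoseq approx_incseq assms) auto
  then show ?thesis by (simp add: prof_def convergent_LIMSEQ_iff)
qed

lemma adm_prof:
  assumes "0 \<le> s" "s \<le> 1" shows "adm (prof s)"
  unfolding adm_def mono_def
proof (intro conjI allI impI)
  fix x y :: real assume "x \<le> y"
  then show "prof s x \<le> prof s y"
    using adm_bounds(4)[OF adm_approx[OF assms]]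
    by (intro LIMSEQ_le[OF approx_tendsto approx_tendsto] assms) auto
next
  fix x :: real assume "x < 0"
  then have "(\<lambda>m. approx s m x) \<longlonglongrightarrow> 0"
    using adm_bounds(3)[OF adm_approx[OF assms]] by simp
  then show "prof s x = 0" using approx_tendsto[OF assms] LIMSEQ_unique by blast
next
  fix x
  show "prof s x \<le> 1"
    using adm_bounds(2)[OF adm_approx[OF assms]]
    by (intro LIMSEQ_le_const2[OF approx_tendsto] assms) auto
qed

lemma prof_eq:
  assumes "0 \<le> s" "s \<le> 1" "0 \<le> x"
  shows "prof s x = 1 - s * exp (- conv (prof s) x)"
proof -
  have "(\<lambda>m. conv (approx s m) x) \<longlonglongrightarrow> conv (prof s) x"
    unfolding conv_def
  proof (rule integral_dominated_convergence)
    show "integrable lborel (\<lambda>y. a / 2 * exp (x / 2) * (indicator {0..} y * exp (- (1 / 2) * y)))"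
      using integrable_exp_Ici[of "1/2" 0] by (intro integrable_mult_right) auto
    show "AE y in lborel. (\<lambda>m. ker x y * approx s m y) \<longlonglongrightarrow> ker x y * prof s y"
      using approx_tendsto[OF assms(1,2)] by (intro AE_I2 tendsto_mult_left) auto
    show "AE y in lborel. norm (ker x y * approx s m y)
        \<le> a / 2 * exp (x / 2) * (indicator {0..} y * exp (- (1 / 2) * y))" for m
      using ker_adm_le[OF adm_approx[OF assms(1,2)]] by (intro AE_I2) simp
    show "(\<lambda>y. ker x y * prof s y) \<in> borel_measurable lborel"
      "(\<lambda>y. ker x y * approx s m y) \<in> borel_measurable lborel" for m
      using adm_measurable[OF adm_prof[OF assms(1,2)]] adm_measurable[OF adm_approx[OF assms(1,2)]]
      by measurable
  qed
  then have "(\<lambda>m. 1 - s * exp (- conv (approx s m) x)) \<longlonglongrightarrow> 1 - s * exp (- conv (prof s) x)"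
    by (intro tendsto_intros)
  then have "(\<lambda>m. approx s (Suc m) x) \<longlonglongrightarrow> 1 - s * exp (- conv (prof s) x)"
    using assms by (simp add: approx_Suc step_def)
  moreover have "(\<lambda>m. approx s (Suc m) x) \<longlonglongrightarrow> prof s x"
    by (rule LIMSEQ_Suc[OF approx_tendsto[OF assms(1,2)]])
  ultimately show ?thesis using LIMSEQ_unique by blast
qed

lemma prof_antimono:
  assumes "0 \<le> s" "s \<le> s'" "s' \<le> 1" shows "prof s' x \<le> prof s x"
  using approx_compare[OF assms] assms by (intro LIMSEQ_le[OF approx_tendsto approx_tendsto]) auto

lemma prof_square:
  assumes "0 \<le> s" "s \<le> 1" shows "prof (s\<^sup>2) x \<le> 2 * prof s x"
  using approx_square[OF assms] assms
  by (intro LIMSEQ_le[OF approx_tendsto tendsto_mult_left[OF approx_tendsto]]) (auto intro: power_le_one)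

lemma prof_ge:
  assumes "0 \<le> s" "s \<le> 1" "0 \<le> x" shows "1 - s \<le> prof s x"
  using mult_left_mono[of "exp (- conv (prof s) x)" 1 s] conv_nonneg[OF adm_prof[OF assms(1,2)], of x] assms
  by (simp add: prof_eq)

text \<open>For \<open>0 <= y <= x\<close> the tilt outweighs the decay because
  \<open>a <= 1 / 2\<close>, so \<open>ker x y >= a / 2\<close>, while
  \<open>prof s y >= 1 - s\<close>.\<close>

lemma conv_prof_ge:
  assumes "0 \<le> s" "s \<le> 1" "0 \<le> x" shows "a / 2 * (1 - s) * x \<le> conv (prof s) x"
proof -
  have "(LINT y|lborel. a / 2 * (1 - s) * indicator {0..x} y) \<le> conv (prof s) x"
    unfolding conv_def
  proof (rule integral_mono)
    fix y
    show "a / 2 * (1 - s) * indicator {0..x} y \<le> ker x y * prof s y"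
    proof (cases "y \<in> {0..x}")
      case True
      have "a * (x - y) \<le> 1 / 2 * (x - y)" using True a_le by (intro mult_right_mono) auto
      then have "a / 2 * 1 \<le> ker x y"
        unfolding ker_def using True a_pos by (intro mult_left_mono) auto
      then have "(a / 2 * 1) * (1 - s) \<le> ker x y * prof s y"
        using True prof_ge[OF assms(1,2), of y] assms a_pos ker_pos[of x y] by (intro mult_mono) auto
      then show ?thesis using True by simp
    qed (use ker_pos[of x y] adm_bounds(1)[OF adm_prof[OF assms(1,2)], of y] in simp)
  qed (use assms in \<open>auto intro!: integrable_ker_adm adm_prof integrable_real_indicator simp: emeasure_lborel_Icc_eq\<close>)
  then show ?thesis using assms by simp
qed

lemma conv_prof_unbounded:
  assumes "0 \<le> s" "s < 1" shows "\<exists>x\<ge>0. M \<le> conv (prof s) x"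
proof -
  define x where "x = max 0 (M / (a / 2 * (1 - s)))"
  have "M \<le> a / 2 * (1 - s) * x" using a_pos assms by (simp add: x_def field_simps max_def)
  also have "\<dots> \<le> conv (prof s) x" using assms by (intro conv_prof_ge) (auto simp: x_def)
  finally show ?thesis by (intro exI[of _ x]) (simp add: x_def)
qed

section \<open>Green's function representation and differential equation of the fixed point\<close>

definition Gp :: "real \<Rightarrow> real \<Rightarrow> real" where
  "Gp s x = exp (- x / 2) * conv (prof s) x"

definition wt :: "real \<Rightarrow> real \<Rightarrow> real" where
  "wt s y = exp (- y / 2) * prof s y"

text \<open>\<open>lo\<close> and \<open>hi\<close> are the contributions from the left and from the
  right of \<open>x\<close> to the integral of \<open>wt\<close> against the two-sided exponential.
  \<open>hi\<close> is a total minus an integral over \<open>{0..x}\<close>, so both are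
  differentiated on compact intervals.\<close>

definition lo :: "real \<Rightarrow> real \<Rightarrow> real" where
  "lo s x = exp (- a * x) * integral {0..x} (\<lambda>y. exp (a * y) * wt s y)"

definition hi :: "real \<Rightarrow> real \<Rightarrow> real" where
  "hi s x = exp (a * x) * ((LINT y|lborel. exp (- a * y) * wt s y) - integral {0..x} (\<lambda>y. exp (- a * y) * wt s y))"

definition Gp1 :: "real \<Rightarrow> real \<Rightarrow> real" where
  "Gp1 s x = a\<^sup>2 / 2 * (hi s x - lo s x)"

context
  fixes s :: real
  assumes s: "0 \<le> s" "s \<le> 1"
begin

lemma prof_measurable [measurable]: "prof s \<in> borel_measurable borel"
  by (intro adm_measurable adm_prof s)

lemma wt_measurable [measurable]: "wt s \<in> borel_measurable borel"
  unfolding wt_def[abs_def] by measurable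

lemma wt_bounds: "0 \<le> wt s y" "wt s y \<le> indicator {0..} y * exp (- (1 / 2) * y)"
  using adm_bounds[OF adm_prof[OF s], of y] by (auto simp: wt_def indicator_def)

lemma integrable_exp_wt:
  assumes "c < 1 / 2"
  shows "integrable lborel (\<lambda>y. exp (c * y) * wt s y)"
proof (rule integrable_exp_bound)
  show "\<bar>exp (c * y) * wt s y\<bar> \<le> 1 * (indicator {0..} y * exp (- (1 / 2 - c) * y))" for y
  proof -
    have "exp (c * y) * wt s y \<le> exp (c * y) * (indicator {0..} y * exp (- (1 / 2) * y))"
      by (intro mult_left_mono wt_bounds) auto
    also have "\<dots> = indicator {0..} y * (exp (c * y) * exp (- (1 / 2) * y))" by simp
    also have "exp (c * y) * exp (- (1 / 2) * y) = exp (- (1 / 2 - c) * y)"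
      by (subst exp_add[symmetric]) (simp add: algebra_simps)
    finally show ?thesis using wt_bounds(1)[of y] by (simp add: abs_mult)
  qed
  show "(\<lambda>y. exp (c * y) * wt s y) \<in> borel_measurable borel" by measurable
qed (use assms in simp)

lemma wt_neg: "y < 0 \<Longrightarrow> wt s y = 0"
  using adm_bounds(3)[OF adm_prof[OF s]] by (simp add: wt_def)

text \<open>For \<open>\<gamma> = 0\<close> the exponent \<open>a\<close> equals
  \<open>1 / 2\<close>, and \<open>wt_bounds\<close> gives no integrability of
  \<open>exp (a * y) * wt s y\<close> on the half line; on bounded intervals every \<open>c\<close>
  is admissible, which serves \<open>lo\<close>.\<close>

lemma set_integrable_exp_wt: "set_integrable lborel {0..x} (\<lambda>y. exp (c * y) * wt s y)"
proof -
  have "integrable lborel (\<lambda>y. indicator {0..x} y *\<^sub>R (exp (c * y) * wt s y))"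
  proof (rule Bochner_Integration.integrable_bound)
    show "integrable lborel (\<lambda>y. exp (\<bar>c\<bar> * \<bar>x\<bar>) * (indicator {0..} y * exp (- (1 / 2) * y)))"
      using integrable_exp_Ici[of "1/2" 0] by (intro integrable_mult_right) auto
    have "exp (c * y) * wt s y \<le> exp (\<bar>c\<bar> * \<bar>x\<bar>) * (indicator {0..} y * exp (- (1 / 2) * y))"
      if "0 \<le> y" "y \<le> x" for y
    proof (intro mult_mono wt_bounds)
      have "c * y \<le> \<bar>c\<bar> * \<bar>x\<bar>" using that by (intro mult_mono) auto
      then show "exp (c * y) \<le> exp (\<bar>c\<bar> * \<bar>x\<bar>)" by simp
    qed auto
    then show "AE y in lborel. norm (indicator {0..x} y *\<^sub>R (exp (c * y) * wt s y))
        \<le> norm (exp (\<bar>c\<bar> * \<bar>x\<bar>) * (indicator {0..} y * exp (- (1 / 2) * y)))"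
      using wt_bounds(1) by (intro AE_I2) (auto simp: indicator_def abs_mult)
  qed measurable
  then show ?thesis by (simp add: set_integrable_def)
qed

lemma integral_exp_wt:
  "integral {0..x} (\<lambda>y. exp (c * y) * wt s y) = (LINT y|lborel. indicator {0..x} y * (exp (c * y) * wt s y))"
  using set_borel_integral_eq_integral(2)[OF set_integrable_exp_wt[of x c]]
  by (simp add: set_lebesgue_integral_def)

lemma Gp_eq_integral: "Gp s x = a / 2 * (LINT y|lborel. exp (- a * \<bar>x - y\<bar>) * wt s y)"
proof -
  have "exp (- x / 2) * (ker x y * prof s y) = a / 2 * (exp (- a * \<bar>x - y\<bar>) * wt s y)" for y
  proof -
    have "exp (- x / 2) * exp ((x - y) / 2 - a * \<bar>x - y\<bar>) = exp (- a * \<bar>x - y\<bar>) * exp (- y / 2)"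
      by (simp add: exp_add[symmetric] field_simps)
    then show ?thesis by (simp add: ker_def wt_def)
  qed
  note * = this
  have "Gp s x = (LINT y|lborel. exp (- x / 2) * (ker x y * prof s y))" by (simp add: Gp_def conv_def)
  also have "\<dots> = (LINT y|lborel. a / 2 * (exp (- a * \<bar>x - y\<bar>) * wt s y))" by (simp only: *)
  finally have "Gp s x = (LINT y|lborel. a / 2 * (exp (- a * \<bar>x - y\<bar>) * wt s y))" .
  then show ?thesis by simp
qed

lemma Gp_split:
  assumes "0 \<le> x" shows "Gp s x = a / 2 * (lo s x + hi s x)"
proof -
  let ?p = "\<lambda>y. exp (a * y) * wt s y" and ?q = "\<lambda>y. exp (- a * y) * wt s y"
  have i1: "integrable lborel (\<lambda>y. indicator {0..x} y * ?p y)"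
    and i2: "integrable lborel (\<lambda>y. indicator {0..x} y * ?q y)"
    using set_integrable_exp_wt[of x a] set_integrable_exp_wt[of x "- a"] by (simp_all add: set_integrable_def)
  have i3: "integrable lborel ?q" using a_pos by (intro integrable_exp_wt) auto
  have "exp (- a * \<bar>x - y\<bar>) * wt s y
      = exp (- a * x) * (indicator {0..x} y * ?p y) + exp (a * x) * (?q y - indicator {0..x} y * ?q y)" for y
  proof (cases "y < 0")
    case False
    show ?thesis
    proof (cases "y \<le> x")
      case True
      have "exp (- a * \<bar>x - y\<bar>) = exp (- a * x) * exp (a * y)"
        using True by (subst exp_add[symmetric]) (simp add: algebra_simps)
      then show ?thesis using True False by (simp add: indicator_def)
    next
      case gt: False
      have "exp (- a * \<bar>x - y\<bar>) = exp (a * x) * exp (- a * y)"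
        using gt by (subst exp_add[symmetric]) (simp add: algebra_simps)
      then show ?thesis using gt by (simp add: indicator_def)
    qed
  qed (simp add: wt_neg)
  then have "(LINT y|lborel. exp (- a * \<bar>x - y\<bar>) * wt s y)
      = (LINT y|lborel. exp (- a * x) * (indicator {0..x} y * ?p y) + exp (a * x) * (?q y - indicator {0..x} y * ?q y))"
    by simp
  also have "\<dots> = exp (- a * x) * (LINT y|lborel. indicator {0..x} y * ?p y)
      + exp (a * x) * ((LINT y|lborel. ?q y) - (LINT y|lborel. indicator {0..x} y * ?q y))"
    using i1 i2 i3 by simp
  finally show ?thesis
    unfolding Gp_eq_integral lo_def hi_def integral_exp_wt by simp
qed

lemma lo_nonneg: "0 \<le> lo s x" and hi_nonneg: "0 \<le> hi s x"
proof -
  show "0 \<le> lo s x"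
    unfolding lo_def integral_exp_wt using wt_bounds(1)
    by (intro mult_nonneg_nonneg integral_nonneg_AE AE_I2) auto
  have "(LINT y|lborel. indicator {0..x} y * (exp (- a * y) * wt s y)) \<le> (LINT y|lborel. exp (- a * y) * wt s y)"
    using set_integrable_exp_wt[of x "- a"] a_pos wt_bounds(1)
    by (intro integral_mono integrable_exp_wt) (auto simp: set_integrable_def indicator_def)
  then show "0 \<le> hi s x"
    unfolding hi_def integral_exp_wt by simp
qed

lemma cont_lo_hi: "continuous_on {0..v} (lo s)" "continuous_on {0..v} (hi s)"
  unfolding lo_def hi_def
  by (intro continuous_intros indefinite_integral_continuous_1
      set_borel_integral_eq_integral(1)[OF set_integrable_exp_wt])+

lemma cont_Gp: "continuous_on {0..v} (Gp s)" and cont_Gp1: "continuous_on {0..v} (Gp1 s)"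
proof -
  have "continuous_on {0..v} (\<lambda>x. a / 2 * (lo s x + hi s x))"
    by (intro continuous_intros cont_lo_hi)
  then show "continuous_on {0..v} (Gp s)"
    by (rule continuous_on_eq) (simp add: Gp_split)
  show "continuous_on {0..v} (Gp1 s)"
    unfolding Gp1_def by (intro continuous_intros cont_lo_hi)
qed

lemma prof_Gp: "0 \<le> x \<Longrightarrow> prof s x = 1 - s * exp (- (exp (x / 2) * Gp s x))"
  unfolding Gp_def exp_half_cancel by (rule prof_eq[OF s])

lemma cont_wt: "continuous_on {0..v} (wt s)"
proof -
  have "continuous_on {0..v} (\<lambda>x. exp (- x / 2) * (1 - s * exp (- (exp (x / 2) * Gp s x))))"
    by (intro continuous_intros cont_Gp) auto
  then show ?thesis by (rule continuous_on_eq) (simp add: wt_def prof_Gp)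
qed

lemma deriv_lo_hi:
  assumes "0 < x"
  shows "(lo s has_real_derivative - a * lo s x + wt s x) (at x)"
    and "(hi s has_real_derivative a * hi s x - wt s x) (at x)"
proof -
  have D: "((\<lambda>x. integral {0..x} (\<lambda>y. exp (c * y) * wt s y)) has_real_derivative exp (c * x) * wt s x) (at x)" for c
  proof -
    have "continuous_on {0..x + 1} (\<lambda>y. exp (c * y) * wt s y)" by (intro continuous_intros cont_wt)
    from integral_has_real_derivative[OF this, of x] show ?thesis
      using assms by (simp add: at_within_Icc_at)
  qed
  have e: "exp (- a * x) * exp (a * x) = 1" by (simp add: exp_add[symmetric])
  have "(lo s has_real_derivative exp (- a * x) * (exp (a * x) * wt s x)
      + (- a * exp (- a * x)) * integral {0..x} (\<lambda>y. exp (a * y) * wt s y)) (at x)"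
    unfolding lo_def by (auto intro!: derivative_eq_intros D)
  moreover have "exp (- a * x) * (exp (a * x) * wt s x) = wt s x"
    using e by (simp add: mult.assoc[symmetric])
  ultimately have "(lo s has_real_derivative wt s x
      + (- a * exp (- a * x)) * integral {0..x} (\<lambda>y. exp (a * y) * wt s y)) (at x)"
    by (simp only:)
  then show "(lo s has_real_derivative - a * lo s x + wt s x) (at x)"
    by (simp add: lo_def algebra_simps)
  define J where "J = (LINT y|lborel. exp (- a * y) * wt s y)"
  have hi: "hi s = (\<lambda>x. exp (a * x) * (J - integral {0..x} (\<lambda>y. exp (- a * y) * wt s y)))"
    by (simp add: hi_def[abs_def] J_def)
  have d1: "((\<lambda>x. exp (a * x)) has_real_derivative a * exp (a * x)) (at x)"
    by (auto intro!: derivative_eq_intros)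
  have d2: "((\<lambda>x. J - integral {0..x} (\<lambda>y. exp (- a * y) * wt s y)) has_real_derivative
      0 - exp (- a * x) * wt s x) (at x)"
    by (rule DERIV_diff[OF DERIV_const D])
  have "(0 - exp (- a * x) * wt s x) * exp (a * x) = - wt s x"
    using e by (simp add: mult.commute mult.left_commute)
  note * = this
  show "(hi s has_real_derivative a * hi s x - wt s x) (at x)"
    unfolding hi by (rule DERIV_cong[OF DERIV_mult[OF d1 d2]]) (subst *, simp)
qed

lemma deriv_Gp:
  assumes "0 < x" shows "(Gp s has_real_derivative Gp1 s x) (at x)"
proof -
  have "((\<lambda>x. a / 2 * (lo s x + hi s x)) has_real_derivative Gp1 s x) (at x)"
    by (auto intro!: derivative_eq_intros deriv_lo_hi assms simp: Gp1_def power2_eq_square algebra_simps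
        add_divide_distrib diff_divide_distrib)
  moreover have "\<forall>\<^sub>F y in nhds x. a / 2 * (lo s y + hi s y) = Gp s y"
    using eventually_nhds_in_open[of "{0<..}" x] assms
    by (auto elim!: eventually_mono simp: Gp_split)
  ultimately show ?thesis by (subst (asm) DERIV_cong_ev[OF refl _ refl]) auto
qed

lemma deriv_Gp1:
  assumes "0 < x" shows "(Gp1 s has_real_derivative a\<^sup>2 * (Gp s x - wt s x)) (at x)"
  unfolding Gp1_def using Gp_split[of x] assms
  by (auto intro!: derivative_eq_intros deriv_lo_hi simp: algebra_simps add_divide_distrib diff_divide_distrib)

text \<open>At 0 only \<open>hi\<close> survives, whence the boundary condition; the lower bound
  replaces \<open>prof s\<close> by \<open>1 - s\<close>.\<close>

lemma Gp_0: "Gp1 s 0 = a * Gp s 0" "a / 2 * (1 - s) \<le> Gp s 0"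
proof -
  show "Gp1 s 0 = a * Gp s 0"
    by (simp add: Gp_split Gp1_def lo_def power2_eq_square)
  have "(1 - s) * (indicator {0..} y * exp (- (a + 1 / 2) * y)) \<le> exp (- a * \<bar>0 - y\<bar>) * wt s y" for y
  proof (cases "0 \<le> y")
    case True
    have "(1 - s) * exp (- (a + 1 / 2) * y) \<le> prof s y * exp (- (a + 1 / 2) * y)"
      using prof_ge[OF s True] by (intro mult_right_mono) auto
    also have "\<dots> = exp (- a * \<bar>0 - y\<bar>) * wt s y"
    proof -
      have "exp (- (a + 1 / 2) * y) = exp (- a * y) * exp (- y / 2)"
        by (subst exp_add[symmetric]) (simp add: algebra_simps)
      then show ?thesis using True by (simp only: wt_def) simp
    qed
    finally show ?thesis using True by (simp only: indicator_simps atLeast_iff mult_1_left)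
  qed (simp add: wt_neg)
  note le = this
  have "(LINT y|lborel. (1 - s) * (indicator {0..} y * exp (- (a + 1 / 2) * y)))
      \<le> (LINT y|lborel. exp (- a * \<bar>0 - y\<bar>) * wt s y)"
  proof (rule integral_mono)
    show "integrable lborel (\<lambda>y. (1 - s) * (indicator {0..} y * exp (- (a + 1 / 2) * y)))"
      using integrable_exp_Ici[of "a + 1 / 2" 0] a_pos by (intro integrable_mult_right) auto
    show "(1 - s) * (indicator {0..} y * exp (- (a + 1 / 2) * y)) \<le> exp (- a * \<bar>0 - y\<bar>) * wt s y" for y
      by (rule le)
    have "integrable lborel (\<lambda>y. exp (- a * y) * wt s y)" using a_pos by (intro integrable_exp_wt) auto
    moreover have "exp (- a * \<bar>0 - y\<bar>) * wt s y = exp (- a * y) * wt s y" for y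
      by (cases "y < 0") (auto simp: wt_neg)
    ultimately show "integrable lborel (\<lambda>y. exp (- a * \<bar>0 - y\<bar>) * wt s y)" by (simp only:)
  qed
  also have "(LINT y|lborel. (1 - s) * (indicator {0..} y * exp (- (a + 1 / 2) * y))) = (1 - s) / (a + 1 / 2)"
    using integral_exp_Ici[of "a + 1 / 2" 0] a_pos by simp
  finally have "(1 - s) / (a + 1 / 2) \<le> (LINT y|lborel. exp (- a * \<bar>0 - y\<bar>) * wt s y)" .
  moreover have "1 - s \<le> (1 - s) / (a + 1 / 2)"
    using s a_pos a_le mult_left_mono[of "a + 1 / 2" 1 "1 - s"] by (simp add: field_simps)
  ultimately show "a / 2 * (1 - s) \<le> Gp s 0"
    unfolding Gp_eq_integral using a_pos by (intro mult_left_mono) auto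
qed

lemma Gp_nonneg: "0 \<le> Gp s x"
  using conv_nonneg[OF adm_prof[OF s]] by (simp add: Gp_def)

text \<open>Half of the rate \<open>a\<close> is given up: \<open>a / 2 < 1 / 2\<close> leaves an
  integrable weight even for \<open>a = 1 / 2\<close>.\<close>

lemma Gp_le: "Gp s x \<le> a / 2 * (exp (- (a / 2) * x) / (1 / 2 - a / 2))"
proof -
  have "(LINT y|lborel. exp (- a * \<bar>x - y\<bar>) * wt s y)
      \<le> (LINT y|lborel. exp (- (a / 2) * x) * (indicator {0..} y * exp (- (1 / 2 - a / 2) * y)))"
  proof (rule integral_mono)
    show i: "integrable lborel (\<lambda>y. exp (- (a / 2) * x) * (indicator {0..} y * exp (- (1 / 2 - a / 2) * y)))"
      using a_pos a_le by (intro integrable_mult_right integrable_exp_Ici) auto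
    show le: "exp (- a * \<bar>x - y\<bar>) * wt s y
        \<le> exp (- (a / 2) * x) * (indicator {0..} y * exp (- (1 / 2 - a / 2) * y))" for y
    proof -
      have "exp (- a * \<bar>x - y\<bar>) * wt s y \<le> exp (- (a / 2) * (x - y)) * (indicator {0..} y * exp (- (1 / 2) * y))"
      proof (intro mult_mono wt_bounds)
        have "a / 2 * (x - y) \<le> a / 2 * \<bar>x - y\<bar>" using a_pos by (intro mult_left_mono) auto
        also have "\<dots> \<le> a * \<bar>x - y\<bar>" using a_pos by (intro mult_right_mono) auto
        finally have "a / 2 * (x - y) \<le> a * \<bar>x - y\<bar>" .
        then show "exp (- a * \<bar>x - y\<bar>) \<le> exp (- (a / 2) * (x - y))" by simp
      qed auto
      also have "\<dots> = indicator {0..} y * (exp (- (a / 2) * (x - y)) * exp (- (1 / 2) * y))" by simp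
      also have "exp (- (a / 2) * (x - y)) * exp (- (1 / 2) * y) = exp (- (a / 2) * x) * exp (- (1 / 2 - a / 2) * y)"
        by (subst (1 2) exp_add[symmetric]) (simp add: field_simps)
      finally show ?thesis by (simp add: mult_ac)
    qed
    show "integrable lborel (\<lambda>y. exp (- a * \<bar>x - y\<bar>) * wt s y)"
    proof (rule Bochner_Integration.integrable_bound[OF i])
      show "AE y in lborel. norm (exp (- a * \<bar>x - y\<bar>) * wt s y)
        \<le> norm (exp (- (a / 2) * x) * (indicator {0..} y * exp (- (1 / 2 - a / 2) * y)))"
      proof (rule AE_I2)
        fix y
        have "norm (exp (- a * \<bar>x - y\<bar>) * wt s y) = exp (- a * \<bar>x - y\<bar>) * wt s y"
          using wt_bounds(1)[of y] by (simp add: abs_mult)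
        also note le[of y]
        also have "exp (- (a / 2) * x) * (indicator {0..} y * exp (- (1 / 2 - a / 2) * y))
            \<le> norm (exp (- (a / 2) * x) * (indicator {0..} y * exp (- (1 / 2 - a / 2) * y)))"
          by (simp only: real_norm_def abs_ge_self)
        finally show "norm (exp (- a * \<bar>x - y\<bar>) * wt s y)
          \<le> norm (exp (- (a / 2) * x) * (indicator {0..} y * exp (- (1 / 2 - a / 2) * y)))" .
      qed
      show "(\<lambda>y. exp (- a * \<bar>x - y\<bar>) * wt s y) \<in> borel_measurable lborel" by measurable
    qed
  qed
  also have "\<dots> = exp (- (a / 2) * x) / (1 / 2 - a / 2)"
    using integral_exp_Ici[of "1 / 2 - a / 2" 0] a_pos a_le by simp
  finally show ?thesis
    unfolding Gp_eq_integral using a_pos by (intro mult_left_mono) auto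
qed

lemma Gp_tendsto_0: "(Gp s \<longlongrightarrow> 0) at_top" "(Gp1 s \<longlongrightarrow> 0) at_top"
proof -
  show G: "(Gp s \<longlongrightarrow> 0) at_top"
  proof (rule real_tendsto_sandwich[where f = "\<lambda>_. 0"])
    show "((\<lambda>x. a / 2 * (exp (- (a / 2) * x) / (1 / 2 - a / 2))) \<longlongrightarrow> 0) at_top"
      using a_pos a_le by real_asymp
    show "\<forall>\<^sub>F x in at_top. Gp s x \<le> a / 2 * (exp (- (a / 2) * x) / (1 / 2 - a / 2))"
      by (intro always_eventually allI Gp_le)
  qed (simp_all add: Gp_nonneg)
  show "(Gp1 s \<longlongrightarrow> 0) at_top"
  proof (rule Lim_null_comparison)
    show "((\<lambda>x. a * Gp s x) \<longlongrightarrow> 0) at_top" using tendsto_mult_right_zero[OF G] .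
    show "\<forall>\<^sub>F x in at_top. norm (Gp1 s x) \<le> a * Gp s x"
      using eventually_ge_at_top[of 0]
    proof eventually_elim
      case (elim x)
      have "norm (Gp1 s x) = a\<^sup>2 / 2 * \<bar>hi s x - lo s x\<bar>" by (simp add: Gp1_def abs_mult)
      also have "\<dots> \<le> a\<^sup>2 / 2 * (lo s x + hi s x)"
        using lo_nonneg[of x] hi_nonneg[of x] by (intro mult_left_mono) auto
      also have "\<dots> = a * Gp s x" using elim by (simp add: Gp_split power2_eq_square)
      finally show ?case .
    qed
  qed
qed

end

lemma profile_ode_prof:
  assumes "0 < s" "s < 1" shows "profile_ode a s (Gp s) (Gp1 s)"
proof -
  interpret p: profile a s "Gp s" "Gp1 s"
    by standard (use assms a_pos a_le in auto)
  have s: "0 \<le> s" "s \<le> 1" using assms by auto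
  have g: "p.g x = conv (prof s) x" for x
    unfolding p.g_def Gp_def exp_half_cancel ..
  have f: "p.f x = prof s x" if "0 \<le> x" for x
    using prof_eq[OF s that] by (simp add: p.f_def g)
  show ?thesis
  proof
    fix x :: real assume "0 < x"
    then show "(Gp s has_real_derivative Gp1 s x) (at x)" by (rule deriv_Gp[OF s])
    show "(Gp1 s has_real_derivative a\<^sup>2 * (Gp s x - exp (- x / 2) * p.f x)) (at x)"
      using deriv_Gp1[OF s \<open>0 < x\<close>] \<open>0 < x\<close> by (simp add: f wt_def)
  next
    fix x y :: real assume "0 \<le> x" "x \<le> y"
    then show "p.g x \<le> p.g y" unfolding g by (intro conv_mono adm_prof s)
  next
    fix M
    show "\<exists>x\<ge>0. M \<le> p.g x" unfolding g by (rule conv_prof_unbounded[OF s(1) assms(2)])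
  qed (use assms s cont_Gp[OF s] cont_Gp1[OF s] Gp_nonneg[OF s] Gp_tendsto_0[OF s] Gp_0[OF s] in auto)
qed

text \<open>A uniform vertex has, in the limit, a standard exponential coordinate, so this is
  \<open>1 - E s^T\<close> for a uniformly chosen root.\<close>

definition mass :: "real \<Rightarrow> real" where
  "mass s = (LINT y|lborel. exp (- y) * prof s y)"

lemma integrable_mass:
  assumes "0 \<le> s" "s \<le> 1" shows "integrable lborel (\<lambda>y. exp (- y) * prof s y)"
proof (rule integrable_exp_bound[of _ 1 1])
  show "(\<lambda>y. exp (- y) * prof s y) \<in> borel_measurable borel"
    using adm_measurable[OF adm_prof[OF assms]] by measurable
  show "\<bar>exp (- y) * prof s y\<bar> \<le> 1 * (indicator {0..} y * exp (- 1 * y))" for y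
    using adm_bounds[OF adm_prof[OF assms], of y] by (auto simp: indicator_def abs_mult)
qed simp

lemma profile_pair_prof:
  assumes "0 < s" "s < 1"
  shows "profile_pair a s (Gp s) (Gp1 s) (Gp (s\<^sup>2)) (Gp1 (s\<^sup>2))"
proof -
  have s: "0 \<le> s" "s \<le> 1" "0 < s\<^sup>2" "s\<^sup>2 < 1" "s\<^sup>2 \<le> 1" "s\<^sup>2 \<le> s"
    using assms power_strict_mono[of s 1 2] mult_left_mono[of s 1 s] by (auto simp: power2_eq_square)
  interpret p: profile_ode a s "Gp s" "Gp1 s" by (rule profile_ode_prof[OF assms])
  interpret q: profile_ode a "s\<^sup>2" "Gp (s\<^sup>2)" "Gp1 (s\<^sup>2)" by (rule profile_ode_prof[OF s(3,4)])
  show ?thesis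
  proof
    fix x :: real assume x: "0 \<le> x"
    have "conv (prof (s\<^sup>2)) x \<le> 2 * conv (prof s) x"
      by (intro conv_le adm_prof prof_square s) simp
    then show "Gp (s\<^sup>2) x \<le> 2 * Gp s x"
      unfolding Gp_def using mult_left_mono[of _ _ "exp (- x / 2)"] by fastforce
    show "p.f x \<le> q.f x"
      using prof_antimono[of "s\<^sup>2" s x] s prof_Gp[of s x] prof_Gp[of "s\<^sup>2" x] x
      by (simp add: p.f_def q.f_def p.g_def q.g_def)
  qed
qed

section \<open>Order of the second difference for a uniform root\<close>

lemma le_4_exp_quarter: "x \<le> 4 * exp (x / 4 :: real)"
  using exp_ge_add_one_self[of "x / 4"] by linarith

text \<open>\<open>D 0\<close> integrates \<open>d\<close> with the weight
  \<open>exp (- (a + 1 / 2) * y)\<close>, which dominates \<open>exp (- y)\<close>; conversely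
  \<open>d >= D 0 / 4\<close> on the unit interval. So the gap is comparable to \<open>D 0\<close>,
  hence to \<open>(1 - s) / X^2\<close>, and \<open>X\<close> is comparable to
  \<open>ln (1 / (1 - s))\<close>.\<close>

lemma mass_gap_bounds:
  "\<exists>c C \<epsilon>. 0 < c \<and> 0 < C \<and> 0 < \<epsilon> \<and> \<epsilon> < 1 \<and> (\<forall>s. 0 < s \<longrightarrow> s < 1 \<longrightarrow> 1 - s \<le> \<epsilon> \<longrightarrow>
    c * (1 - s) / (ln (1 / (1 - s)))\<^sup>2 \<le> 2 * mass s - mass (s\<^sup>2) \<and>
    2 * mass s - mass (s\<^sup>2) \<le> C * (1 - s) / (ln (1 / (1 - s)))\<^sup>2)"
proof -
  define c0 where "c0 = a\<^sup>2 / 2 * (1 - exp (- (exp (- 18) / 128)))\<^sup>2"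
  have c0: "0 < c0" using a_pos by (simp add: c0_def)
  define K where "K = 4 * 18432\<^sup>2 / a\<^sup>2"
  have K: "0 < K" using a_pos by (simp add: K_def)
  define c where "c = c0 * a / (12 * 12 * 64)"
  define C where "C = 2 / a * (K * 4)"
  \<comment> \<open>\<open>a / 48\<close> turns \<open>a * e <= 48 * exp (- X / 4)\<close> into
    \<open>e * e <= exp (- X / 4)\<close>, that is \<open>X <= 8 * \<Lambda>\<close>.\<close>
  define \<epsilon> where "\<epsilon> = min (exp (- 40)) (a / 48)"
  have \<epsilon>: "0 < \<epsilon>" "\<epsilon> < 1" using a_pos by (auto simp: \<epsilon>_def min_less_iff_disj)
  have main: "c * (1 - s) / (ln (1 / (1 - s)))\<^sup>2 \<le> 2 * mass s - mass (s\<^sup>2)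
      \<and> 2 * mass s - mass (s\<^sup>2) \<le> C * (1 - s) / (ln (1 / (1 - s)))\<^sup>2"
    if s: "0 < s" "s < 1" "1 - s \<le> \<epsilon>" for s
  proof -
    define G G1 H H1 where "G = Gp s" and "G1 = Gp1 s" and "H = Gp (s\<^sup>2)" and "H1 = Gp1 (s\<^sup>2)"
    note defs = G_def G1_def H_def H1_def
    have s01: "0 \<le> s" "s \<le> 1" "0 \<le> s\<^sup>2" "s\<^sup>2 \<le> 1"
      using s by (auto intro: power_le_one)
    have small: "1 - s \<le> exp (- 40)" "1 - s \<le> a / 48" using s(3) by (auto simp: \<epsilon>_def)
    interpret pp: profile_pair a s G G1 H H1 unfolding defs by (rule profile_pair_prof[OF s(1,2)])
    obtain X where X: "0 \<le> X" "pp.p.g X = 1 / 128" using pp.p.ex_cut[OF small(1)] by blast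
    interpret pc: profile_pair_cut a s G G1 H H1 X
      by standard (use X small in auto)
    define \<Lambda> where "\<Lambda> = ln (1 / (1 - s))"
    define e where "e = 1 - s"
    define A where "A = exp (- X / 2)"
    have e: "0 < e" using s by (simp add: e_def)
    have A: "0 < A" by (simp add: A_def)
    have X32: "32 \<le> X" by (rule pc.p.X_ge)
    have "ln e \<le> - 40" using small(1) e ln_le_cancel_iff[of e "exp (- 40)"] by (simp add: e_def)
    then have L40: "40 \<le> \<Lambda>" using e by (simp add: \<Lambda>_def e_def[symmetric] ln_div)
    have XL: "\<Lambda> / 2 \<le> X" using pc.p.X_ge(1) L40 by (simp add: \<Lambda>_def)
    have ae: "a * e \<le> 12 * X * A" using pc.p.exp_cut_ge by (simp add: e_def A_def)
    have XL': "X \<le> 8 * \<Lambda>"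
    proof -
      have "a * e \<le> 12 * X * A" by (rule ae)
      also have "\<dots> \<le> 12 * (4 * exp (X / 4)) * A"
        using le_4_exp_quarter[of X] A by (intro mult_right_mono mult_left_mono) auto
      also have "\<dots> = 48 * exp (- X / 4)" by (simp add: A_def exp_add[symmetric])
      finally have "a * e / 48 \<le> exp (- X / 4)" by simp
      moreover have "e * e \<le> a * e / 48" using small(2) e mult_right_mono[of e "a / 48" e] by (simp add: e_def)
      ultimately have "e * e \<le> exp (- X / 4)" by linarith
      then have "ln (e * e) \<le> - X / 4"
        using e ln_le_cancel_iff[of "e * e" "exp (- X / 4)"] by simp
      then show ?thesis using e by (simp add: ln_mult \<Lambda>_def e_def[symmetric] ln_div)
    qed
    have D_up: "pp.D 0 \<le> K * e / X\<^sup>2"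
    proof -
      have "pp.D 0 * (a\<^sup>2 * e) * X\<^sup>2 \<le> 4 * A\<^sup>2 * X\<^sup>2"
        using pc.D_0_upper by (intro mult_right_mono) (auto simp: e_def A_def)
      also have "\<dots> = 4 * (X * A)\<^sup>2" by (simp add: power_mult_distrib)
      also have "\<dots> \<le> 4 * (18432 * e)\<^sup>2"
        using pc.p.exp_cut_le X A by (intro mult_left_mono power_mono) (auto simp: e_def A_def)
      finally have "e * (pp.D 0 * a\<^sup>2 * X\<^sup>2) \<le> e * (4 * 18432\<^sup>2 * e)"
        by (simp add: power2_eq_square mult_ac)
      then have "pp.D 0 * a\<^sup>2 * X\<^sup>2 \<le> 4 * 18432\<^sup>2 * e" using e by simp
      then show ?thesis using a_pos X32 by (simp add: K_def field_simps)
    qed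
    have D_lo: "c0 * a * e / (12 * X\<^sup>2) \<le> pp.D 0"
    proof -
      have "c0 * (a * e) \<le> c0 * (12 * X * A)" using ae c0 by (intro mult_left_mono) auto
      also have "\<dots> = 12 * X * (c0 * A)" by simp
      also have "\<dots> \<le> 12 * X * (X * pp.D 0)"
        using pc.D_0_lower X32 by (intro mult_left_mono) (auto simp: c0_def A_def)
      finally show ?thesis using X32 by (simp add: field_simps power2_eq_square)
    qed
    have pf: "pp.p.f y = prof s y" "pp.q.f y = prof (s\<^sup>2) y" if "0 \<le> y" for y
      using prof_Gp[OF s01(1,2) that] prof_Gp[OF s01(3,4) that]
      unfolding pp.p.f_def pp.q.f_def pp.p.g_def pp.q.g_def by (simp_all add: defs)
    define d where "d y = 2 * prof s y - prof (s\<^sup>2) y" for y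
    have d0: "d y = 0" if "y < 0" for y
      using that adm_bounds(3)[OF adm_prof] s01 by (simp add: d_def)
    have d: "pp.d y = d y" if "0 \<le> y" for y using pf[OF that] by (simp add: d_def pp.d_def)
    have d_nonneg: "0 \<le> d y" for y using d0[of y] d[of y] pp.d_nonneg[of y] by (cases "y < 0") auto
    have int_m: "integrable lborel (\<lambda>y. exp (- y) * d y)"
      using integrable_mass[OF s01(1,2)] integrable_mass[OF s01(3,4)]
      by (simp add: d_def right_diff_distrib mult.left_commute)
    have gap: "2 * mass s - mass (s\<^sup>2) = (LINT y|lborel. exp (- y) * d y)"
      using integrable_mass[OF s01(1,2)] integrable_mass[OF s01(3,4)]
      by (simp add: d_def mass_def right_diff_distrib mult.left_commute)
    have i12: "integrable lborel (\<lambda>y. exp (- a * y) * wt s y)" "integrable lborel (\<lambda>y. exp (- a * y) * wt (s\<^sup>2) y)"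
      by (rule integrable_exp_wt[OF s01(1,2)], use a_pos in simp,
          rule integrable_exp_wt[OF s01(3,4)], use a_pos in simp)
    have D0: "pp.D 0 = a / 2 * (LINT y|lborel. exp (- a * y) * (2 * wt s y - wt (s\<^sup>2) y))"
      "integrable lborel (\<lambda>y. exp (- a * y) * (2 * wt s y - wt (s\<^sup>2) y))"
    proof -
      have abs: "exp (- a * \<bar>0 - y\<bar>) * wt t y = exp (- a * y) * wt t y" if "0 \<le> t" "t \<le> 1" for t y
        by (cases "y < 0") (auto simp: wt_neg[OF that])
      have G: "Gp t 0 = a / 2 * (LINT y|lborel. exp (- a * y) * wt t y)" if "0 \<le> t" "t \<le> 1" for t
        unfolding Gp_eq_integral[OF that] by (simp only: abs[OF that])
      have Dv: "pp.D 0 = 2 * Gp s 0 - Gp (s\<^sup>2) 0" unfolding pp.D_def by (simp add: defs)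
      have alg: "2 * (a / 2 * A) - a / 2 * B = a / 2 * I" if "I = 2 * A - B" for I A B :: real
        unfolding that by (simp add: algebra_simps)
      have eq: "exp (- a * y) * (2 * wt s y - wt (s\<^sup>2) y) = 2 * (exp (- a * y) * wt s y) - exp (- a * y) * wt (s\<^sup>2) y" for y
        by (simp add: algebra_simps)
      show "integrable lborel (\<lambda>y. exp (- a * y) * (2 * wt s y - wt (s\<^sup>2) y))"
        unfolding eq using i12 by (intro Bochner_Integration.integrable_diff integrable_mult_right)
      have "(LINT y|lborel. exp (- a * y) * (2 * wt s y - wt (s\<^sup>2) y))
          = 2 * (LINT y|lborel. exp (- a * y) * wt s y) - (LINT y|lborel. exp (- a * y) * wt (s\<^sup>2) y)"
        unfolding eq
        by (simp only: Bochner_Integration.integral_diff[OF integrable_mult_right[OF i12(1)] i12(2)]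
            integral_mult_right_zero)
      then show "pp.D 0 = a / 2 * (LINT y|lborel. exp (- a * y) * (2 * wt s y - wt (s\<^sup>2) y))"
        unfolding Dv G[OF s01(1,2)] G[OF s01(3,4)] by (rule alg)
    qed
    have "(LINT y|lborel. exp (- y) * d y) \<le> (LINT y|lborel. exp (- a * y) * (2 * wt s y - wt (s\<^sup>2) y))"
    proof (rule integral_mono[OF int_m D0(2)])
      fix y
      show "exp (- y) * d y \<le> exp (- a * y) * (2 * wt s y - wt (s\<^sup>2) y)"
      proof (cases "y < 0")
        case False
        have "a * y \<le> 1 / 2 * y" using a_le False by (intro mult_right_mono) auto
        then have "exp (- y) \<le> exp (- a * y + - y / 2)" by simp
        then have "exp (- y) * d y \<le> exp (- a * y + - y / 2) * d y"
          using d_nonneg by (intro mult_right_mono) auto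
        also have "\<dots> = exp (- a * y) * (2 * wt s y - wt (s\<^sup>2) y)"
          unfolding exp_add wt_def d_def by (simp add: algebra_simps)
        finally show ?thesis .
      qed (simp add: d0 wt_neg s01)
    qed
    then have up: "2 * mass s - mass (s\<^sup>2) \<le> 2 / a * pp.D 0"
      unfolding gap D0(1) using a_pos by simp
    have "2 / a * pp.D 0 \<le> 2 / a * (K * e / X\<^sup>2)" using D_up a_pos by (intro mult_left_mono) auto
    also have "\<dots> \<le> 2 / a * (K * e / (\<Lambda> / 2)\<^sup>2)"
      using XL L40 a_pos K e X32 by (intro mult_left_mono divide_left_mono power_mono) auto
    also have "\<dots> = C * e / \<Lambda>\<^sup>2" by (simp add: C_def power_divide)
    finally have up': "2 * mass s - mass (s\<^sup>2) \<le> C * e / \<Lambda>\<^sup>2" using up by linarith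
    have "(LINT y|lborel. pp.D 0 / 12 * indicator {0..1 :: real} y) \<le> (LINT y|lborel. exp (- y) * d y)"
    proof (rule integral_mono[OF _ int_m])
      show "integrable lborel (\<lambda>y. pp.D 0 / 12 * indicator {0..1::real} y)"
        by (intro integrable_mult_right integrable_real_indicator) auto
      fix y :: real
      show "pp.D 0 / 12 * indicator {0..1} y \<le> exp (- y) * d y"
      proof (cases "y \<in> {0..1}")
        case True
        have "exp (- 1 :: real) \<ge> 1 / 3" using exp_le by (simp add: exp_minus field_simps)
        moreover have "exp (- 1) \<le> exp (- y)" using True by simp
        ultimately have "1 / 3 \<le> exp (- y)" by linarith
        then have "1 / 3 * (pp.D 0 / 4) \<le> exp (- y) * pp.d y"
          using pc.d_lower[of y] True pp.D_nonneg[of 0] by (intro mult_mono) auto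
        then show ?thesis using True d[of y] by simp
      qed (use d_nonneg in simp)
    qed
    then have lo: "pp.D 0 / 12 \<le> 2 * mass s - mass (s\<^sup>2)" unfolding gap by simp
    have "c * e / \<Lambda>\<^sup>2 = c0 * a * e / (12 * (8 * \<Lambda>)\<^sup>2) / 12"
      by (simp add: c_def power_mult_distrib)
    also have "\<dots> \<le> c0 * a * e / (12 * X\<^sup>2) / 12"
      using XL' L40 a_pos c0 e X32 by (intro divide_right_mono divide_left_mono mult_left_mono power_mono) auto
    also have "\<dots> \<le> pp.D 0 / 12" using D_lo by (intro divide_right_mono) auto
    finally have "c * e / \<Lambda>\<^sup>2 \<le> 2 * mass s - mass (s\<^sup>2)" using lo by linarith
    with up' show ?thesis by (simp add: e_def \<Lambda>_def)
  qed
  have "0 < c" "0 < C" using a_pos c0 K by (auto simp: c_def C_def)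
  with main \<epsilon> show ?thesis by (intro exI[of _ c] exI[of _ C] exI[of _ \<epsilon>]) auto
qed

end

section \<open>Convergence of the generating functions\<close>

text \<open>On the cell from \<open>x'\<close> to \<open>x\<close> the monotone \<open>h\<close>
  lies between its end values, and \<open>exp (- y)\<close> has integral
  \<open>exp (- x') - exp (- x)\<close>, which is \<open>1 / n\<close> for consecutive vertices. In
  terms of tail integrals the cells telescope.\<close>

lemma tail_integral_step:
  fixes h :: "real \<Rightarrow> real"
  assumes "mono h" and int: "integrable lborel (\<lambda>y. exp (- y) * h y)" and "x' \<le> x"
  defines "T \<equiv> \<lambda>z. LINT y|lborel. indicator {z..} y * (exp (- y) * h y)"
  shows "h x' * (exp (- x') - exp (- x)) \<le> T x' - T x"
    and "T x' - T x \<le> h x * (exp (- x') - exp (- x))"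
proof -
  define d where "d y = indicator {x'..} y - (indicator {x..} y :: real)" for y
  have intT: "integrable lborel (\<lambda>y. indicator {z..} y * (exp (- y) * h y))" for z :: real
    using integrable_mult_indicator[OF _ int, of "{z..}"] by simp
  have e: "has_bochner_integral lborel (\<lambda>y. indicator {z..} y * exp (- y)) (exp (- z))" for z :: real
    using has_bochner_integral_exp_Ici[of 1 z] by simp
  have dT: "T x' - T x = (LINT y|lborel. d y * exp (- y) * h y)"
    "integrable lborel (\<lambda>y. d y * exp (- y) * h y)"
  proof -
    have eq: "d y * exp (- y) * h y
        = indicator {x'..} y * (exp (- y) * h y) - indicator {x..} y * (exp (- y) * h y)" for y
      by (simp add: d_def algebra_simps)
    show "T x' - T x = (LINT y|lborel. d y * exp (- y) * h y)"
      "integrable lborel (\<lambda>y. d y * exp (- y) * h y)"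
      unfolding eq T_def using intT by auto
  qed
  have ce: "has_bochner_integral lborel (\<lambda>y. c * (d y * exp (- y))) (c * (exp (- x') - exp (- x)))" for c
  proof -
    have "d y * exp (- y) = indicator {x'..} y * exp (- y) - indicator {x..} y * exp (- y)" for y
      by (simp add: d_def algebra_simps)
    then show ?thesis
      using has_bochner_integral_mult_right[OF has_bochner_integral_diff[OF e[of x'] e[of x]], of c] by simp
  qed
  have d: "d y = (if x' \<le> y \<and> y < x then 1 else 0)" for y
    using \<open>x' \<le> x\<close> by (auto simp: d_def indicator_def)
  have "(LINT y|lborel. h x' * (d y * exp (- y))) \<le> (LINT y|lborel. d y * exp (- y) * h y)"
    using ce[of "h x'"] dT(2) monoD[OF \<open>mono h\<close>]
    by (intro integral_mono) (auto simp: d has_bochner_integral_iff)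
  then show "h x' * (exp (- x') - exp (- x)) \<le> T x' - T x"
    unfolding dT(1) has_bochner_integral_integral_eq[OF ce] .
  have "(LINT y|lborel. d y * exp (- y) * h y) \<le> (LINT y|lborel. h x * (d y * exp (- y)))"
    using ce[of "h x"] dT(2) monoD[OF \<open>mono h\<close>]
    by (intro integral_mono) (auto simp: d has_bochner_integral_iff)
  then show "T x' - T x \<le> h x * (exp (- x') - exp (- x))"
    unfolding dT(1) has_bochner_integral_integral_eq[OF ce] .
qed

definition pos :: "nat \<Rightarrow> nat \<Rightarrow> real" where
  "pos n v = ln (real n / real v)"

lemma exp_pos: "1 \<le> v \<Longrightarrow> 1 \<le> n \<Longrightarrow> exp (pos n v) = n / v" "1 \<le> v \<Longrightarrow> 1 \<le> n \<Longrightarrow> exp (- pos n v) = v / n"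
  by (simp_all add: pos_def exp_minus)

lemma pos_antimono: "1 \<le> v \<Longrightarrow> v \<le> w \<Longrightarrow> 1 \<le> n \<Longrightarrow> pos n w \<le> pos n v"
  by (auto simp: pos_def frac_le)

lemma pos_nonneg: "1 \<le> v \<Longrightarrow> v \<le> n \<Longrightarrow> 0 \<le> pos n v"
  by (simp add: pos_def)

text \<open>A lower sum: the vertices cut \<open>exp (- y) dy\<close> into cells of mass
  \<open>1 / n\<close>, \<open>h\<close> is read off at the left end, and vertex 1 owns the
  unbounded cell.\<close>

lemma riemann_sum_le:
  fixes h :: "real \<Rightarrow> real"
  assumes "mono h" "\<And>y. 0 \<le> h y" and int: "integrable lborel (\<lambda>y. exp (- y) * h y)" and "1 \<le> n"
  shows "(\<Sum>v=1..n. h (pos n v) / n) \<le> (LINT y|lborel. exp (- y) * h y)"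
proof -
  define T where "T z = (LINT y|lborel. indicator {z..} y * (exp (- y) * h y))" for z :: real
  have intT: "integrable lborel (\<lambda>y. indicator {z..} y * (exp (- y) * h y))" for z :: real
    using integrable_mult_indicator[OF _ int, of "{z..}"] by simp
  have "(\<Sum>v=1..Suc m. h (pos n v) / n) \<le> T (pos n (Suc m))" for m
  proof (induction m)
    case 0
    have e: "has_bochner_integral lborel (\<lambda>y. h (pos n 1) * (indicator {pos n 1..} y * exp (- y)))
        (h (pos n 1) * exp (- pos n 1))"
      using has_bochner_integral_mult_right[OF has_bochner_integral_exp_Ici[of 1 "pos n 1"]] by simp
    have "(LINT y|lborel. h (pos n 1) * (indicator {pos n 1..} y * exp (- y))) \<le> T (pos n 1)"
      unfolding T_def using e intT[of "pos n 1"] monoD[OF \<open>mono h\<close>]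
      by (intro integral_mono) (auto simp: has_bochner_integral_iff indicator_def)
    then show ?case
      unfolding has_bochner_integral_integral_eq[OF e] using exp_pos(2)[of 1 n] \<open>1 \<le> n\<close> by simp
  next
    case (Suc m)
    have "h (pos n (Suc (Suc m))) * (exp (- pos n (Suc (Suc m))) - exp (- pos n (Suc m)))
        \<le> T (pos n (Suc (Suc m))) - T (pos n (Suc m))"
      unfolding T_def using \<open>1 \<le> n\<close> by (intro tail_integral_step assms pos_antimono) auto
    moreover have "exp (- pos n (Suc (Suc m))) - exp (- pos n (Suc m)) = 1 / n"
      using \<open>1 \<le> n\<close> by (simp add: exp_pos field_simps)
    ultimately have "h (pos n (Suc (Suc m))) / n \<le> T (pos n (Suc (Suc m))) - T (pos n (Suc m))" by simp
    then show ?case using Suc.IH by simp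
  qed
  from this[of "n - 1"] have "(\<Sum>v=1..n. h (pos n v) / n) \<le> T (pos n n)" using \<open>1 \<le> n\<close> by simp
  also have "\<dots> \<le> (LINT y|lborel. exp (- y) * h y)"
    unfolding T_def using assms(2) by (intro integral_mono intT int) (auto simp: indicator_def)
  finally show ?thesis .
qed

text \<open>An upper sum: \<open>v\<close> takes the cell between \<open>v + 1\<close> and itself,
  so \<open>v = n\<close> is left out. The part beyond \<open>pos n m\<close>, belonging to removed
  vertices, appears as the subtracted tail.\<close>

lemma riemann_sum_ge:
  fixes h :: "real \<Rightarrow> real"
  assumes "mono h" "\<And>y. y < 0 \<Longrightarrow> h y = 0" and int: "integrable lborel (\<lambda>y. exp (- y) * h y)"
    and "1 \<le> m" "m \<le> n"
  shows "(LINT y|lborel. exp (- y) * h y) - (LINT y|lborel. indicator {pos n m..} y * (exp (- y) * h y))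
    \<le> (\<Sum>v=m..<n. h (pos n v) / n)"
proof -
  define T where "T z = (LINT y|lborel. indicator {z..} y * (exp (- y) * h y))" for z :: real
  have "T (pos n (m + k)) - T (pos n m) \<le> (\<Sum>v=m..<m + k. h (pos n v) / n)" for k
  proof (induction k)
    case (Suc k)
    have "T (pos n (Suc (m + k))) - T (pos n (m + k))
        \<le> h (pos n (m + k)) * (exp (- pos n (Suc (m + k))) - exp (- pos n (m + k)))"
      unfolding T_def using assms by (intro tail_integral_step pos_antimono) auto
    moreover have "exp (- pos n (Suc (m + k))) - exp (- pos n (m + k)) = 1 / n"
      using assms by (simp add: exp_pos field_simps)
    ultimately show ?case using Suc.IH by simp
  qed simp
  from this[of "n - m"] have "T (pos n n) - T (pos n m) \<le> (\<Sum>v=m..<n. h (pos n v) / n)"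
    using assms by simp
  moreover have "T (pos n n) = (LINT y|lborel. exp (- y) * h y)"
  proof -
    have "pos n n = 0" using assms by (simp add: pos_def)
    then show ?thesis unfolding T_def using assms(2)
      by (intro Bochner_Integration.integral_cong) (auto simp: indicator_def)
  qed
  ultimately show ?thesis by (simp add: T_def)
qed

section \<open>Products against exponentials\<close>

lemma prod_one_minus_ge:
  fixes t :: "'b \<Rightarrow> real"
  assumes "finite T" "\<And>w. w \<in> T \<Longrightarrow> 0 \<le> t w \<and> t w \<le> q" "q \<le> 1 / 2"
  shows "exp (- ((1 + 2 * q) * (\<Sum>w\<in>T. t w))) \<le> (\<Prod>w\<in>T. 1 - t w)"
proof -
  have "exp (- ((1 + 2 * q) * (\<Sum>w\<in>T. t w))) = (\<Prod>w\<in>T. exp (- ((1 + 2 * q) * t w)))"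
    using assms(1) by (simp add: sum_distrib_left exp_sum[symmetric] sum_negf)
  also have "\<dots> \<le> (\<Prod>w\<in>T. 1 - t w)"
  proof (rule prod_mono, intro conjI)
    fix w assume "w \<in> T"
    then have t: "0 \<le> t w" "t w \<le> q" using assms(2) by auto
    have "t w * t w \<le> q * t w" using t by (intro mult_right_mono) auto
    then have "- ((1 + 2 * q) * t w) \<le> - t w - 2 * (t w)\<^sup>2" by (simp add: algebra_simps power2_eq_square)
    also have "\<dots> \<le> ln (1 - t w)" using t assms(3) by (intro ln_one_minus_pos_lower_bound) auto
    finally have "exp (- ((1 + 2 * q) * t w)) \<le> exp (ln (1 - t w))" by simp
    then show "exp (- ((1 + 2 * q) * t w)) \<le> 1 - t w" using t assms(3) by simp
  qed simp
  finally show ?thesis .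
qed

lemma prod_one_minus_le:
  fixes t :: "'b \<Rightarrow> real"
  assumes "finite T" "\<And>w. w \<in> T \<Longrightarrow> t w \<le> 1"
  shows "(\<Prod>w\<in>T. 1 - t w) \<le> exp (- (\<Sum>w\<in>T. t w))"
proof -
  have "(\<Prod>w\<in>T. 1 - t w) \<le> (\<Prod>w\<in>T. exp (- t w))"
    using assms(2) exp_ge_add_one_self[of "- t w" for w] by (intro prod_mono) auto
  also have "\<dots> = exp (- (\<Sum>w\<in>T. t w))"
    using assms(1) by (simp add: exp_sum[symmetric] sum_negf)
  finally show ?thesis .
qed

text \<open>Convexity of the exponential, \<open>exp (- c * g) \<le> (1 - c) + c * exp (- g)\<close>, gives multiples of
  the fixed point a uniform gap as strict sub- and supersolutions. The gap absorbs the errors of the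
  discretisation.\<close>

lemma exp_convex_scale:
  fixes c g :: real
  assumes "0 \<le> c" "c \<le> 1"
  shows "exp (- (c * g)) \<le> (1 - c) + c * exp (- g)"
proof -
  have "exp ((1 - c) *\<^sub>R 0 + c *\<^sub>R (- g)) \<le> (1 - c) * exp 0 + c * exp (- g)"
    using assms by (intro convex_onD[OF exp_convex]) auto
  then show ?thesis by simp
qed

context kernel
begin

text \<open>In contrast to \<open>ker x y = a / 2 * exp (- y) * KK x y\<close>, the function \<open>KK\<close> is symmetric and increasing
  in both arguments; sums over vertices are therefore comparable to integrals.\<close>

definition KK :: "real \<Rightarrow> real \<Rightarrow> real" where
  "KK x y = exp ((x + y) / 2 - a * \<bar>x - y\<bar>)"

definition ep :: "real \<Rightarrow> nat \<times> nat \<Rightarrow> real" where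
  "ep \<beta> = (\<lambda>(i, j). edge_prob (1 / 2 - a) \<beta> i j)"

section \<open>Edge probabilities and kernel sums\<close>

lemma edge_model_ep: "0 \<le> \<beta> \<Longrightarrow> edge_model (ep \<beta>)"
  by unfold_locales (auto simp: ep_def edge_prob_def)

lemma ker_KK: "exp (- y) * KK x y = 2 / a * ker x y"
proof -
  have "exp (- y) * KK x y = exp ((x - y) / 2 - a * \<bar>x - y\<bar>)"
    unfolding KK_def by (subst exp_add[symmetric]) (simp add: field_simps)
  then show ?thesis using a_pos by (simp add: ker_def)
qed

lemma KK_mono: assumes "y \<le> y'" shows "KK x y \<le> KK x y'"
proof -
  have "a * (\<bar>x - y'\<bar> - \<bar>x - y\<bar>) \<le> a * (y' - y)"
    using assms a_pos by (intro mult_left_mono) auto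
  also have "\<dots> \<le> 1 / 2 * (y' - y)" using a_le assms by (intro mult_right_mono) auto
  finally show ?thesis by (simp add: KK_def algebra_simps add_divide_distrib)
qed

lemma KK_le: "KK x y \<le> exp ((1 / 2 + a) * x + (1 / 2 - a) * y)" "KK x y \<le> exp ((x + y) / 2)"
proof -
  have "a * (y - x) \<le> a * \<bar>x - y\<bar>" using a_pos by (intro mult_left_mono) auto
  then show "KK x y \<le> exp ((1 / 2 + a) * x + (1 / 2 - a) * y)"
    by (simp add: KK_def algebra_simps add_divide_distrib)
  have "0 \<le> a * \<bar>x - y\<bar>" using a_pos by simp
  then have "(x + y) / 2 - a * \<bar>x - y\<bar> \<le> (x + y) / 2" by linarith
  then show "KK x y \<le> exp ((x + y) / 2)" unfolding KK_def by (simp only: exp_le_cancel_iff)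
qed

text \<open>For \<open>\<beta> <= 1\<close> the truncation in \<open>edge_prob\<close> is inactive,
  as both powers are at most 1, and a product of powers becomes an exponential in the logarithmic
  coordinates.\<close>

lemma pr_ep:
  assumes "0 \<le> \<beta>" "\<beta> \<le> 1" "v \<in> {1..n}" "w \<in> {1..n}"
  shows "edge_model.pr (ep \<beta>) v w = \<beta> / n * KK (pos n v) (pos n w)"
proof -
  interpret edge_model n "ep \<beta>" by (rule edge_model_ep[OF assms(1)])
  define i j where "i = min v w" and "j = max v w"
  have ij: "1 \<le> i" "i \<le> j" "j \<le> n" using assms by (auto simp: i_def j_def)
  have le1: "real i powr - (1 / 2 - a) * real j powr (1 / 2 - a - 1) \<le> 1"
  proof -
    have "real i powr - (1 / 2 - a) \<le> real i powr 0" using ij a_le by (intro powr_mono) auto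
    moreover have "real j powr (1 / 2 - a - 1) \<le> real j powr 0" using ij a_pos by (intro powr_mono) auto
    ultimately have "real i powr - (1 / 2 - a) * real j powr (1 / 2 - a - 1) \<le> 1 * 1"
      using ij by (intro mult_mono) auto
    then show ?thesis by simp
  qed
  have "KK (pos n v) (pos n w) = KK (pos n i) (pos n j)"
    by (auto simp: i_def j_def min_def max_def KK_def abs_minus_commute add.commute)
  also have "\<dots> = exp (ln n + (- (1 / 2 - a) * ln i + (1 / 2 - a - 1) * ln j))"
    using ij pos_antimono[of i j n] by (simp add: KK_def pos_def ln_div field_simps)
  also have "\<dots> = n * (real i powr - (1 / 2 - a) * real j powr (1 / 2 - a - 1))"
    using ij by (simp add: exp_add powr_def)
  finally have KK: "KK (pos n v) (pos n w) = n * (real i powr - (1 / 2 - a) * real j powr (1 / 2 - a - 1))" .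
  have "pr v w = edge_prob (1 / 2 - a) \<beta> i j" unfolding pr_def by (simp add: ep_def i_def j_def)
  also have "\<dots> = \<beta> * (real i powr - (1 / 2 - a) * real j powr (1 / 2 - a - 1))"
    using mult_mono[OF assms(2) le1] assms(1) unfolding edge_prob_def by (simp add: mult.assoc)
  finally show ?thesis using KK ij by simp
qed

lemma mono_KK_adm: "adm f \<Longrightarrow> mono (\<lambda>y. KK x y * f y)"
  using adm_bounds KK_mono by (intro monoI mult_mono) (auto simp: KK_def)

lemma integral_KK_adm:
  assumes "adm f"
  shows "integrable lborel (\<lambda>y. exp (- y) * (KK x y * f y))"
    and "(LINT y|lborel. exp (- y) * (KK x y * f y)) = 2 / a * conv f x"
proof -
  have eq: "exp (- y) * (KK x y * f y) = 2 / a * (ker x y * f y)" for y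
    using ker_KK[of y x] by (simp only: mult.assoc[symmetric])
  show "integrable lborel (\<lambda>y. exp (- y) * (KK x y * f y))"
    unfolding eq using integrable_ker_adm[OF assms] by (rule integrable_mult_right)
  show "(LINT y|lborel. exp (- y) * (KK x y * f y)) = 2 / a * conv f x"
    unfolding eq conv_def by simp
qed

lemma sum_pr_le:
  assumes "adm f" "0 \<le> \<beta>" "\<beta> \<le> 1" "v \<in> {1..n}" "1 \<le> n"
  shows "(\<Sum>w\<in>{1..n} - {v}. edge_model.pr (ep \<beta>) v w * f (pos n w)) \<le> \<beta> / (a / 2) * conv f (pos n v)"
proof -
  have "(\<Sum>w\<in>{1..n} - {v}. edge_model.pr (ep \<beta>) v w * f (pos n w))
      = (\<Sum>w\<in>{1..n} - {v}. \<beta> * (KK (pos n v) (pos n w) * f (pos n w) / n))"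
    by (intro sum.cong refl) (simp add: pr_ep[OF assms(2,3,4)])
  also have "\<dots> \<le> (\<Sum>w=1..n. \<beta> * (KK (pos n v) (pos n w) * f (pos n w) / n))"
    using assms adm_bounds[OF assms(1)] by (intro sum_mono2) (auto simp: KK_def)
  also have "\<dots> = \<beta> * (\<Sum>w=1..n. KK (pos n v) (pos n w) * f (pos n w) / n)"
    by (simp add: sum_distrib_left)
  also have "\<dots> \<le> \<beta> * (LINT y|lborel. exp (- y) * (KK (pos n v) y * f y))"
    using assms adm_bounds[OF assms(1)]
    by (intro mult_left_mono riemann_sum_le mono_KK_adm integral_KK_adm) (auto simp: KK_def)
  also have "\<dots> = \<beta> / (a / 2) * conv f (pos n v)"
    by (simp add: integral_KK_adm[OF assms(1)])
  finally show ?thesis .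
qed

text \<open>Two losses against the integral: the removed vertices \<open>w < m\<close> cost the tail
  beyond \<open>pos n m\<close>, and the absent diagonal term \<open>w = v\<close> costs at most
  \<open>\<beta> / n * exp (pos n v)\<close>.\<close>

lemma sum_pr_ge:
  assumes "adm f" "0 \<le> \<beta>" "\<beta> \<le> 1" "1 \<le> m" "m \<le> v" "v \<le> n"
  shows "\<beta> / (a / 2) * (conv f (pos n v) - exp (- (pos n m - pos n v) / 2)) - \<beta> / n * exp (pos n v)
     \<le> (\<Sum>w\<in>{m..n} - {v}. edge_model.pr (ep \<beta>) v w * f (pos n w))"
proof -
  let ?x = "pos n v" and ?h = "\<lambda>y. KK (pos n v) y * f y"
  have vn: "v \<in> {1..n}" "1 \<le> n" using assms by auto
  have f: "0 \<le> f y" "f y \<le> 1" for y using adm_bounds[OF assms(1)] by auto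
  have xm: "?x \<le> pos n m" using assms by (intro pos_antimono) auto
  have tail: "(LINT y|lborel. indicator {pos n m..} y * (exp (- y) * ?h y)) \<le> 2 / a * exp (- (pos n m - ?x) / 2)"
  proof -
    have "(LINT y|lborel. indicator {pos n m..} y * (exp (- y) * ?h y))
        \<le> (LINT y|lborel. exp ((1 / 2 + a) * ?x) * (indicator {pos n m..} y * exp (- (1 / 2 + a) * y)))"
    proof (rule integral_mono)
      show "integrable lborel (\<lambda>y. indicator {pos n m..} y * (exp (- y) * ?h y))"
        using integrable_mult_indicator[OF _ integral_KK_adm(1)[OF assms(1)], of "{pos n m..}"] by simp
      show "integrable lborel (\<lambda>y. exp ((1 / 2 + a) * ?x) * (indicator {pos n m..} y * exp (- (1 / 2 + a) * y)))"
        using a_pos by (intro integrable_mult_right integrable_exp_Ici) auto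
      fix y
      have "exp (- y) * ?h y \<le> exp (- y) * (exp ((1 / 2 + a) * ?x + (1 / 2 - a) * y) * 1)"
        using KK_le(1)[of ?x y] f by (intro mult_left_mono mult_mono) (auto simp: KK_def)
      also have "\<dots> = exp ((1 / 2 + a) * ?x) * exp (- (1 / 2 + a) * y)"
        by (simp add: exp_add[symmetric] algebra_simps)
      finally show "indicator {pos n m..} y * (exp (- y) * ?h y)
          \<le> exp ((1 / 2 + a) * ?x) * (indicator {pos n m..} y * exp (- (1 / 2 + a) * y))"
        by (auto simp: indicator_def)
    qed
    also have "\<dots> = exp ((1 / 2 + a) * ?x) * (exp (- (1 / 2 + a) * pos n m) / (1 / 2 + a))"
      using integral_exp_Ici[of "1 / 2 + a" "pos n m"] a_pos by simp
    also have "\<dots> = exp (- (1 / 2 + a) * (pos n m - ?x)) / (1 / 2 + a)"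
      by (simp add: exp_add[symmetric] algebra_simps)
    also have "\<dots> \<le> exp (- (pos n m - ?x) / 2) / (a / 2)"
    proof (intro frac_le)
      have "1 / 2 * (pos n m - ?x) \<le> (1 / 2 + a) * (pos n m - ?x)"
        using xm a_pos by (intro mult_right_mono) auto
      then have "- (1 / 2 + a) * (pos n m - ?x) \<le> - (pos n m - ?x) / 2" by linarith
      then show "exp (- (1 / 2 + a) * (pos n m - ?x)) \<le> exp (- (pos n m - ?x) / 2)"
        by (simp only: exp_le_cancel_iff)
    qed (use a_pos a_le in auto)
    finally show ?thesis by (simp add: mult.commute)
  qed
  have "2 / a * (conv f ?x - exp (- (pos n m - ?x) / 2))
      \<le> (LINT y|lborel. exp (- y) * ?h y) - (LINT y|lborel. indicator {pos n m..} y * (exp (- y) * ?h y))"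
    using tail by (simp add: integral_KK_adm[OF assms(1)] right_diff_distrib)
  also have "\<dots> \<le> (\<Sum>w=m..<n. ?h (pos n w) / n)"
    using assms adm_bounds[OF assms(1)]
    by (intro riemann_sum_ge mono_KK_adm integral_KK_adm) auto
  also have "\<dots> \<le> (\<Sum>w\<in>{m..n}. ?h (pos n w) / n)"
    using f by (intro sum_mono2) (auto simp: KK_def)
  also have "\<dots> = (\<Sum>w\<in>{m..n} - {v}. ?h (pos n w) / n) + ?h ?x / n"
    using assms by (subst sum.remove[of _ v]) auto
  also have "?h ?x / n \<le> exp ?x / n"
    using f[of ?x] by (intro divide_right_mono) (auto simp: KK_def)
  finally have "\<beta> * (2 / a * (conv f ?x - exp (- (pos n m - ?x) / 2)))
      \<le> \<beta> * ((\<Sum>w\<in>{m..n} - {v}. ?h (pos n w) / n) + exp ?x / n)"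
    using assms(2) by (intro mult_left_mono) auto
  moreover have "(\<Sum>w\<in>{m..n} - {v}. edge_model.pr (ep \<beta>) v w * f (pos n w))
      = \<beta> * (\<Sum>w\<in>{m..n} - {v}. ?h (pos n w) / n)"
    unfolding sum_distrib_left using assms(4) by (intro sum.cong refl) (simp add: pr_ep[OF assms(2,3) vn(1)])
  ultimately show ?thesis by (simp add: algebra_simps)
qed

text \<open>Where \<open>\<mu> * prof s\<close> has reached 1 the left side is 0, so only positions
  up to \<open>X\<close> matter. From these, \<open>KK_le\<close> bounds even the connection to the
  oldest vertex, at \<open>ln n\<close>, by \<open>exp X * n powr (1 / 2 - a)\<close>. Hence all
  edge probabilities are at most a small \<open>q\<close>, and the product is an exponential up to
  the factor \<open>1 + 2 * q\<close> in the exponent.\<close>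

lemma supersolution_step:
  assumes s: "0 < s" "s < 1" and \<mu>: "1 < \<mu>" and \<beta>: "0 < \<beta>" "\<beta> \<le> 1" and n: "1 \<le> n"
    and X: "0 \<le> X" "1 \<le> \<mu> * prof s X"
    and q: "\<beta> / n * exp (X + (1 / 2 - a) * ln n) \<le> q" "q \<le> 1 / 2"
    and \<eta>: "(1 + 2 * q) * (\<beta> / (a / 2)) \<le> 1 + \<eta>" "0 \<le> \<eta>" "\<eta> * \<mu> * conv (prof s) X \<le> (\<mu> - 1) * (1 - s)"
    and v: "v \<in> {1..n}"
  defines "h \<equiv> \<lambda>w. min 1 (\<mu> * prof s (pos n w))"
  shows "1 - h v \<le> s * (\<Prod>w\<in>{1..n} - {v}. 1 - edge_model.pr (ep \<beta>) v w * h w)"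
proof -
  interpret edge_model n "ep \<beta>" using \<beta> by (intro edge_model_ep) simp
  have s01: "0 \<le> s" "s \<le> 1" using s by auto
  note adm = adm_prof[OF s01]
  have h01: "0 \<le> h w" "h w \<le> 1" for w
    using adm_bounds(1)[OF adm] \<mu> by (auto simp: h_def)
  have fac: "pr v w * h w \<le> 1" for w
    using mult_mono[of "pr v w" 1 "h w" 1] h01 by simp
  show ?thesis
  proof (cases "X \<le> pos n v")
    case True
    then have "\<mu> * prof s X \<le> \<mu> * prof s (pos n v)"
      using adm_bounds(4)[OF adm] \<mu> by (intro mult_left_mono) auto
    then have "h v = 1" using X by (simp add: h_def)
    then show ?thesis using s fac by (auto intro!: mult_nonneg_nonneg prod_nonneg)
  next
    case False
    define x where "x = pos n v"
    define g where "g = conv (prof s) x"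
    have x: "0 \<le> x" "x \<le> X" using False pos_nonneg v by (auto simp: x_def)
    have g: "0 \<le> g" "g \<le> conv (prof s) X"
      using conv_nonneg[OF adm] conv_mono[OF adm x(2)] by (auto simp: g_def)
    have prq: "pr v w \<le> q" if "w \<in> {1..n}" for w
    proof -
      have "(1 / 2 + a) * x \<le> 1 * X" using x a_le a_pos by (intro mult_mono) auto
      moreover have "(1 / 2 - a) * pos n w \<le> (1 / 2 - a) * ln n"
      proof (rule mult_left_mono)
        have "real n / real w \<le> real n / 1" using that by (intro frac_le) auto
        then show "pos n w \<le> ln n" using that n by (simp add: pos_def)
      qed (use a_le in simp)
      ultimately have "KK x (pos n w) \<le> exp (X + (1 / 2 - a) * ln n)"
        by (intro order_trans[OF KK_le(1)]) simp
      then have "pr v w \<le> \<beta> / n * exp (X + (1 / 2 - a) * ln n)"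
        using pr_ep[of \<beta> v n w] \<beta> v that unfolding x_def
        by (simp add: mult_left_mono divide_right_mono)
      then show ?thesis using q by simp
    qed
    have q0: "0 \<le> q" using prq[OF v] pr_bounds(1)[of v v] by linarith
    have "(\<Sum>w\<in>{1..n} - {v}. pr v w * h w) \<le> (\<Sum>w\<in>{1..n} - {v}. \<mu> * (pr v w * prof s (pos n w)))"
    proof (rule sum_mono)
      fix w
      have "pr v w * h w \<le> pr v w * (\<mu> * prof s (pos n w))" by (intro mult_left_mono) (auto simp: h_def)
      then show "pr v w * h w \<le> \<mu> * (pr v w * prof s (pos n w))" by (simp add: mult_ac)
    qed
    also have "\<dots> \<le> \<mu> * (\<beta> / (a / 2) * g)"
      unfolding sum_distrib_left[symmetric] g_def x_def
      using \<mu> \<beta> v n by (intro mult_left_mono sum_pr_le adm) auto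
    finally have "(1 + 2 * q) * (\<Sum>w\<in>{1..n} - {v}. pr v w * h w) \<le> (1 + 2 * q) * (\<mu> * (\<beta> / (a / 2) * g))"
      using q0 by (intro mult_left_mono) auto
    also have "\<dots> = (1 + 2 * q) * (\<beta> / (a / 2)) * (\<mu> * g)" by simp
    also have "\<dots> \<le> (1 + \<eta>) * (\<mu> * g)" using \<eta> \<mu> g by (intro mult_right_mono) auto
    also have "\<dots> \<le> \<mu> * g + (\<mu> - 1) * (1 - s)"
    proof -
      have "\<eta> * \<mu> * g \<le> \<eta> * \<mu> * conv (prof s) X" using g \<eta> \<mu> by (intro mult_left_mono) auto
      then show ?thesis using \<eta>(3) by (simp add: algebra_simps)
    qed
    finally have "exp (- (\<mu> * g + (\<mu> - 1) * (1 - s)))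
        \<le> exp (- ((1 + 2 * q) * (\<Sum>w\<in>{1..n} - {v}. pr v w * h w)))" by simp
    also have "\<dots> \<le> (\<Prod>w\<in>{1..n} - {v}. 1 - pr v w * h w)"
    proof (rule prod_one_minus_ge[OF _ _ q(2)])
      fix w assume "w \<in> {1..n} - {v}"
      then show "0 \<le> pr v w * h w \<and> pr v w * h w \<le> q"
        using prq[of w] h01[of w] mult_mono[of "pr v w" q "h w" 1] q0 by auto
    qed simp
    finally have prod: "s * exp (- (\<mu> * g + (\<mu> - 1) * (1 - s))) \<le> s * (\<Prod>w\<in>{1..n} - {v}. 1 - pr v w * h w)"
      using s by (intro mult_left_mono) auto
    define r where "r = (\<mu> - 1) * (1 - s)"
    have r: "0 \<le> r" using \<mu> s by (simp add: r_def)
    \<comment> \<open>\<open>exp_convex_scale\<close> with weight \<open>1 / \<mu>\<close> at the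
      point \<open>\<mu> * g\<close>; the slack \<open>r\<close> remains because
      \<open>s < 1\<close>.\<close>
    have "1 - \<mu> * prof s x \<le> s * exp (- (\<mu> * g)) - r"
    proof -
      have c: "0 \<le> 1 / \<mu>" "1 / \<mu> \<le> 1" using \<mu> by auto
      have "exp (- g) \<le> (1 - 1 / \<mu>) + 1 / \<mu> * exp (- (\<mu> * g))"
        using exp_convex_scale[OF c, of "\<mu> * g"] \<mu> by simp
      then have "\<mu> * exp (- g) \<le> \<mu> * ((1 - 1 / \<mu>) + 1 / \<mu> * exp (- (\<mu> * g)))"
        using \<mu> by (intro mult_left_mono) auto
      also have "\<dots> = \<mu> - 1 + exp (- (\<mu> * g))" using \<mu> by (simp add: field_simps)
      finally have "s * (\<mu> * exp (- g)) \<le> s * (\<mu> - 1 + exp (- (\<mu> * g)))"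
        using s by (intro mult_left_mono) auto
      moreover have "\<mu> * prof s x = \<mu> * (1 - s * exp (- g))"
        unfolding g_def by (rule arg_cong[OF prof_eq[OF s01 x(1)]])
      ultimately show ?thesis by (simp add: r_def algebra_simps)
    qed
    also have "s * exp (- (\<mu> * g)) - r \<le> s * exp (- (\<mu> * g + r))"
    proof -
      have "0 \<le> \<mu> * g" using \<mu> g by simp
      then have se: "s * exp (- (\<mu> * g)) \<le> 1" using mult_mono[of s 1 "exp (- (\<mu> * g))" 1] s by simp
      have "s * exp (- (\<mu> * g)) * (1 - r) \<le> s * exp (- (\<mu> * g)) * exp (- r)"
        using s exp_ge_add_one_self[of "- r"] by (intro mult_left_mono) auto
      moreover have "s * exp (- (\<mu> * g)) * r \<le> 1 * r" using se r by (intro mult_right_mono) auto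
      moreover have "exp (- (\<mu> * g + r)) = exp (- (\<mu> * g)) * exp (- r)" by (simp add: exp_add[symmetric])
      ultimately show ?thesis by (simp add: algebra_simps)
    qed
    also note prod[folded r_def]
    finally have "1 - \<mu> * prof s x \<le> s * (\<Prod>w\<in>{1..n} - {v}. 1 - pr v w * h w)" .
    moreover have "0 \<le> s * (\<Prod>w\<in>{1..n} - {v}. 1 - pr v w * h w)"
      using s fac by (auto intro!: mult_nonneg_nonneg prod_nonneg)
    ultimately show ?thesis by (auto simp: h_def x_def min_def)
  qed
qed

text \<open>Left of \<open>X\<close> the truncation at \<open>pos n m\<close> is far away and all
  errors fit into the slack \<open>(1 - l) * (1 - s)\<close>. Right of \<open>X\<close>, possibly
  next to the truncation, accuracy is lost, but the kernel sum is still large enough to push the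
  product below \<open>1 - l\<close>, which suffices as \<open>prof s <= 1\<close>.\<close>

lemma subsolution_step:
  assumes s: "0 < s" "s < 1" and l: "0 < l" "l < 1" and \<beta>: "0 < \<beta>" "\<beta> \<le> 1" and m: "1 \<le> m" "m \<le> n"
    and X0: "pos n m \<le> X0" "X0 - 1 \<le> pos n m"
    and \<rho>: "1 / 2 \<le> \<beta> / (a / 2)" "\<beta> / (a / 2) \<le> 2" and u: "\<beta> / n * exp X0 \<le> 1"
    and X: "0 \<le> X" "1 \<le> conv (prof s) X" "ln (1 / (1 - l)) \<le> l * ((conv (prof s) X - 1) / 2 - 1)"
    and \<eta>: "\<bar>\<beta> / (a / 2) - 1\<bar> * conv (prof s) X + 2 * exp (- (X0 - 1 - X) / 2) + \<beta> / n * exp X0 \<le> \<eta>"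
      "\<eta> \<le> 1" "2 * \<eta> \<le> (1 - l) * (1 - s)"
    and v: "v \<in> {m..n}"
  shows "s * (\<Prod>w\<in>{m..n} - {v}. 1 - edge_model.pr (ep \<beta>) v w * (l * prof s (pos n w)))
    \<le> 1 - l * prof s (pos n v)"
proof -
  interpret edge_model n "ep \<beta>" using \<beta> by (intro edge_model_ep) simp
  have s01: "0 \<le> s" "s \<le> 1" using s by auto
  note adm = adm_prof[OF s01]
  have f01: "0 \<le> prof s y" "prof s y \<le> 1" for y using adm_bounds[OF adm] by auto
  define x where "x = pos n v"
  define g where "g = conv (prof s) x"
  define S where "S = (\<Sum>w\<in>{m..n} - {v}. pr v w * prof s (pos n w))"
  define \<rho> where "\<rho> = \<beta> / (a / 2)"
  define b where "b = \<beta> / n * exp X0"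
  have x: "0 \<le> x" "x \<le> pos n m" using v m pos_nonneg pos_antimono by (auto simp: x_def)
  have "(\<Prod>w\<in>{m..n} - {v}. 1 - pr v w * (l * prof s (pos n w)))
      \<le> exp (- (\<Sum>w\<in>{m..n} - {v}. pr v w * (l * prof s (pos n w))))"
  proof (rule prod_one_minus_le)
    fix w
    have "pr v w * (l * prof s (pos n w)) \<le> 1 * (1 * 1)"
      using f01 l by (intro mult_mono) auto
    then show "pr v w * (l * prof s (pos n w)) \<le> 1" by simp
  qed simp
  also have "(\<Sum>w\<in>{m..n} - {v}. pr v w * (l * prof s (pos n w))) = l * S"
    by (simp add: S_def sum_distrib_left mult_ac)
  finally have prod: "s * (\<Prod>w\<in>{m..n} - {v}. 1 - pr v w * (l * prof s (pos n w))) \<le> s * exp (- (l * S))"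
    using s by (intro mult_left_mono) auto
  have "\<beta> / n * exp x \<le> b"
    unfolding b_def using x X0 \<beta> by (intro mult_left_mono) auto
  then have S: "\<rho> * (g - exp (- (pos n m - x) / 2)) - b \<le> S"
    using sum_pr_ge[OF adm, of \<beta> m v n] \<beta> m v unfolding S_def \<rho>_def g_def x_def by fastforce
  show ?thesis
  proof (cases "X \<le> x")
    case True
    then have gX: "conv (prof s) X \<le> g" unfolding g_def by (rule conv_mono[OF adm])
    have e1: "exp (- (pos n m - x) / 2) \<le> 1" using x by simp
    have "conv (prof s) X - 1 \<le> g - exp (- (pos n m - x) / 2)" using gX e1 by linarith
    then have "1 / 2 * (conv (prof s) X - 1) \<le> \<rho> * (g - exp (- (pos n m - x) / 2))"
      using X(2) \<rho>(1) unfolding \<rho>_def by (intro mult_mono) auto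
    then have "(conv (prof s) X - 1) / 2 - 1 \<le> S" using S u unfolding b_def by linarith
    then have "l * ((conv (prof s) X - 1) / 2 - 1) \<le> l * S" using l by (intro mult_left_mono) auto
    then have "ln (1 / (1 - l)) \<le> l * S" using X(3) by linarith
    then have "exp (- (l * S)) \<le> exp (- ln (1 / (1 - l)))" by simp
    also have "\<dots> = 1 - l" using l by (simp add: exp_minus)
    finally have "s * exp (- (l * S)) \<le> 1 * (1 - l)" using s l by (intro mult_mono) auto
    also have "\<dots> \<le> 1 - l * prof s x" using l f01[of x] by (simp add: mult_left_le)
    finally show ?thesis using prod by (simp add: x_def)
  next
    case False
    have gX: "0 \<le> g" "g \<le> conv (prof s) X"
      using False conv_nonneg[OF adm] conv_mono[OF adm, of x X] by (auto simp: g_def)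
    define t where "t = exp (- (X0 - 1 - X) / 2)"
    have "exp (- (pos n m - x) / 2) \<le> t" using False X0 by (simp add: t_def)
    then have "\<rho> * exp (- (pos n m - x) / 2) \<le> 2 * t"
      using \<rho> by (intro mult_mono) (auto simp: \<rho>_def)
    moreover have "- (\<bar>\<rho> - 1\<bar> * conv (prof s) X) \<le> (\<rho> - 1) * g"
    proof -
      have "\<bar>(\<rho> - 1) * g\<bar> \<le> \<bar>\<rho> - 1\<bar> * conv (prof s) X"
        using gX unfolding abs_mult by (intro mult_left_mono) auto
      then show ?thesis by linarith
    qed
    ultimately have "g - \<eta> \<le> S"
      using S \<eta>(1) unfolding \<rho>_def[symmetric] t_def[symmetric] b_def[symmetric]
      by (simp add: algebra_simps)
    then have "l * (g - \<eta>) \<le> l * S" using l by (intro mult_left_mono) auto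
    moreover have \<eta>0: "0 \<le> \<eta>"
    proof -
      have "0 \<le> \<bar>\<beta> / (a / 2) - 1\<bar> * conv (prof s) X" using X by simp
      moreover have "0 \<le> \<beta> / n * exp X0" using \<beta> by simp
      ultimately show ?thesis using \<eta>(1) exp_gt_zero[of "- (X0 - 1 - X) / 2"] by linarith
    qed
    moreover have "l * \<eta> \<le> 1 * \<eta>" using l \<eta>0 by (intro mult_right_mono) auto
    ultimately have "- (l * S) \<le> - (l * g) + \<eta>" by (simp add: right_diff_distrib)
    then have "exp (- (l * S)) \<le> exp (- (l * g) + \<eta>)" by simp
    also have "\<dots> = exp (- (l * g)) * exp \<eta>" by (rule exp_add)
    also have "\<dots> \<le> exp (- (l * g)) * (1 + 2 * \<eta>)"
    proof (rule mult_left_mono)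
      have "exp \<eta> \<le> 1 + \<eta> + \<eta>\<^sup>2" using \<eta>0 \<eta>(2) by (rule exp_bound)
      moreover have "\<eta>\<^sup>2 \<le> \<eta>" using \<eta>0 \<eta>(2) by (simp add: power2_eq_square mult_left_le)
      ultimately show "exp \<eta> \<le> 1 + 2 * \<eta>" by simp
    qed simp
    also have "\<dots> \<le> exp (- (l * g)) + 2 * \<eta>"
    proof -
      have "exp (- (l * g)) * (2 * \<eta>) \<le> 1 * (2 * \<eta>)"
        using gX l \<eta>0 by (intro mult_right_mono) auto
      then show ?thesis by (simp add: algebra_simps)
    qed
    also have "\<dots> \<le> (1 - l) + l * exp (- g) + 2 * \<eta>" using exp_convex_scale[of l g] l by simp
    finally have "s * exp (- (l * S)) \<le> s * ((1 - l) + l * exp (- g) + 2 * \<eta>)"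
      using s by (intro mult_left_mono) auto
    also have "\<dots> \<le> s * ((1 - l) + l * exp (- g)) + 2 * \<eta>"
      using s \<eta>0 mult_right_mono[of s 1 "2 * \<eta>"] by (simp add: algebra_simps)
    also have "\<dots> \<le> s * ((1 - l) + l * exp (- g)) + (1 - l) * (1 - s)" using \<eta>(3) by simp
    also have "\<dots> = 1 - l * (1 - s * exp (- g))" by (simp add: algebra_simps)
    also have "1 - s * exp (- g) = prof s x" unfolding g_def by (rule prof_eq[OF s01 x(1), symmetric])
    finally show ?thesis using prod by (simp add: x_def)
  qed
qed

section \<open>Mean generating functions of the finite graphs\<close>

lemma mass_bounds:
  assumes "0 \<le> s" "s \<le> 1" shows "0 \<le> mass s" "mass s \<le> 1"
proof -
  note f = adm_bounds[OF adm_prof[OF assms]]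
  show "0 \<le> mass s" unfolding mass_def using f by (intro integral_nonneg_AE AE_I2) auto
  have "mass s \<le> (LINT y|lborel. indicator {0..} y * exp (- 1 * y))"
    unfolding mass_def using f
    by (intro integral_mono integrable_mass assms integrable_exp_Ici) (auto simp: indicator_def)
  then show "mass s \<le> 1" using integral_exp_Ici[of 1 0] by simp
qed

lemma mean_pgf_lower:
  assumes s: "0 < s" "s < 1" and \<beta>: "\<And>n. 1 \<le> n \<Longrightarrow> 0 < \<beta> n" "\<beta> \<longlonglongrightarrow> a / 2" and \<mu>: "1 < \<mu>"
  shows "\<forall>\<^sub>F n in sequentially. 1 - \<mu> * mass s
    \<le> (\<Sum>v=1..n. edge_model.pgf n (ep (\<beta> n)) s {1..n} {v} / n)"
proof -
  have s01: "0 \<le> s" "s \<le> 1" using s by auto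
  note adm = adm_prof[OF s01]
  obtain X where X: "0 \<le> X" "ln (1 / (1 - 1 / \<mu>)) \<le> conv (prof s) X"
    using conv_prof_unbounded[of s] s by auto
  have "1 \<le> \<mu> * prof s X"
  proof -
    have "exp (- conv (prof s) X) \<le> exp (- ln (1 / (1 - 1 / \<mu>)))" using X by simp
    also have "\<dots> = 1 - 1 / \<mu>" using \<mu> by (simp add: exp_minus)
    finally have "s * exp (- conv (prof s) X) \<le> 1 * (1 - 1 / \<mu>)"
      using s \<mu> by (intro mult_mono) auto
    moreover have "prof s X = 1 - s * exp (- conv (prof s) X)" by (rule prof_eq[OF s01 X(1)])
    ultimately have "1 / \<mu> \<le> prof s X" by simp
    then show ?thesis using \<mu> by (simp add: field_simps)
  qed
  note X' = X(1) this
  \<comment> \<open>The relative error that the slack absorbs at all positions up to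
    \<open>X\<close>; the \<open>+ 1\<close> keeps the denominator positive.\<close>
  define \<eta> where "\<eta> = (\<mu> - 1) * (1 - s) / (\<mu> * (conv (prof s) X + 1))"
  have L: "0 \<le> conv (prof s) X" by (rule conv_nonneg[OF adm])
  have \<eta>: "0 < \<eta>" using \<mu> s L by (simp add: \<eta>_def)
  have \<eta>': "\<eta> * \<mu> * conv (prof s) X \<le> (\<mu> - 1) * (1 - s)"
  proof -
    have "\<eta> * \<mu> * conv (prof s) X \<le> \<eta> * \<mu> * (conv (prof s) X + 1)"
      using \<eta> \<mu> by (intro mult_left_mono) auto
    also have "\<dots> = (\<mu> - 1) * (1 - s)" using \<mu> L by (simp add: \<eta>_def)
    finally show ?thesis .
  qed
  \<comment> \<open>The exponent \<open>1 / 2\<close> majorises \<open>1 / 2 - a\<close>, so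
    \<open>q\<close> vanishes like \<open>n powr (- 1 / 2)\<close>.\<close>
  define q where "q n = \<beta> n / real n * exp (X + 1 / 2 * ln (real n))" for n
  have "(\<lambda>n. exp (X + 1 / 2 * ln (real n)) / real n) \<longlonglongrightarrow> 0" by real_asymp
  from tendsto_mult[OF \<beta>(2) this] have q: "q \<longlonglongrightarrow> 0" by (simp add: q_def[abs_def])
  have a2: "a / 2 < 1" "0 < a / 2" using a_pos a_le by auto
  have "(\<lambda>n. (1 + 2 * q n) * (\<beta> n / (a / 2))) \<longlonglongrightarrow> (1 + 2 * 0) * ((a / 2) / (a / 2))"
    using a2 by (intro tendsto_intros q \<beta>) auto
  then have "(\<lambda>n. (1 + 2 * q n) * (\<beta> n / (a / 2))) \<longlonglongrightarrow> 1" using a2 by simp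
  from order_tendstoD(2)[OF this, of "1 + \<eta>"] \<eta>
  have ev1: "\<forall>\<^sub>F n in sequentially. (1 + 2 * q n) * (\<beta> n / (a / 2)) < 1 + \<eta>" by simp
  have ev2: "\<forall>\<^sub>F n in sequentially. q n < 1 / 2" using order_tendstoD(2)[OF q, of "1 / 2"] by simp
  have ev3: "\<forall>\<^sub>F n in sequentially. \<beta> n < 1" using order_tendstoD(2)[OF \<beta>(2) a2(1)] .
  show ?thesis
    using ev1 ev2 ev3 eventually_ge_at_top[of 1]
  proof eventually_elim
    case (elim n)
    have b: "0 < \<beta> n" "\<beta> n \<le> 1" using elim \<beta>(1) by auto
    interpret edge_model n "ep (\<beta> n)" using b by (intro edge_model_ep) simp
    define h where "h w = min 1 (\<mu> * prof s (pos n w))" for w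
    have h01: "0 \<le> h w" "h w \<le> 1" for w
      using adm_bounds(1)[OF adm] \<mu> by (auto simp: h_def)
    have "0 \<le> ln (real n)" using elim by simp
    then have "(1 / 2 - a) * ln (real n) \<le> 1 / 2 * ln (real n)" using a_pos by (intro mult_right_mono) auto
    then have qn: "\<beta> n / n * exp (X + (1 / 2 - a) * ln n) \<le> q n"
      unfolding q_def using b by (intro mult_left_mono) auto
    have "1 - h v \<le> s * (\<Prod>w\<in>{1..n} - {v}. 1 - pr v w * h w)" if "v \<in> {1..n}" for v
      unfolding h_def using elim qn \<eta> \<eta>' X' b that
      by (intro supersolution_step[where q = "q n" and \<eta> = \<eta> and X = X] s \<mu>) auto
    then have "(\<Prod>v\<in>{v}. 1 - h v) \<le> pgf s {1..n} {v}" if "v \<in> {1..n}" for v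
      using h01 s that by (intro pgf_ge_supersolution[where ?W0.0 = "{1..n}"]) auto
    then have le: "1 - \<mu> * prof s (pos n v) \<le> pgf s {1..n} {v}" if "v \<in> {1..n}" for v
      using that by (fastforce simp: h_def)
    have "(\<Sum>v=1..n. prof s (pos n v) / n) \<le> mass s"
      unfolding mass_def using adm_bounds(1)[OF adm] adm elim
      by (intro riemann_sum_le integrable_mass s01) (auto simp: adm_def)
    then have "1 - \<mu> * mass s \<le> 1 - \<mu> * (\<Sum>v=1..n. prof s (pos n v) / n)" using \<mu> by simp
    also have "\<dots> = (\<Sum>v=1..n. (1 - \<mu> * prof s (pos n v)) / n)"
      using elim by (simp add: diff_divide_distrib sum_subtractf sum_distrib_left)
    also have "\<dots> \<le> (\<Sum>v=1..n. pgf s {1..n} {v} / n)"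
      by (intro sum_mono divide_right_mono le) auto
    finally show ?case .
  qed
qed

text \<open>Removing the vertices \<open>v < m\<close>, with \<open>m\<close> about
  \<open>n * exp (- X0)\<close>, shrinks clusters and so raises the generating function. All
  remaining edge probabilities are at most \<open>\<beta> n / n * exp X0\<close>, which makes the
  error of \<open>pgf_le_subsolution\<close> of order \<open>1 / n\<close>. As roots, the removed
  vertices are a fraction of order \<open>exp (- X0)\<close> and get the trivial bound.\<close>

lemma mean_pgf_upper:
  assumes s: "0 < s" "s < 1" and \<beta>: "\<And>n. 1 \<le> n \<Longrightarrow> 0 < \<beta> n" "\<beta> \<longlonglongrightarrow> a / 2"
    and l: "0 < l" "l < 1" and \<delta>: "0 < \<delta>"
  shows "\<forall>\<^sub>F n in sequentially. (\<Sum>v=1..n. edge_model.pgf n (ep (\<beta> n)) s {1..n} {v} / n)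
    \<le> 1 - l * mass s + \<delta>"
proof -
  have s01: "0 \<le> s" "s \<le> 1" using s by auto
  note adm = adm_prof[OF s01]
  note f = adm_bounds[OF adm]
  obtain X where X: "0 \<le> X" "max 1 (3 + 2 * (ln (1 / (1 - l)) / l)) \<le> conv (prof s) X"
    using conv_prof_unbounded[of s "max 1 (3 + 2 * (ln (1 / (1 - l)) / l))"] s by auto
  have X1: "1 \<le> conv (prof s) X" using X by simp
  have X2: "ln (1 / (1 - l)) \<le> l * ((conv (prof s) X - 1) / 2 - 1)"
  proof -
    have "t \<le> (c - 1) / 2 - 1" if "3 + 2 * t \<le> c" for t c :: real using that by (simp add: field_simps)
    then have "ln (1 / (1 - l)) / l \<le> (conv (prof s) X - 1) / 2 - 1" using X(2) by (meson max.boundedE)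
    then show ?thesis using l by (simp add: pos_divide_le_eq mult.commute)
  qed
  define \<eta> where "\<eta> = min 1 ((1 - l) * (1 - s) / 2)"
  have \<eta>: "0 < \<eta>" "\<eta> \<le> 1" "2 * \<eta> \<le> (1 - l) * (1 - s)" using l s by (auto simp: \<eta>_def min_def)
  have "((\<lambda>X0. 2 * exp (- (X0 - 1 - X) / 2)) \<longlongrightarrow> 0) at_top" "((\<lambda>X0. exp (1 - X0)) \<longlongrightarrow> (0::real)) at_top"
    by real_asymp+
  from order_tendstoD(2)[OF this(1) \<eta>(1)] order_tendstoD(2)[OF this(2), of "\<delta> / 2"] \<delta>
  have "\<forall>\<^sub>F X0 in at_top. 2 * exp (- (X0 - 1 - X) / 2) < \<eta> \<and> exp (1 - X0) < \<delta> / 2 \<and> 0 \<le> X0"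
    by (intro eventually_conj eventually_ge_at_top) auto
  then obtain X0 where X0: "2 * exp (- (X0 - 1 - X) / 2) < \<eta>" "exp (1 - X0) < \<delta> / 2" "0 \<le> X0"
    using eventually_happens'[OF trivial_limit_at_top_linorder] by blast
  define b where "b n = \<beta> n / real n * exp X0" for n
  have "(\<lambda>n. exp X0 / real n) \<longlonglongrightarrow> 0" by real_asymp
  from tendsto_mult[OF \<beta>(2) this] have b: "b \<longlonglongrightarrow> 0" by (simp add: b_def[abs_def])
  have a2: "a / 2 < 1" "0 < a / 2" using a_pos a_le by auto
  have "(\<lambda>n. \<beta> n / (a / 2)) \<longlonglongrightarrow> (a / 2) / (a / 2)" using a2 by (intro tendsto_intros \<beta>) auto
  then have \<rho>: "(\<lambda>n. \<beta> n / (a / 2)) \<longlonglongrightarrow> 1" using a2 by simp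
  have "(\<lambda>n. \<bar>\<beta> n / (a / 2) - 1\<bar> * conv (prof s) X + 2 * exp (- (X0 - 1 - X) / 2) + b n)
      \<longlonglongrightarrow> \<bar>1 - 1\<bar> * conv (prof s) X + 2 * exp (- (X0 - 1 - X) / 2) + 0"
    by (intro tendsto_intros \<rho> b)
  from order_tendstoD(2)[OF this, of \<eta>] X0
  have ev1: "\<forall>\<^sub>F n in sequentially. \<bar>\<beta> n / (a / 2) - 1\<bar> * conv (prof s) X
      + 2 * exp (- (X0 - 1 - X) / 2) + b n < \<eta>" by simp
  define err where "err n = b n * (1 / (1 - s) + \<beta> n * exp X0 / (1 - s)\<^sup>2)" for n
  have "err \<longlonglongrightarrow> 0 * (1 / (1 - s) + a / 2 * exp X0 / (1 - s)\<^sup>2)"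
    unfolding err_def using s by (intro tendsto_intros b \<beta>) auto
  then have "err \<longlonglongrightarrow> 0" by simp
  from order_tendstoD(2)[OF this, of "\<delta> / 2"] \<delta>
  have ev2: "\<forall>\<^sub>F n in sequentially. err n < \<delta> / 2" by simp
  have ev3: "\<forall>\<^sub>F n in sequentially. \<beta> n < 1" using order_tendstoD(2)[OF \<beta>(2) a2(1)] .
  have ev4: "\<forall>\<^sub>F n in sequentially. 1 / 2 < \<beta> n / (a / 2)" "\<forall>\<^sub>F n in sequentially. \<beta> n / (a / 2) < 2"
    by (rule order_tendstoD(1)[OF \<rho>], simp, rule order_tendstoD(2)[OF \<rho>], simp)
  have ev5: "\<forall>\<^sub>F n in sequentially. b n < 1" using order_tendstoD(2)[OF b, of 1] by simp
  have ev6: "\<forall>\<^sub>F n in sequentially. exp X0 \<le> real n"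
    using filterlim_real_sequentially unfolding filterlim_at_top by blast
  show ?thesis
    using ev1 ev2 ev3 ev4 ev5 ev6 eventually_ge_at_top[of 1]
  proof eventually_elim
    case (elim n)
    have bn: "0 < \<beta> n" "\<beta> n \<le> 1" using elim \<beta>(1) by auto
    interpret edge_model n "ep (\<beta> n)" using bn by (intro edge_model_ep) simp
    have n: "1 \<le> n" "exp X0 \<le> n" using elim by auto
    \<comment> \<open>The oldest vertex kept. Rounding shifts its coordinate by at most 1, since
      \<open>m <= 2 * (n * exp (- X0))\<close> and \<open>2 <= exp 1\<close>.\<close>
    define m where "m = nat \<lceil>n * exp (- X0)\<rceil>"
    have npos: "1 \<le> n * exp (- X0)" using n by (simp add: exp_minus field_simps)
    have m_real: "n * exp (- X0) \<le> m" "m \<le> n * exp (- X0) + 1"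
      using npos by (auto simp: m_def)
    have m1: "1 \<le> m" using npos m_real by linarith
    have mn: "m \<le> n"
    proof -
      have "n * exp (- X0) \<le> real n" using X0(3) by (simp add: mult_left_le)
      then show ?thesis by (simp add: m_def ceiling_le_iff)
    qed
    have pm: "pos n m \<le> X0" "X0 - 1 \<le> pos n m"
    proof -
      have "real n \<le> m * exp X0"
        using m_real(1) mult_right_mono[of "n * exp (- X0)" m "exp X0"]
        by (simp add: mult.assoc exp_add[symmetric])
      then have "n / m \<le> exp X0" using m1 by (simp add: field_simps)
      then have "exp (pos n m) \<le> exp X0" using exp_pos(1)[OF m1 n(1)] by simp
      then show "pos n m \<le> X0" by simp
      have "real m \<le> 2 * (n * exp (- X0))" using m_real npos by linarith
      also have "\<dots> \<le> exp 1 * (n * exp (- X0))"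
        using exp_ge_add_one_self[of 1] by (intro mult_right_mono) auto
      also have "\<dots> = n * exp (- (X0 - 1))" by (simp add: exp_add[symmetric] mult.left_commute)
      finally have "real m * exp (X0 - 1) \<le> n * exp (- (X0 - 1)) * exp (X0 - 1)"
        by (intro mult_right_mono) auto
      then have "real m * exp (X0 - 1) \<le> n" by (simp add: mult.assoc exp_add[symmetric])
      then have "exp (X0 - 1) \<le> n / m" using m1 by (simp add: field_simps)
      then have "exp (X0 - 1) \<le> exp (pos n m)" using exp_pos(1)[OF m1 n(1)] by simp
      then show "X0 - 1 \<le> pos n m" by simp
    qed
    define h where "h w = l * prof s (pos n w)" for w
    have h01: "0 \<le> h w" "h w \<le> 1" for w
      using f(1,2)[of "pos n w"] l mult_mono[of l 1 "prof s (pos n w)" 1] by (auto simp: h_def)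
    have sub: "s * (\<Prod>w\<in>{m..n} - {v}. 1 - pr v w * h w) \<le> 1 - h v" if "v \<in> {m..n}" for v
      unfolding h_def
      by (rule subsolution_step[OF s l bn m1 mn pm _ _ _ X(1) X1 X2 _ \<eta>(2,3) that])
        (use elim in \<open>auto simp: b_def\<close>)
    have prq: "pr v w \<le> b n" if "v \<in> {m..n}" "w \<in> {m..n}" for v w
    proof -
      have "pos n v \<le> X0" "pos n w \<le> X0"
        using that m1 pm(1) pos_antimono[of m v n] pos_antimono[of m w n] n by auto
      then have "KK (pos n v) (pos n w) \<le> exp X0" by (intro order_trans[OF KK_le(2)]) simp
      then show ?thesis
        using pr_ep[of "\<beta> n" v n w] bn that m1 unfolding b_def
        by (simp add: mult_left_mono divide_right_mono)
    qed
    have b0: "0 \<le> b n" using bn by (simp add: b_def)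
    have pgf_le: "pgf s {1..n} {v} \<le> 1 - h v + err n" if v: "v \<in> {m..n}" for v
    proof -
      have "pgf s {1..n} {v} \<le> pgf s {m..n} {v}"
        using v m1 by (intro pgf_antimono s01) auto
      also have "\<dots> \<le> (\<Prod>v\<in>{v}. 1 - h v) + b n * (1 / (1 - s) * (card ({m..n} - {m..n}) + card {v})
          + \<beta> n * exp X0 / (1 - s)\<^sup>2)"
      proof (rule pgf_le_subsolution)
        show "real (card {m..n}) * b n \<le> \<beta> n * exp X0"
        proof -
          have "real (card {m..n}) * b n \<le> n * b n" using b0 m1 by (intro mult_right_mono) auto
          also have "\<dots> = \<beta> n * exp X0" using n by (simp add: b_def)
          finally show ?thesis .
        qed
      qed (use v m1 s h01 sub prq b0 in auto)
      finally show ?thesis by (simp add: err_def)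
    qed
    have err0: "0 \<le> err n" using b0 bn s by (simp add: err_def)
    have split: "{1..n} = {1..<m} \<union> {m..n}" using m1 mn by auto
    have "(\<Sum>v=1..n. pgf s {1..n} {v} / n)
        = (\<Sum>v=1..<m. pgf s {1..n} {v} / n) + (\<Sum>v=m..n. pgf s {1..n} {v} / n)"
      by (subst (1) split, subst sum.union_disjoint) auto
    also have "\<dots> \<le> (\<Sum>v=1..<m. (1 + err n) / n) + (\<Sum>v=m..n. (1 - h v + err n) / n)"
    proof (intro add_mono sum_mono divide_right_mono)
      fix v show "pgf s {1..n} {v} \<le> 1 + err n"
        using pgf_bounds(2)[OF s01, of "{1..n}" "{v}"] err0 by linarith
    qed (use pgf_le in auto)
    also have "\<dots> = (\<Sum>v=1..n. (1 + err n) / n) - (\<Sum>v=m..n. h v / n)"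
    proof -
      have "(\<Sum>v=m..n. (1 - h v + err n) / n) = (\<Sum>v=m..n. (1 + err n) / n) - (\<Sum>v=m..n. h v / n)"
        unfolding sum_subtractf[symmetric]
        by (intro sum.cong refl) (simp add: diff_divide_distrib add_divide_distrib)
      moreover have "(\<Sum>v=1..n. (1 + err n) / n) = (\<Sum>v=1..<m. (1 + err n) / n) + (\<Sum>v=m..n. (1 + err n) / n)"
        unfolding split by (rule sum.union_disjoint) auto
      ultimately show ?thesis by linarith
    qed
    also have "\<dots> = 1 + err n - l * (\<Sum>v=m..n. prof s (pos n v) / n)"
      using n by (simp add: h_def sum_distrib_left)
    also have "\<dots> \<le> 1 + err n - l * (mass s - exp (1 - X0))"
    proof -
      have "mass s - (LINT y|lborel. indicator {pos n m..} y * (exp (- y) * prof s y))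
          \<le> (\<Sum>v=m..<n. prof s (pos n v) / n)"
        unfolding mass_def using f m1 mn adm
        by (intro riemann_sum_ge integrable_mass s01) (auto simp: adm_def)
      also have "\<dots> \<le> (\<Sum>v=m..n. prof s (pos n v) / n)"
        using f by (intro sum_mono2) auto
      finally have *: "mass s - (LINT y|lborel. indicator {pos n m..} y * (exp (- y) * prof s y))
          \<le> (\<Sum>v=m..n. prof s (pos n v) / n)" .
      have "(LINT y|lborel. indicator {pos n m..} y * (exp (- y) * prof s y))
          \<le> (LINT y|lborel. indicator {pos n m..} y * exp (- 1 * y))"
      proof (rule integral_mono)
        show "integrable lborel (\<lambda>y. indicator {pos n m..} y * (exp (- y) * prof s y))"
          using integrable_mult_indicator[OF _ integrable_mass[OF s01], of "{pos n m..}"] by simp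
      qed (use f integrable_exp_Ici[of 1 "pos n m"] in \<open>auto simp: indicator_def\<close>)
      also have "\<dots> = exp (- pos n m)" using integral_exp_Ici[of 1 "pos n m"] by simp
      also have "\<dots> \<le> exp (1 - X0)" using pm by simp
      finally have "mass s - exp (1 - X0) \<le> (\<Sum>v=m..n. prof s (pos n v) / n)" using * by linarith
      from mult_left_mono[OF this, of l] show ?thesis using l by simp
    qed
    also have "\<dots> \<le> 1 - l * mass s + \<delta>"
    proof -
      have "l * exp (1 - X0) \<le> 1 * exp (1 - X0)" using l by (intro mult_right_mono) auto
      then show ?thesis using elim(2) X0(2) unfolding right_diff_distrib by linarith
    qed
    finally show ?case .
  qed
qed

lemma mean_pgf_tendsto:
  assumes s: "0 < s" "s < 1" and \<beta>: "\<And>n. 1 \<le> n \<Longrightarrow> 0 < \<beta> n" "\<beta> \<longlonglongrightarrow> a / 2"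
  shows "(\<lambda>n. \<Sum>v=1..n. edge_model.pgf n (ep (\<beta> n)) s {1..n} {v} / n) \<longlonglongrightarrow> 1 - mass s"
proof (rule order_tendstoI)
  have m: "0 \<le> mass s" "mass s \<le> 1" using mass_bounds[of s] s by auto
  fix c assume c: "c < 1 - mass s"
  define d where "d = (1 - mass s - c) / 2"
  have d: "0 < d" using c by (simp add: d_def)
  have "d * mass s \<le> d * 1" using d m by (intro mult_left_mono) auto
  moreover have "c = 1 - mass s - 2 * d" by (simp add: d_def field_simps)
  ultimately have "c < 1 - (1 + d) * mass s" using d unfolding distrib_right mult_1 by linarith
  then show "\<forall>\<^sub>F n in sequentially. c < (\<Sum>v=1..n. edge_model.pgf n (ep (\<beta> n)) s {1..n} {v} / n)"
    using mean_pgf_lower[OF s \<beta>, of "1 + d"] d by (auto elim!: eventually_mono)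
next
  have m: "0 \<le> mass s" "mass s \<le> 1" using mass_bounds[of s] s by auto
  fix c assume c: "1 - mass s < c"
  define d where "d = min (1 / 2) ((c - (1 - mass s)) / 4)"
  have d: "0 < d" "d \<le> 1 / 2" "4 * d \<le> c - (1 - mass s)" using c by (auto simp: d_def min_def)
  have "d * mass s \<le> d * 1" using d m by (intro mult_left_mono) auto
  then have "1 - (1 - d) * mass s + d < c" using d unfolding left_diff_distrib mult_1 by linarith
  then show "\<forall>\<^sub>F n in sequentially. (\<Sum>v=1..n. edge_model.pgf n (ep (\<beta> n)) s {1..n} {v} / n) < c"
    using mean_pgf_upper[OF s \<beta>, of "1 - d" d] d by (auto elim!: eventually_mono)
qed

end

section \<open>From generating functions to tails\<close>

lemma expectation_add_finite:
  fixes u v :: "'a \<Rightarrow> real"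
  assumes "finite (set_pmf P)"
  shows "measure_pmf.expectation P (\<lambda>x. u x + v x) = measure_pmf.expectation P u + measure_pmf.expectation P v"
    and "measure_pmf.expectation P (\<lambda>x. u x - v x) = measure_pmf.expectation P u - measure_pmf.expectation P v"
  using integrable_measure_pmf_finite[OF assms] by (auto intro: Bochner_Integration.integral_add Bochner_Integration.integral_diff)

text \<open>After subtracting the lower coefficients and dividing by \<open>s ^ j\<close>, the
  generating function is \<open>pmf (Q n) j\<close> up to an error of at most \<open>s\<close>,
  uniformly in \<open>n\<close>. Its convergence at a small fixed \<open>s\<close> makes the
  coefficients Cauchy.\<close>

lemma pmf_convergent_of_pgf:
  fixes Q :: "nat \<Rightarrow> nat pmf"
  assumes fin: "\<And>n. finite (set_pmf (Q n))"
    and conv: "\<And>s :: real. 0 < s \<Longrightarrow> s < 1 \<Longrightarrow> convergent (\<lambda>n. measure_pmf.expectation (Q n) (\<lambda>t. s ^ t))"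
  shows "convergent (\<lambda>n. pmf (Q n) j)"
proof (induction j rule: less_induct)
  case (less j)
  define b where "b s n = (measure_pmf.expectation (Q n) (\<lambda>t. s ^ t) - (\<Sum>i<j. pmf (Q n) i * s ^ i)) / s ^ j" for s :: real and n
  have b_conv: "convergent (b s)" if "0 < s" "s < 1" for s
    unfolding b_def using conv[OF that] less that
    by (auto intro!: convergent_diff convergent_sum convergent_mult convergent_const simp: divide_inverse)
  have E: "measure_pmf.expectation (Q n) (\<lambda>t. s ^ t) = (\<Sum>i<j. pmf (Q n) i * s ^ i) + measure_pmf.expectation (Q n) (\<lambda>t. if j \<le> t then s ^ t else 0)"
    for s :: real and n
  proof -
    have "(\<Sum>i<j. pmf (Q n) i * s ^ i) = measure_pmf.expectation (Q n) (\<lambda>t. if t < j then s ^ t else 0)"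
      by (subst integral_measure_pmf[of "{..<j}"]) (auto split: if_splits)
    moreover have "measure_pmf.expectation (Q n) (\<lambda>t. s ^ t)
      = measure_pmf.expectation (Q n) (\<lambda>t. (if t < j then s ^ t else 0) + (if j \<le> t then s ^ t else 0))"
      by (intro Bochner_Integration.integral_cong) auto
    ultimately show ?thesis by (simp only: expectation_add_finite[OF fin])
  qed
  have b_bounds: "pmf (Q n) j \<le> b s n" "b s n \<le> pmf (Q n) j + s" if s: "0 < s" "s < 1" for s n
  proof -
    have bs: "b s n * s ^ j = measure_pmf.expectation (Q n) (\<lambda>t. if j \<le> t then s ^ t else 0)"
      using s by (simp add: b_def E)
    have pj: "pmf (Q n) j * s ^ j = measure_pmf.expectation (Q n) (\<lambda>t. if t = j then s ^ t else 0)"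
      by (subst integral_measure_pmf[of "{j}"]) (auto split: if_splits)
    have "pmf (Q n) j * s ^ j \<le> b s n * s ^ j"
      unfolding bs pj using s by (intro expectation_mono_finite fin) auto
    then show "pmf (Q n) j \<le> b s n" using s by simp
    have "b s n * s ^ j \<le> measure_pmf.expectation (Q n) (\<lambda>t. (if t = j then s ^ t else 0) + s ^ Suc j)"
      unfolding bs
    proof (intro expectation_mono_finite fin)
      fix t
      have "s ^ t \<le> s ^ Suc j" if "j < t" using that s by (intro power_decreasing) auto
      then show "(if j \<le> t then s ^ t else 0) \<le> (if t = j then s ^ t else 0) + s ^ Suc j"
        using s by (cases "j < t") auto
    qed
    also have "\<dots> = (pmf (Q n) j + s) * s ^ j"
      unfolding expectation_add_finite[OF fin] pj[symmetric] by (simp add: algebra_simps)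
    finally show "b s n \<le> pmf (Q n) j + s" using s by simp
  qed
  have "Cauchy (\<lambda>n. pmf (Q n) j)"
  proof (rule CauchyI)
    fix e :: real assume "0 < e"
    define s where "s = min (e / 2) (1 / 2)"
    have s: "0 < s" "s < 1" "s \<le> e / 2" using \<open>0 < e\<close> by (auto simp: s_def)
    obtain M where M: "\<And>m n. m \<ge> M \<Longrightarrow> n \<ge> M \<Longrightarrow> norm (b s m - b s n) < e / 2"
      using CauchyD[OF convergent_Cauchy[OF b_conv[OF s(1,2)]], of "e / 2"] \<open>0 < e\<close> by auto
    have "norm (pmf (Q m) j - pmf (Q n) j) < e" if "m \<ge> M" "n \<ge> M" for m n
    proof -
      have "b s m - b s n < e / 2 \<and> - (b s m - b s n) < e / 2"
        using M[OF that] unfolding real_norm_def abs_less_iff .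
      then show ?thesis
        unfolding real_norm_def abs_less_iff
        using b_bounds[OF s(1,2), of m] b_bounds[OF s(1,2), of n] s(3) by linarith
    qed
    then show "\<exists>M. \<forall>m\<ge>M. \<forall>n\<ge>M. norm (pmf (Q m) j - pmf (Q n) j) < e" by blast
  qed
  then show ?case by (rule Cauchy_convergent)
qed

text \<open>Through a finite sum, convergence of point masses passes to tails, whether or not mass
  escapes to infinity.\<close>

lemma prob_atLeast_pmf:
  fixes Q :: "nat pmf"
  shows "measure_pmf.prob Q {k..} = 1 - (\<Sum>i<k. pmf Q i)"
proof -
  have "measure_pmf.prob Q {k..} = 1 - measure_pmf.prob Q {..<k}"
    using measure_pmf.prob_compl[of "{..<k}" Q] by (simp add: Compl_eq_Diff_UNIV[symmetric] Compl_lessThan)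
  then show ?thesis by (simp add: measure_measure_pmf_finite)
qed

lemma prob_eq_expectation:
  "measure_pmf.prob Q {k..} = measure_pmf.expectation Q (\<lambda>t. if k \<le> t then 1 else 0 :: real)"
proof -
  have "measure_pmf.expectation Q (indicator {k..}) = measure_pmf.prob Q {k..}" by simp
  moreover have "(indicator {k..} :: _ \<Rightarrow> real) = (\<lambda>t. if k \<le> t then 1 else 0)"
    by (auto simp: indicator_def)
  ultimately show ?thesis by simp
qed

text \<open>With \<open>s = exp (-1/k)\<close> the quantity \<open>1 - 2 E s\<^sup>T + E s\<^sup>2\<^sup>T = E (1 - s\<^sup>T)\<^sup>2\<close> is comparable to
  \<open>P (T \<ge> k)\<close>; the lower bound for the latter plays two scales \<open>k\<close> and \<open>M k\<close> against each other.\<close>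

definition sq_gap :: "nat pmf \<Rightarrow> real \<Rightarrow> real" where
  "sq_gap Q s = 1 - 2 * measure_pmf.expectation Q (\<lambda>t. s ^ t) + measure_pmf.expectation Q (\<lambda>t. (s\<^sup>2) ^ t)"

lemma sq_gap_eq:
  assumes "finite (set_pmf Q)" shows "sq_gap Q s = measure_pmf.expectation Q (\<lambda>t. (1 - s ^ t)\<^sup>2)"
proof -
  have "(1 - s ^ t)\<^sup>2 = 1 - 2 * s ^ t + (s\<^sup>2) ^ t" for t :: nat
    by (simp add: power2_diff power_mult[symmetric] mult.commute)
  then show ?thesis
    using assms by (simp add: sq_gap_def expectation_add_finite)
qed

lemma exp_neg_power: "exp (- 1 / real k) ^ t = exp (- (real t / real k))"
  by (simp add: exp_of_nat_mult[symmetric])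

lemma tail_le_sq_gap:
  assumes "finite (set_pmf Q)" "1 \<le> k"
  shows "measure_pmf.prob Q {k..} * (1 - exp (- 1))\<^sup>2 \<le> sq_gap Q (exp (- 1 / real k))"
proof -
  have "measure_pmf.prob Q {k..} * (1 - exp (- 1))\<^sup>2
      = measure_pmf.expectation Q (\<lambda>t. (if k \<le> t then 1 else 0) * (1 - exp (- 1))\<^sup>2)"
    unfolding prob_eq_expectation by simp
  also have "\<dots> \<le> measure_pmf.expectation Q (\<lambda>t. (1 - exp (- 1 / real k) ^ t)\<^sup>2)"
  proof (intro expectation_mono_finite assms(1))
    fix t
    show "(if k \<le> t then 1 else 0) * (1 - exp (- 1))\<^sup>2 \<le> (1 - exp (- 1 / real k) ^ t)\<^sup>2"
    proof (cases "k \<le> t")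
      case True
      then have "1 \<le> real t / real k" using assms(2) by simp
      then have "exp (- (real t / real k)) \<le> exp (- 1)" by simp
      moreover have "exp (- 1) \<le> (1::real)" by simp
      ultimately have "(1 - exp (- 1))\<^sup>2 \<le> (1 - exp (- 1 / real k) ^ t)\<^sup>2"
        unfolding exp_neg_power by (intro power_mono) linarith+
      then show ?thesis using True by simp
    qed simp
  qed
  finally show ?thesis by (simp add: sq_gap_eq assms)
qed

text \<open>For \<open>t < k\<close> and \<open>r = t / k\<close>, the integrand at scale
  \<open>M * k\<close> is at most \<open>(r / M)^2\<close>, while
  \<open>1 - exp (- r) >= r * (1 - exp (- 1))\<close> by concavity: only a fraction of order
  \<open>1 / M^2\<close> of the integrand at scale \<open>k\<close>. The gap itself falls only like
  \<open>1 / M\<close> up to logarithms, so for large \<open>M\<close> the tail must make up the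
  difference.\<close>

lemma sq_gap_le_tail:
  assumes "finite (set_pmf Q)" "1 \<le> k" "1 \<le> M"
  shows "sq_gap Q (exp (- 1 / real (M * k)))
    \<le> measure_pmf.prob Q {k..} + 1 / ((1 - exp (- 1))\<^sup>2 * (real M)\<^sup>2) * sq_gap Q (exp (- 1 / real k))"
proof -
  define e where "e = (1 - exp (- 1) :: real)"
  have e: "0 < e" by (simp add: e_def)
  define c where "c = 1 / (e\<^sup>2 * (real M)\<^sup>2)"
  have c: "0 < c" using e assms by (simp add: c_def)
  have "measure_pmf.expectation Q (\<lambda>t. (1 - exp (- 1 / real (M * k)) ^ t)\<^sup>2)
      \<le> measure_pmf.expectation Q (\<lambda>t. (if k \<le> t then 1 else 0) + c * (1 - exp (- 1 / real k) ^ t)\<^sup>2)"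
  proof (intro expectation_mono_finite assms(1))
    fix t
    show "(1 - exp (- 1 / real (M * k)) ^ t)\<^sup>2 \<le> (if k \<le> t then 1 else 0) + c * (1 - exp (- 1 / real k) ^ t)\<^sup>2"
    proof (cases "k \<le> t")
      case True
      have "(1 - exp (- (real t / real (M * k))))\<^sup>2 \<le> 1\<^sup>2" by (intro power_mono) auto
      then show ?thesis using True c unfolding exp_neg_power by (simp add: add_increasing2)
    next
      case False
      define r where "r = real t / real k"
      have r: "0 \<le> r" "r \<le> 1" using False assms by (auto simp: r_def)
      have "1 - exp (- (real t / real (M * k))) \<le> r / M"
        using exp_ge_add_one_self[of "- (real t / real (M * k))"] by (simp add: r_def mult.commute)
      then have "(1 - exp (- (real t / real (M * k))))\<^sup>2 \<le> (r / M)\<^sup>2"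
        by (intro power_mono) auto
      also have "\<dots> = c * (r * e)\<^sup>2" using e by (simp add: c_def power_mult_distrib power_divide)
      also have "\<dots> \<le> c * (1 - exp (- r))\<^sup>2"
      proof (intro mult_left_mono power_mono)
        show "r * e \<le> 1 - exp (- r)"
          using exp_convex_scale[OF r, of 1] by (simp add: e_def algebra_simps)
      qed (use r e c in auto)
      finally show ?thesis using False unfolding exp_neg_power r_def by simp
    qed
  qed
  then show ?thesis
    using assms(1) by (simp add: sq_gap_eq expectation_add_finite prob_eq_expectation c_def e_def)
qed

section \<open>The cluster of a uniform vertex and its limit law\<close>

definition cluster_size_pmf :: "real \<Rightarrow> real \<Rightarrow> nat \<Rightarrow> nat pmf" where
  "cluster_size_pmf \<gamma> \<beta> n
    = map_pmf (\<lambda>(E, v). card (component n E v)) (pair_pmf (growing_graph \<gamma> \<beta> n) (pmf_of_set {1..n}))"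

lemma cluster_tail_eq: "cluster_tail \<gamma> \<beta> n k = measure_pmf.prob (cluster_size_pmf \<gamma> \<beta> n) {k..}"
proof -
  have "(\<lambda>(E, v). card (component n E v)) -` {k..} = {(E, v). k \<le> card (component n E v)}" by auto
  then show ?thesis by (simp add: cluster_tail_def cluster_size_pmf_def)
qed

context kernel
begin

definition gap :: "nat \<Rightarrow> real" where
  "gap k = 2 * mass (exp (- 1 / real k)) - mass ((exp (- 1 / real k))\<^sup>2)"

lemma growing_graph_eq:
  assumes "0 \<le> \<beta>"
  shows "growing_graph (1 / 2 - a) \<beta> n = map_pmf (edge_model.edges n) (edge_model.edge_pmf n (ep \<beta>))"
proof -
  interpret edge_model n "ep \<beta>" by (rule edge_model_ep[OF assms])
  have "(\<lambda>(i, j). bernoulli_pmf (edge_prob (1 / 2 - a) \<beta> i j)) = (\<lambda>e. bernoulli_pmf (ep \<beta> e))"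
    by (auto simp: ep_def)
  then show ?thesis unfolding growing_graph_def edge_pmf_def edges_def[abs_def] by simp
qed

lemma cluster_size_pmf:
  assumes "0 \<le> \<beta>" "1 \<le> n"
  shows "finite (set_pmf (cluster_size_pmf (1 / 2 - a) \<beta> n))"
    and "measure_pmf.expectation (cluster_size_pmf (1 / 2 - a) \<beta> n) (\<lambda>t. s ^ t)
      = (\<Sum>v=1..n. edge_model.pgf n (ep \<beta>) s {1..n} {v} / n)"
proof -
  interpret edge_model n "ep \<beta>" by (rule edge_model_ep[OF assms(1)])
  have fin: "finite (set_pmf (growing_graph (1 / 2 - a) \<beta> n))"
    unfolding growing_graph_eq[OF assms(1)] by simp
  have V: "finite {1..n}" "{1..n} \<noteq> {}" using assms(2) by auto
  have finV: "finite (set_pmf (pmf_of_set {1..n}))" using V by simp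
  show "finite (set_pmf (cluster_size_pmf (1 / 2 - a) \<beta> n))"
    unfolding cluster_size_pmf_def using fin finV by simp
  have comp: "component n (edges X) v = reach (edges X) {1..n} {v}" if "v \<in> {1..n}" for X v
    using that by (intro component_eq_reach) (auto simp: edges_iff vertex_pairs_def min_def max_def split: if_splits)
  have "measure_pmf.expectation (cluster_size_pmf (1 / 2 - a) \<beta> n) (\<lambda>t. s ^ t)
      = measure_pmf.expectation (growing_graph (1 / 2 - a) \<beta> n) (\<lambda>E.
          measure_pmf.expectation (pmf_of_set {1..n}) (\<lambda>v. s ^ card (component n E v)))"
    unfolding cluster_size_pmf_def integral_map_pmf
    by (subst expectation_pair_pmf_finite[OF fin finV]) simp
  also have "\<dots> = measure_pmf.expectation edge_pmf (\<lambda>X. \<Sum>v=1..n. s ^ card (reach (edges X) {1..n} {v}) / n)"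
  proof -
    have "measure_pmf.expectation (pmf_of_set {1..n}) (\<lambda>v. s ^ card (component n (edges X) v))
        = (\<Sum>v=1..n. s ^ card (reach (edges X) {1..n} {v}) / n)" for X
      unfolding integral_pmf_of_set[OF V(2,1)] sum_divide_distrib
      by (intro sum.cong refl) (simp add: comp)
    then show ?thesis unfolding growing_graph_eq[OF assms(1)] by simp
  qed
  also have "\<dots> = (\<Sum>v=1..n. pgf s {1..n} {v} / n)"
    unfolding pgf_def
    by (subst Bochner_Integration.integral_sum) (auto intro!: integrable_measure_pmf_finite)
  finally show "measure_pmf.expectation (cluster_size_pmf (1 / 2 - a) \<beta> n) (\<lambda>t. s ^ t)
      = (\<Sum>v=1..n. pgf s {1..n} {v} / n)" .
qed

text \<open>The bounds mention only \<open>gap\<close>, which does not depend on the sequence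
  \<open>\<beta>\<close>; this makes the final constants uniform. One \<open>L\<close> serves all
  \<open>k\<close>, as different scales are compared.\<close>

lemma cluster_tail_limit:
  assumes \<beta>: "\<And>n. 1 \<le> n \<Longrightarrow> 0 < \<beta> n" "\<beta> \<longlonglongrightarrow> a / 2"
  obtains L where "\<And>k. (\<lambda>n. cluster_tail (1 / 2 - a) (\<beta> n) n k) \<longlonglongrightarrow> L k"
    and "\<And>k. 1 \<le> k \<Longrightarrow> L k * (1 - exp (- 1))\<^sup>2 \<le> gap k"
    and "\<And>k M. 1 \<le> k \<Longrightarrow> 1 \<le> M \<Longrightarrow>
      gap (M * k) \<le> L k + 1 / ((1 - exp (- 1))\<^sup>2 * (real M)\<^sup>2) * gap k"
    and "\<And>k. L k \<le> 1" and "\<And>k k'. k \<le> k' \<Longrightarrow> L k' \<le> L k"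
proof -
  \<comment> \<open>The index is shifted because \<open>pmf_of_set {1..n}\<close> is unspecified at
    \<open>n = 0\<close>.\<close>
  define Q where "Q n = cluster_size_pmf (1 / 2 - a) (\<beta> (Suc n)) (Suc n)" for n
  have \<beta>0: "0 \<le> \<beta> (Suc n)" for n using \<beta>(1)[of "Suc n"] by simp
  have fin: "finite (set_pmf (Q n))" for n
    unfolding Q_def by (intro cluster_size_pmf \<beta>0) simp
  have pgf: "(\<lambda>n. measure_pmf.expectation (Q n) (\<lambda>t. s ^ t)) \<longlonglongrightarrow> 1 - mass s" if "0 < s" "s < 1" for s
    using LIMSEQ_Suc[OF mean_pgf_tendsto[OF that \<beta>]] \<beta>0
    by (simp add: Q_def cluster_size_pmf(2))
  have "convergent (\<lambda>n. pmf (Q n) j)" for j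
    by (rule pmf_convergent_of_pgf[OF fin]) (use pgf convergentI in blast)
  then have conv: "convergent (\<lambda>n. 1 - (\<Sum>i<k. pmf (Q n) i))" for k
    by (intro convergent_diff convergent_const convergent_sum) auto
  define L where "L k = lim (\<lambda>n. measure_pmf.prob (Q n) {k..})" for k
  have L: "(\<lambda>n. measure_pmf.prob (Q n) {k..}) \<longlonglongrightarrow> L k" for k
    using conv[of k] unfolding L_def prob_atLeast_pmf by (simp add: convergent_LIMSEQ_iff)
  have gap: "(\<lambda>n. sq_gap (Q n) s) \<longlonglongrightarrow> 2 * mass s - mass (s\<^sup>2)" if "0 < s" "s < 1" for s
  proof -
    have s2: "0 < s\<^sup>2" "s\<^sup>2 < 1" using that by (auto simp: power_less_one_iff)
    have "(\<lambda>n. sq_gap (Q n) s) \<longlonglongrightarrow> 1 - 2 * (1 - mass s) + (1 - mass (s\<^sup>2))"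
      unfolding sq_gap_def by (intro tendsto_intros pgf that s2)
    then show ?thesis by simp
  qed
  have ek: "0 < exp (- 1 / real k)" "exp (- 1 / real k) < 1" if "1 \<le> k" for k
    using that by auto
  show ?thesis
  proof (rule that[of L])
    fix k
    show "(\<lambda>n. cluster_tail (1 / 2 - a) (\<beta> n) n k) \<longlonglongrightarrow> L k"
      by (rule LIMSEQ_imp_Suc) (use L[of k] in \<open>simp add: cluster_tail_eq Q_def\<close>)
    show "L k \<le> 1" by (rule LIMSEQ_le_const2[OF L]) auto
    show "L k' \<le> L k" if "k \<le> k'" for k'
      by (rule LIMSEQ_le[OF L L]) (use that in \<open>auto intro!: measure_pmf.finite_measure_mono\<close>)
    assume k: "1 \<le> k"
    show "L k * (1 - exp (- 1))\<^sup>2 \<le> gap k"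
      unfolding gap_def by (rule LIMSEQ_le[OF tendsto_mult_right[OF L] gap[OF ek[OF k]]])
        (use tail_le_sq_gap[OF fin k] in auto)
    fix M :: nat assume M: "1 \<le> M"
    have Mk: "1 \<le> M * k" using M k by simp
    show "gap (M * k) \<le> L k + 1 / ((1 - exp (- 1))\<^sup>2 * (real M)\<^sup>2) * gap k"
      unfolding gap_def by (rule LIMSEQ_le[OF gap[OF ek[OF Mk]] tendsto_add[OF L tendsto_mult_left[OF gap[OF ek[OF k]]]]])
        (use sq_gap_le_tail[OF fin k M] in auto)
  qed
qed

section \<open>Explicit scales and uniform constants\<close>

lemma scale_bounds:
  fixes k :: nat
  assumes "2 \<le> k"
  shows "1 / (2 * k) \<le> 1 - exp (- 1 / real k)" "1 - exp (- 1 / real k) \<le> 1 / k"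
    and "ln k \<le> ln (1 / (1 - exp (- 1 / real k)))" "ln (1 / (1 - exp (- 1 / real k))) \<le> 2 * ln k"
proof -
  have k: "0 < 1 / real k" "1 / real k \<le> 1" using assms by auto
  have "exp (- (1 / real k * 1)) \<le> (1 - 1 / real k) + 1 / real k * exp (- 1)"
    using k by (intro exp_convex_scale) auto
  moreover have "1 / real k * exp (- 1) \<le> 1 / real k * (1 / 2)"
  proof (rule mult_left_mono)
    show "exp (- 1) \<le> (1 / 2 :: real)"
      using exp_ge_add_one_self[of 1] by (simp add: exp_minus field_simps)
  qed (use k in simp)
  ultimately show lo: "1 / (2 * k) \<le> 1 - exp (- 1 / real k)" by (simp add: field_simps)
  show up: "1 - exp (- 1 / real k) \<le> 1 / k" using exp_ge_add_one_self[of "- 1 / real k"] by simp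
  have pos: "0 < 1 - exp (- 1 / real k)" using k by simp
  have "real k \<le> 1 / (1 - exp (- 1 / real k))" using up pos assms by (simp add: field_simps)
  then show "ln k \<le> ln (1 / (1 - exp (- 1 / real k)))" using assms by (intro ln_mono) auto
  have "1 / (1 - exp (- 1 / real k)) \<le> 2 * real k" using lo pos assms by (simp add: field_simps)
  also have "\<dots> \<le> real k * real k" using assms by (intro mult_right_mono) auto
  finally have "ln (1 / (1 - exp (- 1 / real k))) \<le> ln (real k * real k)" using pos by (intro ln_mono) auto
  also have "\<dots> = 2 * ln k" using assms by (simp add: ln_mult)
  finally show "ln (1 / (1 - exp (- 1 / real k))) \<le> 2 * ln k" .
qed

lemma mass_gap_scale:
  obtains c C :: real and K :: nat where "0 < c" "0 < C" "2 \<le> K"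
    and "\<And>k. K \<le> k \<Longrightarrow> c / (k * (ln k)\<^sup>2) \<le> gap k"
    and "\<And>k. K \<le> k \<Longrightarrow> gap k \<le> C / (k * (ln k)\<^sup>2)"
proof -
  obtain c C \<epsilon> where c: "0 < c" "0 < C" "0 < \<epsilon>"
    and gap: "\<And>s. \<lbrakk>0 < s; s < 1; 1 - s \<le> \<epsilon>\<rbrakk> \<Longrightarrow>
      c * (1 - s) / (ln (1 / (1 - s)))\<^sup>2 \<le> 2 * mass s - mass (s\<^sup>2) \<and>
      2 * mass s - mass (s\<^sup>2) \<le> C * (1 - s) / (ln (1 / (1 - s)))\<^sup>2"
    using mass_gap_bounds by blast
  define K where "K = max 2 (nat \<lceil>1 / \<epsilon>\<rceil>)"
  show ?thesis
  \<comment> \<open>A factor 2 from \<open>1 - s >= 1 / (2 * k)\<close> and a factor 4 from the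
    square of \<open>\<Lambda> <= 2 * ln k\<close>.\<close>
  proof (rule that[of "c / 8" C K])
    fix k assume "K \<le> k"
    then have k: "2 \<le> k" "1 / \<epsilon> \<le> k" by (auto simp: K_def)
    define s where "s = exp (- 1 / real k)"
    define \<Lambda> where "\<Lambda> = ln (1 / (1 - s))"
    note b = scale_bounds[OF k(1), folded s_def, folded \<Lambda>_def]
    have lk: "0 < ln (real k)" using k by simp
    have "1 / real k \<le> \<epsilon>" using k c by (simp add: field_simps)
    then have *: "c * (1 - s) / \<Lambda>\<^sup>2 \<le> 2 * mass s - mass (s\<^sup>2)" "2 * mass s - mass (s\<^sup>2) \<le> C * (1 - s) / \<Lambda>\<^sup>2"
      using gap[of s] b k unfolding \<Lambda>_def by (auto simp: s_def)
    have "c / 8 / (k * (ln k)\<^sup>2) = c * (1 / (2 * k)) / (2 * ln k)\<^sup>2"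
      by (simp add: power_mult_distrib)
    also have "\<dots> \<le> c * (1 - s) / \<Lambda>\<^sup>2"
      using b lk c k by (intro frac_le mult_left_mono power_mono mult_nonneg_nonneg) auto
    finally show "c / 8 / (k * (ln k)\<^sup>2) \<le> gap k"
      using *(1) unfolding gap_def s_def[symmetric] by linarith
    have "C * (1 - s) / \<Lambda>\<^sup>2 \<le> C * (1 / k) / (ln k)\<^sup>2"
      using b lk c by (intro frac_le mult_left_mono power_mono mult_nonneg_nonneg) auto
    also have "\<dots> = C / (k * (ln k)\<^sup>2)" by simp
    finally show "gap k \<le> C / (k * (ln k)\<^sup>2)"
      using *(2) unfolding gap_def s_def[symmetric] by linarith
  qed (use c in \<open>auto simp: K_def\<close>)
qed

lemma cluster_tail_bounds:
  "\<exists>c C :: real. c > 0 \<and> C > 0 \<and> (\<forall>k \<beta>. k \<ge> 2 \<longrightarrow> (\<forall>n\<ge>1. \<beta> n > 0) \<longrightarrow> \<beta> \<longlonglongrightarrow> a / 2 \<longrightarrow>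
      (\<exists>L. (\<lambda>n. cluster_tail (1 / 2 - a) (\<beta> n) n k) \<longlonglongrightarrow> L \<and>
         c / (real k * (ln (real k))\<^sup>2) \<le> L \<and> L \<le> C / (real k * (ln (real k))\<^sup>2)))"
proof -
  obtain c C :: real and K :: nat where c: "0 < c" "0 < C" "2 \<le> K"
    and lo: "\<And>k. K \<le> k \<Longrightarrow> c / (k * (ln k)\<^sup>2) \<le> gap k"
    and up: "\<And>k. K \<le> k \<Longrightarrow> gap k \<le> C / (k * (ln k)\<^sup>2)"
    using mass_gap_scale by blast
  define e where "e = (1 - exp (- 1))\<^sup>2 * (1 :: real)"
  have e: "0 < e" by (simp add: e_def)
  \<comment> \<open>Makes the correction \<open>gap k / (e * M^2)\<close> at most half of the lower
    bound \<open>c / (4 * M * u k)\<close> for \<open>gap (M * k)\<close>.\<close>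
  define M where "M = max 2 (nat \<lceil>8 * C / (e * c)\<rceil>)"
  have M: "2 \<le> M" "8 * C / (e * c) \<le> M" by (auto simp: M_def) linarith
  \<comment> \<open>\<open>k >= M\<close> gives \<open>ln (M * k) <= 2 * ln k\<close>, hence
    \<open>u (M * k) <= 4 * M * u k\<close>.\<close>
  define N where "N = max K M"
  have N: "K \<le> N" "M \<le> N" "2 \<le> N" using c by (auto simp: N_def)
  define u where "u k = real k * (ln (real k))\<^sup>2" for k :: nat
  have u_pos: "0 < u k" if "2 \<le> k" for k using that by (simp add: u_def)
  have u_mono: "u k \<le> u k'" if "2 \<le> k" "k \<le> k'" for k k'
    unfolding u_def using that by (intro mult_mono power_mono) auto
  define c' where "c' = c / (8 * M)"
  have c': "0 < c'" using c M by (simp add: c'_def)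
  \<comment> \<open>The second entries here and in \<open>upper\<close> cover the finitely many
    \<open>k < N\<close>, where \<open>L k >= L N\<close> by monotonicity and
    \<open>L k <= 1 <= u N / u k\<close>.\<close>
  define lower where "lower = min c' (c' / u N * u 2)"
  define upper where "upper = max (C / e) (u N)"
  have pos: "0 < lower" "0 < upper"
    using c' u_pos[of 2] u_pos[OF N(3)] by (auto simp: lower_def upper_def less_max_iff_disj)
  have main: "\<exists>L. (\<lambda>n. cluster_tail (1 / 2 - a) (\<beta> n) n k) \<longlonglongrightarrow> L \<and> lower / u k \<le> L \<and> L \<le> upper / u k"
    if k: "2 \<le> k" and \<beta>: "\<And>n. 1 \<le> n \<Longrightarrow> 0 < \<beta> n" "\<beta> \<longlonglongrightarrow> a / 2" for k \<beta>
  proof -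
    obtain L where L: "\<And>k. (\<lambda>n. cluster_tail (1 / 2 - a) (\<beta> n) n k) \<longlonglongrightarrow> L k"
      and L1: "\<And>k. 1 \<le> k \<Longrightarrow> L k * (1 - exp (- 1))\<^sup>2 \<le> gap k"
      and L2: "\<And>k M. 1 \<le> k \<Longrightarrow> 1 \<le> M \<Longrightarrow>
        gap (M * k) \<le> L k + 1 / ((1 - exp (- 1))\<^sup>2 * (real M)\<^sup>2) * gap k"
      and L3: "\<And>k. L k \<le> 1" and L4: "\<And>k k'. k \<le> k' \<Longrightarrow> L k' \<le> L k"
      by (rule cluster_tail_limit[OF \<beta>]) blast+
    have upN: "L k \<le> C / e / u k" if "N \<le> k" for k
    proof -
      have "L k * e \<le> C / u k"
        using order_trans[OF L1 up, of k] that N by (simp add: e_def u_def)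
      then have "L k \<le> C / u k / e" using e by (simp only: pos_le_divide_eq)
      then show ?thesis by (simp add: mult.commute)
    qed
    have loN: "c' / u k \<le> L k" if "N \<le> k" for k
    proof -
      have k: "2 \<le> k" "K \<le> k" "M \<le> k" using that N by auto
      have uk: "0 < u k" by (rule u_pos[OF k(1)])
      have Mk: "2 \<le> M * k" "K \<le> M * k"
        using k M mult_le_mono[of 1 M K k] mult_le_mono[of 1 M 2 k] by auto
      have "u (M * k) \<le> 4 * M * u k"
      proof -
        have "ln (real (M * k)) = ln M + ln k" using k M by (simp add: ln_mult)
        also have "\<dots> \<le> 2 * ln k" using k M by simp
        finally have le: "ln (real (M * k)) \<le> 2 * ln k" .
        have "1 \<le> real (M * k)" using Mk by linarith
        then have "(ln (real (M * k)))\<^sup>2 \<le> (2 * ln k)\<^sup>2" by (intro power_mono le ln_ge_zero)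
        then have "real (M * k) * (ln (real (M * k)))\<^sup>2 \<le> real (M * k) * (2 * ln k)\<^sup>2"
          by (intro mult_left_mono) auto
        then show ?thesis by (simp add: u_def power_mult_distrib mult_ac)
      qed
      then have "c / (4 * M * u k) \<le> c / u (M * k)"
        using c M uk u_pos[OF Mk(1)] by (intro divide_left_mono) auto
      also have "\<dots> \<le> gap (M * k)"
        using lo[OF Mk(2)] by (simp add: u_def)
      also have "\<dots> \<le> L k + 1 / (e * (real M)\<^sup>2) * gap k"
        using L2[of k M] k M by (simp add: e_def)
      also have "\<dots> \<le> L k + 1 / (e * (real M)\<^sup>2) * (C / u k)"
        using up[OF k(2)] e by (intro add_left_mono mult_left_mono) (auto simp: u_def)
      also have "1 / (e * (real M)\<^sup>2) * (C / u k) \<le> c / (8 * M * u k)"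
      proof -
        have "8 * C \<le> M * (e * c)" using M(2) e c by (simp add: pos_divide_le_eq)
        then have "8 * C / (8 * e * (real M)\<^sup>2 * u k) \<le> M * (e * c) / (8 * e * (real M)\<^sup>2 * u k)"
          using e uk by (intro divide_right_mono) auto
        moreover have "8 * C / (8 * e * (real M)\<^sup>2 * u k) = 1 / (e * (real M)\<^sup>2) * (C / u k)" by simp
        moreover have "M * (e * c) / (8 * e * (real M)\<^sup>2 * u k) = c / (8 * M * u k)"
          using e M by (simp add: power2_eq_square)
        ultimately show ?thesis by simp
      qed
      finally have "c / (4 * M * u k) \<le> L k + c / (8 * M * u k)" by simp
      moreover have "c / (4 * M * u k) = 2 * (c' / u k)" "c / (8 * M * u k) = c' / u k"
        by (simp_all add: c'_def)
      ultimately show ?thesis by linarith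
    qed
    have uk: "0 < u k" by (rule u_pos[OF k])
    have "lower / u k \<le> L k \<and> L k \<le> upper / u k"
    proof (cases "N \<le> k")
      case True
      have "lower \<le> c'" "C / e \<le> upper" by (simp_all add: lower_def upper_def)
      then have "lower / u k \<le> c' / u k" "C / e / u k \<le> upper / u k"
        using uk by (intro divide_right_mono; simp)+
      then show ?thesis using loN[OF True] upN[OF True] by linarith
    next
      case False
      have "lower / u k \<le> (c' / u N * u 2) / u 2"
        using u_mono[of 2 k] k u_pos[of 2] u_pos[OF N(3)] c' by (intro frac_le) (auto simp: lower_def)
      also have "\<dots> = c' / u N" using u_pos[of 2] by simp
      also have "\<dots> \<le> L N" by (rule loN) simp
      also have "\<dots> \<le> L k" using False by (intro L4) simp
      finally have 1: "lower / u k \<le> L k" .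
      have "u k \<le> upper" using u_mono[OF k, of N] False by (simp add: upper_def)
      then have "1 \<le> upper / u k" using uk by simp
      then show ?thesis using 1 L3[of k] by linarith
    qed
    with L show ?thesis by blast
  qed
  show ?thesis
  proof (rule exI[of _ lower], rule exI[of _ upper], intro conjI allI impI pos)
    fix k :: nat and \<beta> :: "nat \<Rightarrow> real"
    assume "2 \<le> k" "\<forall>n\<ge>1. 0 < \<beta> n" "\<beta> \<longlonglongrightarrow> a / 2"
    then show "\<exists>L. (\<lambda>n. cluster_tail (1 / 2 - a) (\<beta> n) n k) \<longlonglongrightarrow> L \<and>
         lower / (real k * (ln (real k))\<^sup>2) \<le> L \<and> L \<le> upper / (real k * (ln (real k))\<^sup>2)"
      using main[of k \<beta>] by (simp add: u_def)
  qed
qed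

end

theorem theorem2p8:
  fixes \<gamma> :: real
  assumes "0 \<le> \<gamma>" and "\<gamma> < 1 / 2"
  shows "\<exists>c C :: real. c > 0 \<and> C > 0 \<and>
    (\<forall>k :: nat. \<forall>\<beta> :: nat \<Rightarrow> real.
      k \<ge> 2 \<longrightarrow> (\<forall>n\<ge>1. \<beta> n > 0) \<longrightarrow> \<beta> \<longlonglongrightarrow> 1 / 4 - \<gamma> / 2 \<longrightarrow>
      (\<exists>L :: real. (\<lambda>n. cluster_tail \<gamma> (\<beta> n) n k) \<longlonglongrightarrow> L \<and>
         c / (real k * (ln (real k))\<^sup>2) \<le> L \<and>
         L \<le> C / (real k * (ln (real k))\<^sup>2)))"
proof -
  interpret kernel "1 / 2 - \<gamma>" by standard (use assms in auto)
  have "(1 / 2 - \<gamma>) / 2 = 1 / 4 - \<gamma> / 2" "1 / 2 - (1 / 2 - \<gamma>) = \<gamma>" by (auto simp: field_simps)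
  with cluster_tail_bounds show ?thesis by simp
qed

end
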